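(* Let $\Omega\subset\mathbb R^N$ be a bounded open set. Let $(\kappa_n,\theta_n)$, $n\in\mathbb N$, and $(\kappa,\theta)$ be admissible pairs of measures, where $\kappa_n,\kappa$ are (positive) Borel measures on $\partial\Omega$ and $\theta_n,\theta$ are symmetric (positive) Radon measures on $(\partial\Omega\times\partial\Omega)\setminus d$, $d$ being the diagonal. Assume that $(\kappa_n,\theta_n)$ $\gamma$-converges to $(\kappa,\theta)$. Then $\Delta_{\kappa_n,\theta_n}$ converges to $\Delta_{\kappa,\theta}$ in the strong resolvent sense.
   Context: $C_c(\overline\Omega)$ is the space of continuous real-valued functions with compact support in $\overline\Omega$. The form $\mathcal E_{\kappa,\theta}$ has domain $$E=\Big\{u\in H^1(\Omega)\cap C_c(\overline\Omega):\int_{\partial\Omega}|u|^2\,d\kappa+\int_{(\partial\Omega\times\partial\Omega)\setminus d}(u(x)-u(y))^2\,d\theta(x,y)<\infty\Big\}$$ and is given by $$\mathcal E_{\kappa,\theta}(u,v)=\int_\Omega\nabla u\cdot\nabla v\,dx+\int_{\partial\Omega}uv\,d\kappa+\int_{(\partial\Omega\times\partial\Omega)\setminus d}(u(x)-u(y))(v(x)-v(y))\,d\theta(x,y).$$ $\widetilde H^1(\Omega)$ is the closure of $H^1(\Omega)\cap C_c(\overline\Omega)$ in $H^1(\Omega)$. The relative capacity of $A\subset\overline\Omega$ is $$\mathrm{Cap}_{\overline\Omega}(A)=\inf\{\|u\|_{H^1(\Omega)}: u\in\widetilde H^1(\Omega),\ \exists\,O\subset\mathbb R^N\text{ open},\ A\subset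 O,\ u\ge1\text{ a.e. on }\Omega\cap O\}.$$ $\hat\theta$ is the Borel measure on $\partial\Omega$ given by $\hat\theta(B)=\theta((B\times\partial\Omega)\setminus d)$. Let $$\Gamma_{\kappa,\theta}=\{z\in\partial\Omega:\exists r>0,\ \kappa(\partial\Omega\cap B(z,r))+\hat\theta(\partial\Omega\cap B(z,r))<\infty\}.$$ The pair $(\kappa,\theta)$ is admissible if for each Borel set $A\subset\Gamma_{\kappa,\theta}$, $\mathrm{Cap}_{\overline\Omega}(A)=0$ implies $(\kappa+\hat\theta)(A)=0$. When $(\kappa,\theta)$ is admissible the form $(\mathcal E_{\kappa,\theta},E)$ is closable in $L^2(\Omega)$; its closure is denoted $\overline{\mathcal E}_{\kappa,\theta}$, with domain $D(\overline{\mathcal E}_{\kappa,\theta})$, and $\overline{\mathcal E}_{\kappa,\theta}(u):=\overline{\mathcal E}_{\kappa,\theta}(u,u)$. The operator $-\Delta_{\kappa,\theta}$ is the self-adjoint operator on $L^2(\Omega)$ associated with $\overline{\mathcal E}_{\kappa,\theta}$: $D(\Delta_{\kappa,\theta})=\{u\in D(\overline{\mathcal E}_{\kappa,\theta}):\exists v\in L^2(\Omega),\ \overline{\mathcal E}_{\kappa,\theta}(u,\varphi)=(v,\varphi)_{L^2(\Omega)}\ \forall\varphi\in D(\overline{\mathcal E}_{\kappa,\theta})\}$, $\Delta_{\kappa,\theta}u=-v$. $\Gamma$-convergence: functions $F_n:X\to\overline{\mathbb R}$ on a metric space $X$ $\Gamma$-converge to $F:X\to\overline{\mathbb R}$ if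 (1) for every $u\in X$ and every sequence $u_n\to u$ in $X$, $F(u)\le\liminf_{n\to\infty}F_n(u_n)$; and (2) for every $u\in X$ there is a sequence $u_n\to u$ in $X$ with $F(u)=\limsup_{n\to\infty}F_n(u_n)$. For an admissible pair define $F_{\kappa,\theta}:L^2(\Omega)\to[0,\infty]$ by $F_{\kappa,\theta}(u)=\overline{\mathcal E}_{\kappa,\theta}(u)$ if $u\in D(\overline{\mathcal E}_{\kappa,\theta})$ and $F_{\kappa,\theta}(u)=\infty$ otherwise. $(\kappa_n,\theta_n)$ $\gamma$-converges to $(\kappa,\theta)$ if $F_{\kappa_n,\theta_n}$ $\Gamma$-converges to $F_{\kappa,\theta}$ in $L^2(\Omega)$. *)

theory Defs
  imports "HOL-Analysis.Analysis"
begin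

text \<open>
  \<^bold>\<open>Conventions.\<close>  \<open>\<real>\<^sup>N\<close> is an arbitrary Euclidean space \<open>'a\<close>, and \<open>\<partial>\<Omega>\<close> is \<open>frontier \<Omega>\<close>.
  Elements of \<open>L\<^sup>2(\<Omega>)\<close> are represented by functions \<open>'a \<Rightarrow> real\<close>, two functions standing for the same
  element iff they agree almost everywhere on \<open>\<Omega>\<close>, that is, iff their \<open>L\<^sup>2\<close>-distance is 0.  All
  notions below that concern \<open>L\<^sup>2(\<Omega>)\<close> respect this identification.
\<close>


subsection \<open>The space \<open>L\<^sup>2(\<Omega>)\<close>\<close>

definition L2_space :: "'a::euclidean_space set \<Rightarrow> ('a \<Rightarrow> real) set" where
  "L2_space \<Omega> =
     {u \<in> borel_measurable (lebesgue_on \<Omega>). integrable (lebesgue_on \<Omega>) (\<lambda>x. (u x)\<^sup>2)}"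

definition L2_inner :: "'a::euclidean_space set \<Rightarrow> ('a \<Rightarrow> real) \<Rightarrow> ('a \<Rightarrow> real) \<Rightarrow> real" where
  "L2_inner \<Omega> u v = (LINT x|lebesgue_on \<Omega>. u x * v x)"

definition L2_norm :: "'a::euclidean_space set \<Rightarrow> ('a \<Rightarrow> real) \<Rightarrow> real" where
  "L2_norm \<Omega> u = sqrt (L2_inner \<Omega> u u)"

definition L2_dist :: "'a::euclidean_space set \<Rightarrow> ('a \<Rightarrow> real) \<Rightarrow> ('a \<Rightarrow> real) \<Rightarrow> real" where
  "L2_dist \<Omega> u v = L2_norm \<Omega> (\<lambda>x. u x - v x)"


subsection \<open>The Sobolev space \<open>H\<^sup>1(\<Omega>)\<close>\<close>

primrec Ck :: "nat \<Rightarrow> ('a::euclidean_space \<Rightarrow> real) \<Rightarrow> bool" where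
  "Ck 0 f \<longleftrightarrow> continuous_on UNIV f"
| "Ck (Suc k) f \<longleftrightarrow>
     (\<forall>x. f differentiable (at x)) \<and> (\<forall>b\<in>Basis. Ck k (\<lambda>x. frechet_derivative f (at x) b))"

definition test_functions :: "'a::euclidean_space set \<Rightarrow> ('a \<Rightarrow> real) set" where
  "test_functions \<Omega> =
     {\<phi>. (\<forall>k. Ck k \<phi>) \<and> compact (closure (support_on UNIV \<phi>)) \<and> closure (support_on UNIV \<phi>) \<subseteq> \<Omega>}"

definition is_L2_weak_gradient ::
    "'a::euclidean_space set \<Rightarrow> ('a \<Rightarrow> real) \<Rightarrow> ('a \<Rightarrow> 'a) \<Rightarrow> bool" where
  "is_L2_weak_gradient \<Omega> u g \<longleftrightarrow>
     g \<in> borel_measurable (lebesgue_on \<Omega>) \<and>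
     integrable (lebesgue_on \<Omega>) (\<lambda>x. (norm (g x))\<^sup>2) \<and>
     (\<forall>\<phi>\<in>test_functions \<Omega>. \<forall>b\<in>Basis.
        (LINT x|lebesgue_on \<Omega>. u x * frechet_derivative \<phi> (at x) b)
          = - (LINT x|lebesgue_on \<Omega>. (g x \<bullet> b) * \<phi> x))"

definition H1 :: "'a::euclidean_space set \<Rightarrow> ('a \<Rightarrow> real) set" where
  "H1 \<Omega> = {u \<in> L2_space \<Omega>. \<exists>g. is_L2_weak_gradient \<Omega> u g}"

text \<open>For \<open>u \<in> H\<^sup>1(\<Omega>)\<close> the weak gradient is unique up to equality a.e. on \<open>\<Omega>\<close>.\<close>

definition weak_gradient :: "'a::euclidean_space set \<Rightarrow> ('a \<Rightarrow> real) \<Rightarrow> 'a \<Rightarrow> 'a" where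
  "weak_gradient \<Omega> u = (SOME g. is_L2_weak_gradient \<Omega> u g)"

definition H1_norm :: "'a::euclidean_space set \<Rightarrow> ('a \<Rightarrow> real) \<Rightarrow> real" where
  "H1_norm \<Omega> u =
     sqrt ((LINT x|lebesgue_on \<Omega>. (u x)\<^sup>2) + (LINT x|lebesgue_on \<Omega>. (norm (weak_gradient \<Omega> u x))\<^sup>2))"

text \<open>\<open>C\<^sub>c(closure \<Omega>)\<close>; the values of such a function outside \<open>closure \<Omega>\<close> are irrelevant.\<close>

definition Cc_closure :: "'a::euclidean_space set \<Rightarrow> ('a \<Rightarrow> real) set" where
  "Cc_closure \<Omega> =
     {u. continuous_on (closure \<Omega>) u \<and> compact (closure (support_on (closure \<Omega>) u))}"

definition H1_tilde :: "'a::euclidean_space set \<Rightarrow> ('a \<Rightarrow> real) set" where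
  "H1_tilde \<Omega> =
     {u \<in> H1 \<Omega>. \<exists>us. (\<forall>n. us n \<in> H1 \<Omega> \<inter> Cc_closure \<Omega>) \<and>
        (\<lambda>n. H1_norm \<Omega> (\<lambda>x. us n x - u x)) \<longlonglongrightarrow> 0}"

definition rel_capacity :: "'a::euclidean_space set \<Rightarrow> 'a set \<Rightarrow> ennreal" where
  "rel_capacity \<Omega> A =
     Inf {ennreal (H1_norm \<Omega> u) |u. u \<in> H1_tilde \<Omega> \<and>
       (\<exists>U. open U \<and> A \<subseteq> U \<and> (AE x in lebesgue_on (\<Omega> \<inter> U). 1 \<le> u x))}"


subsection \<open>Measures on the boundary and admissible pairs\<close>

definition boundary_borel_measure :: "'a::euclidean_space set \<Rightarrow> 'a measure \<Rightarrow> bool" where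
  "boundary_borel_measure \<Omega> \<kappa> \<longleftrightarrow> sets \<kappa> = sets (restrict_space borel (frontier \<Omega>))"

definition off_diagonal :: "'a::euclidean_space set \<Rightarrow> ('a \<times> 'a) set" where
  "off_diagonal \<Omega> = frontier \<Omega> \<times> frontier \<Omega> - Id"

text \<open>
  A Radon measure is finite on compact sets and inner regular.  (The second property is automatic
  here, since \<open>off_diagonal \<Omega>\<close> is locally compact and separable metrizable.)
\<close>

definition symmetric_radon_measure :: "'a::euclidean_space set \<Rightarrow> ('a \<times> 'a) measure \<Rightarrow> bool" where
  "symmetric_radon_measure \<Omega> \<theta> \<longleftrightarrow>
     sets \<theta> = sets (restrict_space borel (off_diagonal \<Omega>)) \<and>
     (\<forall>K. compact K \<and> K \<subseteq> off_diagonal \<Omega> \<longrightarrow> emeasure \<theta> K < \<infinity>) \<and>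
     (\<forall>B\<in>sets \<theta>. emeasure \<theta> B = (SUP K\<in>{K. compact K \<and> K \<subseteq> B}. emeasure \<theta> K)) \<and>
     (\<forall>B\<in>sets \<theta>. emeasure \<theta> (prod.swap ` B) = emeasure \<theta> B)"

definition theta_hat :: "'a::euclidean_space set \<Rightarrow> ('a \<times> 'a) measure \<Rightarrow> 'a set \<Rightarrow> ennreal" where
  "theta_hat \<Omega> \<theta> B = emeasure \<theta> (B \<times> frontier \<Omega> - Id)"

definition locally_finite_part ::
    "'a::euclidean_space set \<Rightarrow> 'a measure \<Rightarrow> ('a \<times> 'a) measure \<Rightarrow> 'a set" where
  "locally_finite_part \<Omega> \<kappa> \<theta> =
     {z \<in> frontier \<Omega>. \<exists>r>0.
        emeasure \<kappa> (frontier \<Omega> \<inter> ball z r) + theta_hat \<Omega> \<theta> (frontier \<Omega> \<inter> ball z r) < \<infinity>}"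

definition admissible_pair ::
    "'a::euclidean_space set \<Rightarrow> 'a measure \<Rightarrow> ('a \<times> 'a) measure \<Rightarrow> bool" where
  "admissible_pair \<Omega> \<kappa> \<theta> \<longleftrightarrow>
     boundary_borel_measure \<Omega> \<kappa> \<and> symmetric_radon_measure \<Omega> \<theta> \<and>
     (\<forall>A\<in>sets borel. A \<subseteq> locally_finite_part \<Omega> \<kappa> \<theta> \<and> rel_capacity \<Omega> A = 0 \<longrightarrow>
        emeasure \<kappa> A + theta_hat \<Omega> \<theta> A = 0)"


subsection \<open>The form and its closure\<close>

definition form_domain ::
    "'a::euclidean_space set \<Rightarrow> 'a measure \<Rightarrow> ('a \<times> 'a) measure \<Rightarrow> ('a \<Rightarrow> real) set" where
  "form_domain \<Omega> \<kappa> \<theta> =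
     {u \<in> H1 \<Omega> \<inter> Cc_closure \<Omega>.
        (\<integral>\<^sup>+x. ennreal ((u x)\<^sup>2) \<partial>\<kappa>) + (\<integral>\<^sup>+(x, y). ennreal ((u x - u y)\<^sup>2) \<partial>\<theta>) < \<infinity>}"

definition bdry_form ::
    "'a::euclidean_space set \<Rightarrow> 'a measure \<Rightarrow> ('a \<times> 'a) measure
      \<Rightarrow> ('a \<Rightarrow> real) \<Rightarrow> ('a \<Rightarrow> real) \<Rightarrow> real" where
  "bdry_form \<Omega> \<kappa> \<theta> u v =
     (LINT x|lebesgue_on \<Omega>. weak_gradient \<Omega> u x \<bullet> weak_gradient \<Omega> v x)
     + (LINT x|\<kappa>. u x * v x)
     + (LINT (x, y)|\<theta>. (u x - u y) * (v x - v y))"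

definition approximates ::
    "'a::euclidean_space set \<Rightarrow> 'a measure \<Rightarrow> ('a \<times> 'a) measure
      \<Rightarrow> (nat \<Rightarrow> 'a \<Rightarrow> real) \<Rightarrow> ('a \<Rightarrow> real) \<Rightarrow> bool" where
  "approximates \<Omega> \<kappa> \<theta> us u \<longleftrightarrow>
     (\<forall>n. us n \<in> form_domain \<Omega> \<kappa> \<theta>) \<and>
     (\<lambda>n. L2_dist \<Omega> (us n) u) \<longlonglongrightarrow> 0 \<and>
     (\<forall>e>0. \<exists>M. \<forall>m\<ge>M. \<forall>n\<ge>M.
        bdry_form \<Omega> \<kappa> \<theta> (\<lambda>x. us m x - us n x) (\<lambda>x. us m x - us n x) < e)"

definition closure_domain ::
    "'a::euclidean_space set \<Rightarrow> 'a measure \<Rightarrow> ('a \<times> 'a) measure \<Rightarrow> ('a \<Rightarrow> real) set" where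
  "closure_domain \<Omega> \<kappa> \<theta> = {u \<in> L2_space \<Omega>. \<exists>us. approximates \<Omega> \<kappa> \<theta> us u}"

text \<open>The limit below always exists; closability says that it is independent of \<open>us\<close> and \<open>vs\<close>.\<close>

definition closure_form ::
    "'a::euclidean_space set \<Rightarrow> 'a measure \<Rightarrow> ('a \<times> 'a) measure
      \<Rightarrow> ('a \<Rightarrow> real) \<Rightarrow> ('a \<Rightarrow> real) \<Rightarrow> real" where
  "closure_form \<Omega> \<kappa> \<theta> u v =
     (THE r. \<forall>us vs. approximates \<Omega> \<kappa> \<theta> us u \<and> approximates \<Omega> \<kappa> \<theta> vs v \<longrightarrow>
        (\<lambda>n. bdry_form \<Omega> \<kappa> \<theta> (us n) (vs n)) \<longlonglongrightarrow> r)"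


subsection \<open>The operator \<open>\<Delta>\<close> and strong resolvent convergence\<close>

text \<open>
  Operators on \<open>L\<^sup>2(\<Omega>)\<close> are given by their graphs; \<open>(u, w) \<in> laplacian \<Omega> \<kappa> \<theta>\<close> means that \<open>u\<close> is in
  the domain and that \<open>w\<close> is a representative of the image of \<open>u\<close>.
\<close>

definition laplacian ::
    "'a::euclidean_space set \<Rightarrow> 'a measure \<Rightarrow> ('a \<times> 'a) measure
      \<Rightarrow> (('a \<Rightarrow> real) \<times> ('a \<Rightarrow> real)) set" where
  "laplacian \<Omega> \<kappa> \<theta> =
     {(u, \<lambda>x. - v x) |u v. u \<in> closure_domain \<Omega> \<kappa> \<theta> \<and> v \<in> L2_space \<Omega> \<and>
        (\<forall>\<phi>\<in>closure_domain \<Omega> \<kappa> \<theta>. closure_form \<Omega> \<kappa> \<theta> u \<phi> = L2_inner \<Omega> v \<phi>)}"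

definition solves_resolvent ::
    "'a::euclidean_space set \<Rightarrow> (('a \<Rightarrow> real) \<times> ('a \<Rightarrow> real)) set \<Rightarrow> real
      \<Rightarrow> ('a \<Rightarrow> real) \<Rightarrow> ('a \<Rightarrow> real) \<Rightarrow> bool" where
  "solves_resolvent \<Omega> A \<mu> f u \<longleftrightarrow>
     (\<exists>w. (u, w) \<in> A \<and> (AE x in lebesgue_on \<Omega>. \<mu> * u x - w x = f x))"

definition in_resolvent_set ::
    "'a::euclidean_space set \<Rightarrow> (('a \<Rightarrow> real) \<times> ('a \<Rightarrow> real)) set \<Rightarrow> real \<Rightarrow> bool" where
  "in_resolvent_set \<Omega> A \<mu> \<longleftrightarrow>
     (\<forall>f\<in>L2_space \<Omega>. \<exists>u. solves_resolvent \<Omega> A \<mu> f u) \<and>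
     (\<forall>f\<in>L2_space \<Omega>. \<forall>u u'. solves_resolvent \<Omega> A \<mu> f u \<and> solves_resolvent \<Omega> A \<mu> f u' \<longrightarrow>
        (AE x in lebesgue_on \<Omega>. u x = u' x)) \<and>
     (\<exists>C. \<forall>f\<in>L2_space \<Omega>. \<forall>u. solves_resolvent \<Omega> A \<mu> f u \<longrightarrow> L2_norm \<Omega> u \<le> C * L2_norm \<Omega> f)"

text \<open>A representative of \<open>(\<mu> - A)\<^sup>-\<^sup>1 f\<close>.\<close>

definition resolvent ::
    "'a::euclidean_space set \<Rightarrow> (('a \<Rightarrow> real) \<times> ('a \<Rightarrow> real)) set \<Rightarrow> real
      \<Rightarrow> ('a \<Rightarrow> real) \<Rightarrow> 'a \<Rightarrow> real" where
  "resolvent \<Omega> A \<mu> f = (SOME u. solves_resolvent \<Omega> A \<mu> f u)"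

text \<open>
  Strong resolvent convergence of nonpositive self-adjoint operators on the real space \<open>L\<^sup>2(\<Omega>)\<close>:
  every \<open>\<mu> > 0\<close> belongs to the resolvent sets (for the members of the sequence, from some index on)
  and the resolvents converge strongly.
\<close>

definition strong_resolvent_converges ::
    "'a::euclidean_space set \<Rightarrow> (nat \<Rightarrow> (('a \<Rightarrow> real) \<times> ('a \<Rightarrow> real)) set)
      \<Rightarrow> (('a \<Rightarrow> real) \<times> ('a \<Rightarrow> real)) set \<Rightarrow> bool" where
  "strong_resolvent_converges \<Omega> A\<^sub>n A \<longleftrightarrow>
     (\<forall>\<mu>>0. in_resolvent_set \<Omega> A \<mu> \<and>
        (\<forall>\<^sub>F n in sequentially. in_resolvent_set \<Omega> (A\<^sub>n n) \<mu>) \<and>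
        (\<forall>f\<in>L2_space \<Omega>.
           (\<lambda>n. L2_dist \<Omega> (resolvent \<Omega> (A\<^sub>n n) \<mu> f) (resolvent \<Omega> A \<mu> f)) \<longlonglongrightarrow> 0))"


subsection \<open>\<open>\<Gamma>\<close>- and \<open>\<gamma>\<close>-convergence\<close>

text \<open>
  \<open>X\<close> is the carrier of a (pseudo)metric space with distance \<open>d\<close>.
\<close>

definition Gamma_converges ::
    "'x set \<Rightarrow> ('x \<Rightarrow> 'x \<Rightarrow> real) \<Rightarrow> (nat \<Rightarrow> 'x \<Rightarrow> ereal) \<Rightarrow> ('x \<Rightarrow> ereal) \<Rightarrow> bool" where
  "Gamma_converges X d Fn F \<longleftrightarrow>
     (\<forall>u\<in>X. \<forall>us. (\<forall>n. us n \<in> X) \<and> (\<lambda>n. d (us n) u) \<longlonglongrightarrow> 0 \<longrightarrow>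
        F u \<le> liminf (\<lambda>n. Fn n (us n))) \<and>
     (\<forall>u\<in>X. \<exists>us. (\<forall>n. us n \<in> X) \<and> (\<lambda>n. d (us n) u) \<longlonglongrightarrow> 0 \<and>
        F u = limsup (\<lambda>n. Fn n (us n)))"

definition energy_functional ::
    "'a::euclidean_space set \<Rightarrow> 'a measure \<Rightarrow> ('a \<times> 'a) measure \<Rightarrow> ('a \<Rightarrow> real) \<Rightarrow> ereal" where
  "energy_functional \<Omega> \<kappa> \<theta> u =
     (if u \<in> closure_domain \<Omega> \<kappa> \<theta> then ereal (closure_form \<Omega> \<kappa> \<theta> u u) else \<infinity>)"

definition gamma_converges ::
    "'a::euclidean_space set \<Rightarrow> (nat \<Rightarrow> 'a measure) \<Rightarrow> (nat \<Rightarrow> ('a \<times> 'a) measure)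
      \<Rightarrow> 'a measure \<Rightarrow> ('a \<times> 'a) measure \<Rightarrow> bool" where
  "gamma_converges \<Omega> \<kappa>\<^sub>n \<theta>\<^sub>n \<kappa> \<theta> \<longleftrightarrow>
     Gamma_converges (L2_space \<Omega>) (L2_dist \<Omega>)
       (\<lambda>n. energy_functional \<Omega> (\<kappa>\<^sub>n n) (\<theta>\<^sub>n n)) (energy_functional \<Omega> \<kappa> \<theta>)"

end

theory Submission
  imports Defs "HOL-Library.Diagonal_Subsequence"
begin

text \<open>
  The resolvent \<open>(\<mu> - \<Delta>)\<^sup>-\<^sup>1 f\<close> minimizes \<open>F(v) + \<mu> \<parallel>v\<parallel>\<^sup>2 - 2 (f, v)\<close>, so \<open>\<Gamma>\<close>-convergence identifies every
  strong limit of the approximating resolvents; what has to be supplied is strong precompactness, which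
  \<open>\<Gamma>\<close>-convergence in the norm topology does not give.  It comes from the Markov property: truncation
  decreases the form, so a bounded \<open>f\<close> has uniformly bounded resolvents, and a uniformly bounded sequence
  that is bounded in \<open>H\<^sup>1(\<Omega>)\<close> is precompact in \<open>L\<^sup>2(\<Omega>)\<close>, by interior compactness and because no mass
  can concentrate at the boundary.  General \<open>f\<close> follow by density, since the resolvents are bounded by
  \<open>1 / \<mu>\<close>.  Closability is not taken from admissibility, but from the \<open>\<Gamma>\<close>-convergence itself.
\<close>

subsection \<open>Smooth test functions\<close>

text \<open>Derivatives are handled by duality throughout: \<open>weak_deriv_bound\<close> limits
  the pairings of u with directional derivatives of test functions. Such a bound survives L^2
  limits, so it is available on the closure domain even before the closed form makes sense. It
  controls translation differences and is controlled by them, and this yields both truncation and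
  compactness. Riesz representation turns it back into a weak gradient when the form itself has to
  be evaluated. Closability needs an argument because the closed form is a definite description. The
  witness against a nonclosable form is the indicator of a box: it is an L^2 limit of test
  functions, which belong to all the form domains, but it has no square integrable weak derivative.
  Weak gradients and resolvents are arbitrary choices, determined only almost everywhere. Hence
  identities for gradients go through uniqueness almost everywhere, and the pointwise bounded
  solutions needed for compactness are constructed separately and then compared with the chosen
  resolvents.\<close>

lemma Ck_imp_continuous: "Ck k f \<Longrightarrow> continuous_on UNIV f"
  by (cases k) (auto simp: continuous_at_imp_continuous_on differentiable_imp_continuous_within)

lemma Ck_SucD: "Ck (Suc k) f \<Longrightarrow> Ck k f"
proof (induction k arbitrary: f)
  case 0
  then show ?case using Ck_imp_continuous[of "Suc 0" f] by simp
next
  case (Suc k)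
  have "Ck k (\<lambda>x. frechet_derivative f (at x) b)" if "b \<in> Basis" for b
    using Suc.prems that by (intro Suc.IH) auto
  then show ?case using Suc.prems by simp
qed

lemma Ck_const: "Ck k (\<lambda>x::'a::euclidean_space. c)"
proof (induction k arbitrary: c)
  case (Suc k)
  have "(\<lambda>x. frechet_derivative (\<lambda>x::'a. c) (at x) b) = (\<lambda>x. 0)" for b
    by simp
  then show ?case using Suc[of 0] by simp
qed simp

lemma Ck_add: "Ck k f \<Longrightarrow> Ck k g \<Longrightarrow> Ck k (\<lambda>x. f x + g x)"
proof (induction k arbitrary: f g)
  case (Suc k)
  have "frechet_derivative (\<lambda>x. f x + g x) (at x) b
     = frechet_derivative f (at x) b + frechet_derivative g (at x) b" for x b
  proof -
    have "f differentiable (at x)" "g differentiable (at x)" using Suc.prems by auto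
    then have "(f has_derivative frechet_derivative f (at x)) (at x)"
      "(g has_derivative frechet_derivative g (at x)) (at x)"
      by (simp_all add: frechet_derivative_works[symmetric])
    from frechet_derivative_at[OF has_derivative_add[OF this]]
    show ?thesis by (metis)
  qed
  then show ?case using Suc by simp
qed (auto intro: continuous_intros)

lemma Ck_mult: "Ck k f \<Longrightarrow> Ck k g \<Longrightarrow> Ck k (\<lambda>x. f x * g x)"
proof (induction k arbitrary: f g)
  case (Suc k)
  have d: "frechet_derivative (\<lambda>x. f x * g x) (at x) b
     = f x * frechet_derivative g (at x) b + frechet_derivative f (at x) b * g x" for x b
  proof -
    have "f differentiable (at x)" "g differentiable (at x)" using Suc.prems by auto
    then have "(f has_derivative frechet_derivative f (at x)) (at x)"
      "(g has_derivative frechet_derivative g (at x)) (at x)"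
      by (simp_all add: frechet_derivative_works[symmetric])
    from frechet_derivative_at[OF has_derivative_mult[OF this]]
    show ?thesis by metis
  qed
  show ?case
    using Suc.prems Suc.IH Ck_SucD[OF Suc.prems(1)] Ck_SucD[OF Suc.prems(2)]
    by (auto simp: d intro!: Ck_add)
qed (auto intro: continuous_intros)

lemma Ck_cmult: "Ck k f \<Longrightarrow> Ck k (\<lambda>x. c * f x)"
  by (intro Ck_mult Ck_const)

lemma Ck_prod: "(\<And>i. i \<in> I \<Longrightarrow> Ck k (f i)) \<Longrightarrow> Ck k (\<lambda>x. \<Prod>i\<in>I. f i x)"
  by (induction I rule: infinite_finite_induct) (auto intro: Ck_const Ck_mult)

lemma frechet_derivative_translate:
  assumes "f differentiable (at (x - a))"
  shows "(\<lambda>x. f (x - a)) differentiable (at x)"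
    and "frechet_derivative (\<lambda>x. f (x - a)) (at x) = frechet_derivative f (at (x - a))"
proof -
  have "((\<lambda>x. f (x - a)) has_derivative frechet_derivative f (at (x - a))) (at x)"
  proof (rule has_derivative_compose[of "\<lambda>x. x - a" "\<lambda>x. x"])
    show "((\<lambda>x. x - a) has_derivative (\<lambda>x. x)) (at x)" by (auto intro!: derivative_eq_intros)
    show "(f has_derivative frechet_derivative f (at (x - a))) (at (x - a))"
      using assms by (simp add: frechet_derivative_works[symmetric])
  qed
  then show "(\<lambda>x. f (x - a)) differentiable (at x)"
    and "frechet_derivative (\<lambda>x. f (x - a)) (at x) = frechet_derivative f (at (x - a))"
    by (auto simp: differentiable_def frechet_derivative_at[symmetric])
qed

lemma Ck_translate: "Ck k f \<Longrightarrow> Ck k (\<lambda>x. f (x - a))"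
proof (induction k arbitrary: f)
  case 0
  then show ?case by (auto intro!: continuous_on_compose2[of UNIV f] continuous_intros)
next
  case (Suc k)
  have d: "f differentiable at x" for x using Suc.prems by simp
  have "Ck k (\<lambda>x. frechet_derivative f (at (x - a)) b)" if "b \<in> Basis" for b
    using Suc.IH[of "\<lambda>x. frechet_derivative f (at x) b"] Suc.prems that by simp
  then show ?case
    using d by (simp add: frechet_derivative_translate)
qed

section \<open>Flat exponentials and smooth bumps on boxes\<close>

definition flat_exp :: "nat \<Rightarrow> real \<Rightarrow> real" where
  "flat_exp m t = (if t > 0 then exp (- 1 / t) / t ^ m else 0)"

lemma power_le_fact_exp:
  fixes x :: real assumes "x \<ge> 0" shows "x ^ n \<le> fact n * exp x"
proof -
  have "x ^ n /\<^sub>R fact n \<le> exp x"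
    unfolding exp_def using assms sum_le_suminf[OF summable_exp_generic[of x], of "{n}"] by auto
  then show ?thesis by (simp add: field_simps)
qed

text \<open>This is (1/t)^(m+1) \<le> (m+1)! exp (1/t), rearranged. The linear decay at 0 makes the
  difference quotients there vanish.\<close>

lemma flat_exp_le: "0 < t \<Longrightarrow> flat_exp m t \<le> fact (Suc m) * t"
  using power_le_fact_exp[of "1 / t" "Suc m"]
  by (simp add: flat_exp_def exp_minus field_simps)

text \<open>The powers of t are carried along because exp (-1/t) alone is not closed under
  differentiation, while this family is: all derivatives are linear combinations of its members, so
  one induction on the order gives smoothness, including at 0.\<close>

lemma DERIV_flat_exp:
  "(flat_exp m has_real_derivative (flat_exp (m + 2) t - m * flat_exp (m + 1) t)) (at t)"
proof (cases t "0::real" rule: linorder_cases)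
  case less
  have "((\<lambda>_. 0) has_real_derivative 0) (at t)" by simp
  then have "(flat_exp m has_real_derivative 0) (at t)"
    by (rule DERIV_cong_ev[THEN iffD1, rotated -1])
       (use less eventually_at_topological in
         \<open>auto simp: flat_exp_def eventually_nhds intro!: exI[of _ "{..<0}"]\<close>)
  then show ?thesis using less by (simp add: flat_exp_def)
next
  case greater
  have eq: "m * t ^ (m - 1) * (t * t) = m * (t * t ^ m)"
    by (cases m) auto
  have "((\<lambda>t. exp (- 1 / t) / t ^ m) has_real_derivative
          flat_exp (m + 2) t - m * flat_exp (m + 1) t) (at t)"
    using greater
    apply (auto intro!: derivative_eq_intros simp: flat_exp_def field_simps power2_eq_square)
    using eq by (simp add: algebra_simps)
  then show ?thesis
    by (rule DERIV_cong_ev[THEN iffD1, rotated -1])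
       (use greater in \<open>auto simp: flat_exp_def eventually_nhds intro!: exI[of _ "{0<..}"]\<close>)
next
  case equal
  \<comment> \<open>At 0 the difference quotient of member m is member m + 1, which is O(h).\<close>
  have "((\<lambda>h. flat_exp m h / h) \<longlongrightarrow> 0) (at 0)"
  proof (rule Lim_null_comparison)
    show "\<forall>\<^sub>F h in at 0. norm (flat_exp m h / h) \<le> fact (Suc (Suc m)) * \<bar>h\<bar>"
    proof (rule always_eventually, rule allI)
      fix h :: real
      have e: "flat_exp m h / h = flat_exp (Suc m) h" by (simp add: flat_exp_def field_simps)
      have "0 \<le> flat_exp (Suc m) h" "h \<le> 0 \<Longrightarrow> flat_exp (Suc m) h = 0" by (auto simp: flat_exp_def)
      then show "norm (flat_exp m h / h) \<le> fact (Suc (Suc m)) * \<bar>h\<bar>"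
        unfolding e using flat_exp_le[of h "Suc m"] 
        by (cases "h > 0") (simp_all add: mult_le_0_iff del: fact_Suc)
    qed
    show "((\<lambda>h::real. fact (Suc (Suc m)) * \<bar>h\<bar>) \<longlongrightarrow> 0) (at 0)"
      by (intro tendsto_eq_intros) auto
  qed
  then show ?thesis using equal by (simp add: DERIV_def flat_exp_def)
qed

text \<open>The index m is generalized in the induction since the derivative mixes the members m + 1
  and m + 2. An affine argument covers both kinds of factors in \<open>bump\<close>.\<close>

lemma Ck_flat_exp_affine:
  "Ck k (\<lambda>x::'a::euclidean_space. flat_exp m (x \<bullet> v + c))"
proof (induction k arbitrary: m)
  case 0
  have "isCont (flat_exp m) t" for t using DERIV_flat_exp DERIV_isCont by blast
  then have "continuous_on UNIV (flat_exp m)" by (simp add: continuous_at_imp_continuous_on)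
  then show ?case by (auto intro!: continuous_on_compose2[of UNIV "flat_exp m"] continuous_intros)
next
  case (Suc k)
  have h: "((\<lambda>x. flat_exp m (x \<bullet> v + c)) has_derivative
     (\<lambda>b. (b \<bullet> v) * (flat_exp (m + 2) (x \<bullet> v + c) - m * flat_exp (m + 1) (x \<bullet> v + c)))) (at x)" for x
    by (rule has_derivative_eq_rhs,
        rule DERIV_compose_FDERIV[OF DERIV_flat_exp, of "\<lambda>x. x \<bullet> v + c"])
       (auto intro!: derivative_eq_intros)
  have "Ck k (\<lambda>x. frechet_derivative (\<lambda>x. flat_exp m (x \<bullet> v + c)) (at x) b)" for b
  proof -
    have "Ck k (\<lambda>x. (b \<bullet> v) * (flat_exp (m + 2) (x \<bullet> v + c) + (- m) * flat_exp (m + 1) (x \<bullet> v + c)))"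
      by (intro Ck_cmult Ck_add Suc)
    then show ?thesis unfolding frechet_derivative_at[OF h, symmetric] by simp
  qed
  moreover have "(\<lambda>x. flat_exp m (x \<bullet> v + c)) differentiable (at x)" for x
    using h differentiable_def by blast
  ultimately show ?case by simp
qed

text \<open>For k > 0 this product of one-dimensional flat exponentials is positive exactly on the
  open box. As k grows, every factor tends to 1 inside the box, so the indicator of the box is a
  bounded pointwise limit of smooth functions. Boxes rather than balls fit the differentiation
  theorem in \<open>fundamental_lemma\<close>.\<close>

definition bump :: "real \<Rightarrow> 'a::euclidean_space \<Rightarrow> 'a \<Rightarrow> 'a \<Rightarrow> real" where
  "bump k p q x =
     (\<Prod>b\<in>Basis. flat_exp 0 (k * (x \<bullet> b - p \<bullet> b)) * flat_exp 0 (k * (q \<bullet> b - x \<bullet> b)))"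

lemma flat_exp_0_bounds: "0 \<le> flat_exp 0 t" "flat_exp 0 t \<le> 1"
  by (auto simp: flat_exp_def)

lemma bump_bounds: "0 \<le> bump k p q x" "bump k p q x \<le> 1"
  unfolding bump_def
  by (auto intro!: prod_nonneg prod_le_1 mult_le_one simp: flat_exp_0_bounds)

lemma bump_outside: "0 < k \<Longrightarrow> x \<notin> box p q \<Longrightarrow> bump k p q x = 0"
  by (force simp: bump_def flat_exp_def mem_box prod_zero_iff not_less zero_less_mult_iff)

lemma bump_tendsto:
  "(\<lambda>n. bump (real (Suc n)) p q x) \<longlonglongrightarrow> indicator (box p q) x"
proof (cases "x \<in> box p q")
  case True
  have f: "(\<lambda>n. flat_exp 0 (real (Suc n) * t)) \<longlonglongrightarrow> 1" if "t > 0" for t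
  proof -
    have "(\<lambda>n. exp (- (1 / t) * inverse (real (Suc n)))) \<longlonglongrightarrow> exp (- (1 / t) * 0)"
      by (intro tendsto_intros LIMSEQ_inverse_real_of_nat)
    moreover have "0 < t + t * real n" for n using that by (simp add: add_pos_nonneg)
    ultimately show ?thesis using that by (simp add: flat_exp_def field_simps)
  qed
  have "(\<lambda>n. bump (real (Suc n)) p q x) \<longlonglongrightarrow> (\<Prod>b\<in>(Basis::'a set). 1 * 1)"
    unfolding bump_def using True by (intro tendsto_intros f) (auto simp: mem_box)
  then show ?thesis using True by simp
next
  case False
  then show ?thesis by (simp add: bump_outside)
qed

lemma Ck_bump: "Ck j (bump k p q)"
proof -
  have 1: "Ck j (\<lambda>x. flat_exp 0 (k * (x \<bullet> b - p \<bullet> b)))" for b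
    using Ck_flat_exp_affine[of j 0 "k *\<^sub>R b" "- k * (p \<bullet> b)"] by (simp add: algebra_simps)
  have 2: "Ck j (\<lambda>x. flat_exp 0 (k * (q \<bullet> b - x \<bullet> b)))" for b
    using Ck_flat_exp_affine[of j 0 "(- k) *\<^sub>R b" "k * (q \<bullet> b)"] by (simp add: algebra_simps)
  show ?thesis unfolding bump_def by (intro Ck_prod Ck_mult 1 2)
qed

section \<open>Calculus, supports and closure properties of test functions\<close>

abbreviation dderiv :: "('a::euclidean_space \<Rightarrow> real) \<Rightarrow> 'a \<Rightarrow> 'a \<Rightarrow> real" where
  "dderiv f y x \<equiv> frechet_derivative f (at x) y"

lemma test_function_differentiable:
  "\<phi> \<in> test_functions \<Omega> \<Longrightarrow> \<phi> differentiable (at x)"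
  by (auto simp: test_functions_def dest: spec[of _ "Suc 0"])

lemma test_function_has_derivative:
  "\<phi> \<in> test_functions \<Omega> \<Longrightarrow> (\<phi> has_derivative frechet_derivative \<phi> (at x)) (at x)"
  by (simp add: test_function_differentiable frechet_derivative_works[symmetric])

lemma test_function_continuous: "\<phi> \<in> test_functions \<Omega> \<Longrightarrow> continuous_on UNIV \<phi>"
  using Ck_imp_continuous by (auto simp: test_functions_def)

text \<open>\<open>Ck\<close> speaks of partial derivatives along \<open>Basis\<close> only; this
  carries continuity and the weak gradient identity over to any direction.\<close>

lemma dderiv_eq_sum:
  assumes "\<phi> differentiable (at x)"
  shows "dderiv \<phi> y x = (\<Sum>b\<in>Basis. (y \<bullet> b) * dderiv \<phi> b x)"
proof -
  have l: "linear (frechet_derivative \<phi> (at x))"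
    using assms by (rule linear_frechet_derivative)
  have "dderiv \<phi> y x = frechet_derivative \<phi> (at x) (\<Sum>b\<in>Basis. (y \<bullet> b) *\<^sub>R b)"
    by (simp add: euclidean_representation)
  then show ?thesis by (simp add: linear_sum[OF l] linear_cmul[OF l] o_def)
qed

lemma test_function_dderiv_continuous:
  assumes "\<phi> \<in> test_functions \<Omega>"
  shows "continuous_on UNIV (dderiv \<phi> y)"
proof -
  have *: "continuous_on UNIV (dderiv \<phi> b)" if "b \<in> Basis" for b
  proof -
    have "Ck (Suc 0) \<phi>" using assms unfolding test_functions_def by blast
    then show ?thesis using that by simp
  qed
  have eq: "dderiv \<phi> y = (\<lambda>x. \<Sum>b\<in>Basis. (y \<bullet> b) * dderiv \<phi> b x)"
    using dderiv_eq_sum[OF test_function_differentiable[OF assms]] by blast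
  show ?thesis
    by (subst eq) (intro continuous_on_sum continuous_on_mult continuous_on_const *)
qed

lemma test_function_support:
  assumes "\<phi> \<in> test_functions \<Omega>"
  obtains K where "compact K" "K \<subseteq> \<Omega>" "\<And>x. x \<notin> K \<Longrightarrow> \<phi> x = 0" "\<And>x y. x \<notin> K \<Longrightarrow> dderiv \<phi> y x = 0"
proof
  let ?K = "closure (support_on UNIV \<phi>)"
  show "compact ?K" "?K \<subseteq> \<Omega>" using assms by (auto simp: test_functions_def)
  show z: "\<phi> x = 0" if "x \<notin> ?K" for x
    using that closure_subset[of "support_on UNIV \<phi>"] by (auto simp: support_on_def)
  show "dderiv \<phi> y x = 0" if "x \<notin> ?K" for x y
  proof -
    have "((\<lambda>_. 0) has_derivative (\<lambda>_. 0)) (at x)" by simp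
    then have "(\<phi> has_derivative (\<lambda>_. 0)) (at x)"
      by (rule has_derivative_transform_within_open[of _ _ _ _ "- ?K"]) (use that z in auto)
    from frechet_derivative_at[OF this] show ?thesis by (auto dest: fun_cong)
  qed
qed

lemma continuous_compact_support_bounded:
  fixes f :: "'a::euclidean_space \<Rightarrow> real"
  assumes "continuous_on UNIV f" "compact K" "\<And>x. x \<notin> K \<Longrightarrow> f x = 0"
  obtains B where "0 \<le> B" "\<And>x. \<bar>f x\<bar> \<le> B"
proof -
  have "bounded (f ` K)"
    using assms by (intro compact_imp_bounded compact_continuous_image) (auto intro: continuous_on_subset)
  then obtain B where B: "0 < B" "\<And>x. x \<in> K \<Longrightarrow> \<bar>f x\<bar> \<le> B" by (auto simp: bounded_pos)
  have "\<bar>f x\<bar> \<le> B" for x using B assms(3)[of x] by (cases "x \<in> K") auto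
  then show ?thesis using that[of B] B by simp
qed

lemma test_function_bounded:
  assumes "\<phi> \<in> test_functions \<Omega>" obtains B where "0 \<le> B" "\<And>x. \<bar>\<phi> x\<bar> \<le> B"
  using continuous_compact_support_bounded[of \<phi>] test_function_support[OF assms]
    test_function_continuous[OF assms] by metis

lemma test_function_dderiv_bounded:
  assumes "\<phi> \<in> test_functions \<Omega>" obtains B where "0 \<le> B" "\<And>x. \<bar>dderiv \<phi> y x\<bar> \<le> B"
  using continuous_compact_support_bounded[of "dderiv \<phi> y"] test_function_support[OF assms]
    test_function_dderiv_continuous[OF assms] by metis

text \<open>Any compact set outside which \<phi> vanishes serves, so the exact supports of sums,
  products and translates need not be computed.\<close>

lemma test_functionI:
  assumes "\<And>k. Ck k \<phi>" "compact K" "K \<subseteq> \<Omega>" "\<And>x. x \<notin> K \<Longrightarrow> \<phi> x = 0"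
  shows "\<phi> \<in> test_functions \<Omega>"
proof -
  have "closure (support_on UNIV \<phi>) \<subseteq> K"
    using assms by (intro closure_minimal) (auto simp: support_on_def compact_imp_closed)
  moreover have "compact (closure (support_on UNIV \<phi>))"
    using calculation assms(2) by (metis closed_closure compact_Int_closed inf.absorb2)
  ultimately show ?thesis using assms by (auto simp: test_functions_def)
qed

lemma bump_test_function:
  assumes "0 < k" "cbox p q \<subseteq> \<Omega>"
  shows "bump k p q \<in> test_functions \<Omega>"
proof (rule test_functionI[of _ "cbox p q"])
  show "bump k p q x = 0" if "x \<notin> cbox p q" for x
    using that box_subset_cbox[of p q] by (intro bump_outside assms) auto
qed (use assms in \<open>simp_all add: Ck_bump\<close>)

lemma test_function_translate:
  assumes "\<phi> \<in> test_functions \<omega>" "(\<lambda>x. x + a) ` \<omega> \<subseteq> \<Omega>"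
  shows "(\<lambda>x. \<phi> (x - a)) \<in> test_functions \<Omega>"
proof -
  obtain K where K: "compact K" "K \<subseteq> \<omega>" "\<And>x. x \<notin> K \<Longrightarrow> \<phi> x = 0"
    using test_function_support[OF assms(1)] by metis
  show ?thesis
  proof (rule test_functionI)
    show "Ck k (\<lambda>x. \<phi> (x - a))" for k using assms(1) by (auto simp: test_functions_def intro: Ck_translate)
    show "compact ((\<lambda>x. x + a) ` K)" using K(1) by (intro compact_continuous_image continuous_intros)
    show "(\<lambda>x. x + a) ` K \<subseteq> \<Omega>" using K assms(2) by auto
    show "\<phi> (x - a) = 0" if "x \<notin> (\<lambda>x. x + a) ` K" for x
      using that by (intro K) (metis diff_add_cancel image_eqI)
  qed
qed

lemma test_function_add_cmult:
  assumes "\<phi> \<in> test_functions \<Omega>" "\<psi> \<in> test_functions \<Omega>"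
  shows "(\<lambda>x. \<phi> x + c * \<psi> x) \<in> test_functions \<Omega>"
proof -
  obtain K where K: "compact K" "K \<subseteq> \<Omega>" "\<And>x. x \<notin> K \<Longrightarrow> \<phi> x = 0"
    using test_function_support[OF assms(1)] by metis
  obtain L where L: "compact L" "L \<subseteq> \<Omega>" "\<And>x. x \<notin> L \<Longrightarrow> \<psi> x = 0"
    using test_function_support[OF assms(2)] by metis
  show ?thesis
  proof (rule test_functionI)
    show "Ck k (\<lambda>x. \<phi> x + c * \<psi> x)" for k
      using assms by (intro Ck_add Ck_cmult) (simp_all add: test_functions_def)
    show "compact (K \<union> L)" using K L by blast
  qed (use K L in auto)
qed

lemma zero_test_function: "(\<lambda>_. 0) \<in> test_functions \<Omega>"
  by (rule test_functionI[of _ "{}"]) (auto intro: Ck_const)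

lemma dderiv_add_cmult:
  assumes "\<phi> \<in> test_functions \<Omega>" "\<psi> \<in> test_functions \<Omega>'"
  shows "dderiv (\<lambda>x. \<phi> x + c * \<psi> x) y x = dderiv \<phi> y x + c * dderiv \<psi> y x"
proof -
  have "((\<lambda>x. \<phi> x + c * \<psi> x) has_derivative
      (\<lambda>y. dderiv \<phi> y x + c * dderiv \<psi> y x)) (at x)"
    using assms by (auto intro!: derivative_eq_intros test_function_has_derivative)
  from frechet_derivative_at[OF this] show ?thesis by metis
qed

subsection \<open>Semi-inner products on spaces of functions\<close>

lemma nonneg_quadratic_discriminant:
  fixes a b c :: real
  assumes "\<And>t. 0 \<le> a + 2 * t * b + t\<^sup>2 * c" "0 \<le> c"
  shows "b\<^sup>2 \<le> a * c"
proof (cases "c = 0")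
  case True
  have "b = 0"
  proof (rule ccontr)
    assume "b \<noteq> 0"
    \<comment> \<open>This t makes the affine expression equal to -1.\<close>
    then have "2 * (- (a + 1) / (2 * b)) * b = - a - 1" by (simp add: field_simps)
    then show False using assms(1)[of "- (a + 1) / (2 * b)"] True by simp
  qed
  then show ?thesis using True by simp
next
  case False
  then have c: "c > 0" using assms(2) by simp
  \<comment> \<open>The polynomial at its minimum point -b/c, multiplied by c.\<close>
  have "0 \<le> c * (a + 2 * (- b / c) * b + (- b / c)\<^sup>2 * c)"
    using c by (intro mult_nonneg_nonneg assms(1)) simp
  also have "\<dots> = a * c - b\<^sup>2" using c by (simp add: field_simps power2_eq_square)
  finally show ?thesis by simp
qed

text \<open>Only semidefinite, since functions that agree almost everywhere are distinct elements
  here, and on a set of functions rather than on a type. Among the instances are the L^2 product,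
  the form on \<open>form_domain\<close>, its closure, and the form shifted by a multiple of the L^2
  product.\<close>

locale semi_inner =
  fixes P :: "('a \<Rightarrow> real) set" and B :: "('a \<Rightarrow> real) \<Rightarrow> ('a \<Rightarrow> real) \<Rightarrow> real"
  assumes zero: "(\<lambda>_. 0) \<in> P"
    and add_cmult: "u \<in> P \<Longrightarrow> v \<in> P \<Longrightarrow> (\<lambda>x. u x + c * v x) \<in> P"
    and lin: "u \<in> P \<Longrightarrow> v \<in> P \<Longrightarrow> w \<in> P \<Longrightarrow> B (\<lambda>x. u x + c * v x) w = B u w + c * B v w"
    and sym: "u \<in> P \<Longrightarrow> v \<in> P \<Longrightarrow> B u v = B v u"
    and nonneg: "u \<in> P \<Longrightarrow> 0 \<le> B u u"
begin

definition nrm :: "('a \<Rightarrow> real) \<Rightarrow> real" where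
  "nrm u = sqrt (B u u)"

text \<open>Phrased with the square B instead of \<open>nrm\<close> so that it is literally the last
  clause of \<open>approximates\<close>.\<close>

definition cauchy :: "(nat \<Rightarrow> 'a \<Rightarrow> real) \<Rightarrow> bool" where
  "cauchy us \<longleftrightarrow> (\<forall>e>0. \<exists>M. \<forall>m\<ge>M. \<forall>n\<ge>M.
     B (\<lambda>x. us m x - us n x) (\<lambda>x. us m x - us n x) < e)"

lemma nrm_nonneg: "u \<in> P \<Longrightarrow> 0 \<le> nrm u"
  by (simp add: nrm_def nonneg)

lemma nrm_sq: "u \<in> P \<Longrightarrow> (nrm u)\<^sup>2 = B u u"
  by (simp add: nrm_def nonneg)

lemma add: "u \<in> P \<Longrightarrow> v \<in> P \<Longrightarrow> (\<lambda>x. u x + v x) \<in> P"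
  using add_cmult[of u v 1] by simp

lemma diff: "u \<in> P \<Longrightarrow> v \<in> P \<Longrightarrow> (\<lambda>x. u x - v x) \<in> P"
  using add_cmult[of u v "-1"] by simp

lemma cmult: "v \<in> P \<Longrightarrow> (\<lambda>x. c * v x) \<in> P"
  using add_cmult[OF zero, of v c] by simp

lemma lin_right:
  "u \<in> P \<Longrightarrow> v \<in> P \<Longrightarrow> w \<in> P \<Longrightarrow> B w (\<lambda>x. u x + c * v x) = B w u + c * B w v"
  by (simp add: sym[of w] add_cmult lin)

lemma diff_left: "u \<in> P \<Longrightarrow> v \<in> P \<Longrightarrow> w \<in> P \<Longrightarrow> B (\<lambda>x. u x - v x) w = B u w - B v w"
  using lin[of u v w "-1"] by simp

lemma diff_right: "u \<in> P \<Longrightarrow> v \<in> P \<Longrightarrow> w \<in> P \<Longrightarrow> B w (\<lambda>x. u x - v x) = B w u - B w v"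
  using lin_right[of u v w "-1"] by simp

lemma zero_left: "w \<in> P \<Longrightarrow> B (\<lambda>_. 0) w = 0"
  using diff_left[OF zero zero, of w] by simp

lemma cmult_left: "v \<in> P \<Longrightarrow> w \<in> P \<Longrightarrow> B (\<lambda>x. c * v x) w = c * B v w"
  using lin[OF zero, of v w c] by (simp add: zero_left)

lemma cmult_right: "v \<in> P \<Longrightarrow> w \<in> P \<Longrightarrow> B w (\<lambda>x. c * v x) = c * B w v"
  by (simp add: sym[of w] cmult_left cmult)

lemma quad:
  assumes "u \<in> P" "v \<in> P"
  shows "B (\<lambda>x. u x + c * v x) (\<lambda>x. u x + c * v x) = B u u + 2 * c * B u v + c\<^sup>2 * B v v"
  using assms by (simp add: lin lin_right add_cmult sym[of v u] algebra_simps power2_eq_square)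

lemma quad_diff:
  assumes "u \<in> P" "v \<in> P"
  shows "B (\<lambda>x. u x - v x) (\<lambda>x. u x - v x) = B u u - 2 * B u v + B v v"
  using quad[OF assms, of "-1"] by simp

lemma Cauchy_Schwarz_sq: "u \<in> P \<Longrightarrow> v \<in> P \<Longrightarrow> (B u v)\<^sup>2 \<le> B u u * B v v"
  using nonneg[OF add_cmult[of u v]]
  by (intro nonneg_quadratic_discriminant) (auto simp: quad nonneg)

lemma Cauchy_Schwarz: "u \<in> P \<Longrightarrow> v \<in> P \<Longrightarrow> \<bar>B u v\<bar> \<le> nrm u * nrm v"
  using real_sqrt_le_mono[OF Cauchy_Schwarz_sq[of u v]] by (simp add: nrm_def real_sqrt_mult)

lemma nrm_triangle:
  assumes "u \<in> P" "v \<in> P"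
  shows "nrm (\<lambda>x. u x + v x) \<le> nrm u + nrm v"
proof (rule power2_le_imp_le)
  have "B u v \<le> nrm u * nrm v" using Cauchy_Schwarz[OF assms] by simp
  then show "(nrm (\<lambda>x. u x + v x))\<^sup>2 \<le> (nrm u + nrm v)\<^sup>2"
    using quad[OF assms, of 1] assms by (simp add: nrm_sq add power2_sum)
qed (use assms in \<open>simp add: nrm_nonneg\<close>)

lemma nrm_cmult: "u \<in> P \<Longrightarrow> nrm (\<lambda>x. c * u x) = \<bar>c\<bar> * nrm u"
  by (simp add: nrm_def cmult_left cmult_right cmult real_sqrt_mult flip: mult.assoc)

lemma nrm_minus_commute: "u \<in> P \<Longrightarrow> v \<in> P \<Longrightarrow> nrm (\<lambda>x. u x - v x) = nrm (\<lambda>x. v x - u x)"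
  by (simp add: nrm_def quad_diff sym)

lemma nrm_triangle_diff:
  assumes "u \<in> P" "v \<in> P" "w \<in> P"
  shows "nrm (\<lambda>x. u x - w x) \<le> nrm (\<lambda>x. u x - v x) + nrm (\<lambda>x. v x - w x)"
  using nrm_triangle[OF diff[OF assms(1,2)] diff[OF assms(2,3)]] by simp

lemma nrm_diff_ge: "u \<in> P \<Longrightarrow> v \<in> P \<Longrightarrow> \<bar>nrm u - nrm v\<bar> \<le> nrm (\<lambda>x. u x - v x)"
  using nrm_triangle[OF diff[of u v], of v] nrm_triangle[OF diff[of v u], of u]
    nrm_minus_commute[of u v] by simp

lemma cauchyD:
  assumes "cauchy us" "\<And>n. us n \<in> P" "e > 0"
  shows "\<exists>M. \<forall>m\<ge>M. \<forall>n\<ge>M. nrm (\<lambda>x. us m x - us n x) < e"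
proof -
  have "e\<^sup>2 > 0" using assms by simp
  then obtain M where "\<forall>m\<ge>M. \<forall>n\<ge>M. B (\<lambda>x. us m x - us n x) (\<lambda>x. us m x - us n x) < e\<^sup>2"
    using assms(1) unfolding cauchy_def by blast
  then have "\<forall>m\<ge>M. \<forall>n\<ge>M. nrm (\<lambda>x. us m x - us n x) < e"
    unfolding nrm_def using assms(3) by (auto intro: real_less_lsqrt simp: nonneg diff assms(2))
  then show ?thesis by blast
qed

lemma cauchyI:
  assumes "\<And>n. us n \<in> P" "\<And>e. e > 0 \<Longrightarrow> \<exists>M. \<forall>m\<ge>M. \<forall>n\<ge>M. nrm (\<lambda>x. us m x - us n x) < e"
  shows "cauchy us"
  unfolding cauchy_def
proof (intro allI impI)
  fix e :: real assume "e > 0"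
  then obtain M where "\<forall>m\<ge>M. \<forall>n\<ge>M. nrm (\<lambda>x. us m x - us n x) < sqrt e"
    using assms(2)[of "sqrt e"] by auto
  then show "\<exists>M. \<forall>m\<ge>M. \<forall>n\<ge>M. B (\<lambda>x. us m x - us n x) (\<lambda>x. us m x - us n x) < e"
    unfolding nrm_def by auto
qed

lemma cauchy_bounded:
  assumes "cauchy us" "\<And>n. us n \<in> P"
  obtains K where "0 \<le> K" "\<And>n. nrm (us n) \<le> K"
proof -
  obtain M where M: "\<And>m n. m \<ge> M \<Longrightarrow> n \<ge> M \<Longrightarrow> nrm (\<lambda>x. us m x - us n x) < 1"
    using cauchyD[OF assms, of 1] by auto
  define K where "K = Max ((\<lambda>n. nrm (us n)) ` {..M}) + 1"
  have K: "nrm (us n) + 1 \<le> K" if "n \<le> M" for n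
    unfolding K_def using that by (auto intro!: Max_ge)
  have "nrm (us n) \<le> K" for n
  proof (cases "n \<le> M")
    case False
    then show ?thesis
      using M[of n M] K[of M] nrm_diff_ge[OF assms(2)[of n] assms(2)[of M]] by auto
  qed (use K in force)
  moreover have "0 \<le> K" using K[of 0] nrm_nonneg[OF assms(2)[of 0]] by simp
  ultimately show thesis using that by blast
qed

lemma cauchy_add_cmult:
  assumes "cauchy us" "cauchy vs" "\<And>n. us n \<in> P" "\<And>n. vs n \<in> P"
  shows "cauchy (\<lambda>n x. us n x + c * vs n x)"
proof (rule cauchyI)
  show "(\<lambda>x. us n x + c * vs n x) \<in> P" for n using assms by (simp add: add_cmult)
  fix e :: real assume "e > 0"
  \<comment> \<open>The denominator with |c| + 1 also covers c = 0.\<close>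
  then have e: "0 < e / 2" "0 < e / (2 * (\<bar>c\<bar> + 1))" by (simp_all add: add_nonneg_pos)
  obtain M1 where M1: "\<forall>m\<ge>M1. \<forall>n\<ge>M1. nrm (\<lambda>x. us m x - us n x) < e / 2"
    using cauchyD[OF assms(1,3) e(1)] by blast
  obtain M2 where M2: "\<forall>m\<ge>M2. \<forall>n\<ge>M2. nrm (\<lambda>x. vs m x - vs n x) < e / (2 * (\<bar>c\<bar> + 1))"
    using cauchyD[OF assms(2,4) e(2)] by blast
  show "\<exists>M. \<forall>m\<ge>M. \<forall>n\<ge>M. nrm (\<lambda>x. us m x + c * vs m x - (us n x + c * vs n x)) < e"
  proof (intro exI[of _ "max M1 M2"] allI impI)
    fix m n assume mn: "max M1 M2 \<le> m" "max M1 M2 \<le> n"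
    have eq: "(\<lambda>x. us m x + c * vs m x - (us n x + c * vs n x))
        = (\<lambda>x. (us m x - us n x) + c * (vs m x - vs n x))" by (auto simp: algebra_simps)
    have "nrm (\<lambda>x. us m x + c * vs m x - (us n x + c * vs n x))
        \<le> nrm (\<lambda>x. us m x - us n x) + \<bar>c\<bar> * nrm (\<lambda>x. vs m x - vs n x)"
      unfolding eq using nrm_triangle[of "\<lambda>x. us m x - us n x" "\<lambda>x. c * (vs m x - vs n x)"] assms(3,4)
      by (simp add: diff cmult nrm_cmult)
    also have "\<bar>c\<bar> * nrm (\<lambda>x. vs m x - vs n x) \<le> (\<bar>c\<bar> + 1) * nrm (\<lambda>x. vs m x - vs n x)"
      using assms by (intro mult_right_mono nrm_nonneg diff) auto
    also have "(\<bar>c\<bar> + 1) * nrm (\<lambda>x. vs m x - vs n x) < (\<bar>c\<bar> + 1) * (e / (2 * (\<bar>c\<bar> + 1)))"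
      using M2 mn by (intro mult_strict_left_mono) auto
    also have "(\<bar>c\<bar> + 1) * (e / (2 * (\<bar>c\<bar> + 1))) = e / 2"
      by (simp add: field_simps)
    finally show "nrm (\<lambda>x. us m x + c * vs m x - (us n x + c * vs n x)) < e"
      using M1[rule_format, of m n] mn by linarith
  qed
qed

lemma cauchy_inner_convergent:
  assumes "cauchy us" "cauchy vs" "\<And>n. us n \<in> P" "\<And>n. vs n \<in> P"
  shows "convergent (\<lambda>n. B (us n) (vs n))"
proof (rule Cauchy_convergent, rule metric_CauchyI)
  fix e :: real assume "e > 0"
  obtain K where K: "0 \<le> K" "\<And>n. nrm (us n) \<le> K" using cauchy_bounded[OF assms(1,3)] by blast
  obtain L where L: "0 \<le> L" "\<And>n. nrm (vs n) \<le> L" using cauchy_bounded[OF assms(2,4)] by blast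
  \<comment> \<open>Makes d L + K d smaller than e; the summand 1 covers the case K = L = 0.\<close>
  define d where "d = e / (2 * (K + L + 1))"
  have d: "d > 0" unfolding d_def using \<open>e > 0\<close> K L by simp
  obtain M1 where M1: "\<forall>m\<ge>M1. \<forall>n\<ge>M1. nrm (\<lambda>x. us m x - us n x) < d"
    using cauchyD[OF assms(1,3) d] by blast
  obtain M2 where M2: "\<forall>m\<ge>M2. \<forall>n\<ge>M2. nrm (\<lambda>x. vs m x - vs n x) < d"
    using cauchyD[OF assms(2,4) d] by blast
  show "\<exists>M. \<forall>m\<ge>M. \<forall>n\<ge>M. dist (B (us m) (vs m)) (B (us n) (vs n)) < e"
  proof (intro exI[of _ "max M1 M2"] allI impI)
    fix m n assume mn: "max M1 M2 \<le> m" "max M1 M2 \<le> n"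
    have "B (us m) (vs m) - B (us n) (vs n)
       = B (\<lambda>x. us m x - us n x) (vs m) + B (us n) (\<lambda>x. vs m x - vs n x)"
      by (simp add: diff_left diff_right assms)
    then have "dist (B (us m) (vs m)) (B (us n) (vs n))
       \<le> \<bar>B (\<lambda>x. us m x - us n x) (vs m)\<bar> + \<bar>B (us n) (\<lambda>x. vs m x - vs n x)\<bar>"
      by (simp add: dist_real_def)
    also have "\<dots> \<le> d * L + K * d"
    proof (rule add_mono)
      have "\<bar>B (\<lambda>x. us m x - us n x) (vs m)\<bar> \<le> nrm (\<lambda>x. us m x - us n x) * nrm (vs m)"
        by (intro Cauchy_Schwarz diff assms)
      also have "\<dots> \<le> d * L" using M1 mn L d
        by (intro mult_mono) (auto simp: nrm_nonneg assms intro: less_imp_le)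
      finally show "\<bar>B (\<lambda>x. us m x - us n x) (vs m)\<bar> \<le> d * L" .
      have "\<bar>B (us n) (\<lambda>x. vs m x - vs n x)\<bar> \<le> nrm (us n) * nrm (\<lambda>x. vs m x - vs n x)"
        by (intro Cauchy_Schwarz diff assms)
      also have "\<dots> \<le> K * d" using M2 mn K d
        by (intro mult_mono) (auto simp: nrm_nonneg assms diff intro: less_imp_le)
      finally show "\<bar>B (us n) (\<lambda>x. vs m x - vs n x)\<bar> \<le> K * d" .
    qed
    also have "\<dots> < 2 * (K + L + 1) * d" using d K L by (simp add: algebra_simps add_strict_increasing2)
    also have "\<dots> = e" unfolding d_def using K L by (simp add: field_simps)
    finally show "dist (B (us m) (vs m)) (B (us n) (vs n)) < e" .
  qed
qed

lemma null_inner_tendsto: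
  assumes "\<And>n. us n \<in> P" "\<And>n. vs n \<in> P" "(\<lambda>n. nrm (us n)) \<longlonglongrightarrow> 0" "\<And>n. nrm (vs n) \<le> K"
  shows "(\<lambda>n. B (us n) (vs n)) \<longlonglongrightarrow> 0"
proof (rule Lim_null_comparison)
  show "\<forall>\<^sub>F n in sequentially. norm (B (us n) (vs n)) \<le> nrm (us n) * K"
  proof (rule always_eventually, rule allI)
    fix n
    have "norm (B (us n) (vs n)) \<le> nrm (us n) * nrm (vs n)" using Cauchy_Schwarz assms by auto
    also have "\<dots> \<le> nrm (us n) * K" using assms by (intro mult_left_mono nrm_nonneg) auto
    finally show "norm (B (us n) (vs n)) \<le> nrm (us n) * K" .
  qed
  show "(\<lambda>n. nrm (us n) * K) \<longlonglongrightarrow> 0" using tendsto_mult_left_zero[OF assms(3)] .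
qed

text \<open>
  Minimizing sequences of \<open>\<lambda>v. B v v - 2 l v\<close> are Cauchy by the parallelogram identity, and satisfy
  the Euler--Lagrange equation up to an error that is uniform on bounded sets.
\<close>

context
  fixes l :: "('a \<Rightarrow> real) \<Rightarrow> real" and C :: real
  assumes l_lin: "\<And>u v c. u \<in> P \<Longrightarrow> v \<in> P \<Longrightarrow> l (\<lambda>x. u x + c * v x) = l u + c * l v"
    and l_bound: "\<And>u. u \<in> P \<Longrightarrow> \<bar>l u\<bar> \<le> C * nrm u"
begin

definition "minimum = (INF v\<in>P. B v v - 2 * l v)"

lemma minimum_le:
  assumes "v \<in> P" shows "minimum \<le> B v v - 2 * l v"
proof -
  \<comment> \<open>Completing the square shows that the infimum is finite; the \<open>INF\<close>
    of a set unbounded below would carry no information.\<close>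
  have "- C\<^sup>2 \<le> B u u - 2 * l u" if "u \<in> P" for u
  proof -
    have "0 \<le> (nrm u - C)\<^sup>2" by simp
    then show ?thesis using l_bound[OF that] nrm_sq[OF that]
      by (simp add: power2_diff mult.commute)
  qed
  then show ?thesis unfolding minimum_def using assms by (intro cINF_lower bdd_belowI2[of _ "- C\<^sup>2"]) auto
qed

lemma minimizing_sequence_exists:
  obtains vs where "\<And>n. vs n \<in> P" "(\<lambda>n. B (vs n) (vs n) - 2 * l (vs n)) \<longlonglongrightarrow> minimum"
proof -
  have "\<exists>v\<in>P. B v v - 2 * l v < minimum + 1 / Suc n" for n
  proof (rule ccontr)
    assume "\<not> ?thesis"
    then have "minimum + 1 / Suc n \<le> minimum"
      unfolding minimum_def using zero by (intro cINF_greatest) (auto simp: not_less)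
    then show False by simp
  qed
  then obtain vs where vs: "\<And>n. vs n \<in> P" "\<And>n. B (vs n) (vs n) - 2 * l (vs n) < minimum + 1 / Suc n"
    by metis
  have "(\<lambda>n. B (vs n) (vs n) - 2 * l (vs n)) \<longlonglongrightarrow> minimum"
  proof (rule tendsto_sandwich[of "\<lambda>_. minimum" _ _ "\<lambda>n. minimum + 1 / Suc n"])
    show "(\<lambda>n. minimum + 1 / Suc n) \<longlonglongrightarrow> minimum"
      using tendsto_add[OF tendsto_const LIMSEQ_inverse_real_of_nat, of minimum]
      by (simp add: inverse_eq_divide)
    show "(\<lambda>_. minimum) \<longlonglongrightarrow> minimum" by simp
  qed (use vs minimum_le in \<open>auto intro!: always_eventually less_imp_le simp del: of_nat_Suc\<close>)
  then show thesis using that vs by blast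
qed

lemma minimizing_Euler_Lagrange:
  assumes "v \<in> P" "\<phi> \<in> P"
  shows "\<bar>B v \<phi> - l \<phi>\<bar> \<le> sqrt (B v v - 2 * l v - minimum) * nrm \<phi>"
proof -
  have "(B v \<phi> - l \<phi>)\<^sup>2 \<le> (B v v - 2 * l v - minimum) * B \<phi> \<phi>"
  \<comment> \<open>The polynomial in t is the excess of the functional at v + t \<phi> over its
    infimum.\<close>
  proof (rule nonneg_quadratic_discriminant)
    fix t
    show "0 \<le> B v v - 2 * l v - minimum + 2 * t * (B v \<phi> - l \<phi>) + t\<^sup>2 * B \<phi> \<phi>"
      using minimum_le[OF add_cmult[OF assms, of t]] assms by (simp add: quad l_lin algebra_simps)
  qed (simp add: nonneg assms)
  from real_sqrt_le_mono[OF this] show ?thesis by (simp add: nrm_def real_sqrt_mult)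
qed

lemma minimizing_cauchy:
  assumes "\<And>n. vs n \<in> P" "(\<lambda>n. B (vs n) (vs n) - 2 * l (vs n)) \<longlonglongrightarrow> minimum"
  shows "cauchy vs"
  unfolding cauchy_def
proof (intro allI impI)
  let ?F = "\<lambda>v. B v v - 2 * l v"
  fix e :: real assume "e > 0"
  \<comment> \<open>With both excesses below e/4, the combination 2 F(v) + 2 F(w) - 4 F((v + w)/2)
    in the parallelogram identity stays below e.\<close>
  then obtain M where M: "\<And>n. n \<ge> M \<Longrightarrow> ?F (vs n) < minimum + e / 4"
    using order_tendstoD(2)[OF assms(2), of "minimum + e / 4"] by (auto simp: eventually_sequentially)
  have "B (\<lambda>x. vs m x - vs n x) (\<lambda>x. vs m x - vs n x) < e" if "m \<ge> M" "n \<ge> M" for m n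
  proof -
    \<comment> \<open>The midpoint, in the shape that \<open>add_cmult\<close> accepts.\<close>
    let ?w = "\<lambda>x. vs n x + (1/2) * (vs m x - vs n x)"
    have w: "?w \<in> P" by (intro add_cmult diff assms(1))
    have "?F ?w = B (vs n) (vs n) / 4 + B (vs m) (vs n) / 2 + B (vs m) (vs m) / 4
        - l (vs n) - l (vs m)"
    proof -
      have eq: "?w = (\<lambda>x. (1/2) * vs n x + (1/2) * vs m x)" by (auto simp: algebra_simps)
      have l0: "l (\<lambda>x. 0) = 0" using l_lin[OF zero zero, of 1] by simp
      have lh: "l (\<lambda>x. (1/2) * vs n x) = (1/2) * l (vs n)"
        using l_lin[OF zero assms(1), of "1/2" n] l0 by simp
      have P: "vs n \<in> P" "vs m \<in> P" "(\<lambda>x. (1/2) * vs n x) \<in> P" by (rule assms(1) cmult[OF assms(1)])+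
      show ?thesis
        unfolding eq l_lin[OF P(3,2)] quad[OF P(3,2)] lh cmult_left[OF P(1,2)]
          cmult_left[OF P(1,3)] cmult_right[OF P(1,1)] sym[OF P(1,2)]
        by (simp add: power2_eq_square field_simps)
    qed
    then have "B (\<lambda>x. vs m x - vs n x) (\<lambda>x. vs m x - vs n x)
        = 2 * ?F (vs m) + 2 * ?F (vs n) - 4 * ?F ?w"
      using assms(1) by (simp add: quad_diff)
    then show ?thesis using minimum_le[OF w] M[OF that(1)] M[OF that(2)] by argo
  qed
  then show "\<exists>M. \<forall>m\<ge>M. \<forall>n\<ge>M. B (\<lambda>x. vs m x - vs n x) (\<lambda>x. vs m x - vs n x) < e" by blast
qed

end

end

subsection \<open>The space \<open>L\<^sup>2\<close>\<close>

lemma L2_spaceD: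
  "u \<in> L2_space \<Omega> \<Longrightarrow> u \<in> borel_measurable (lebesgue_on \<Omega>)"
  "u \<in> L2_space \<Omega> \<Longrightarrow> integrable (lebesgue_on \<Omega>) (\<lambda>x. (u x)\<^sup>2)"
  by (auto simp: L2_space_def)

lemma integrable_mult_of_squares:
  fixes f g :: "'b \<Rightarrow> real"
  assumes [measurable]: "f \<in> borel_measurable M" "g \<in> borel_measurable M"
    and "integrable M (\<lambda>x. (f x)\<^sup>2)" "integrable M (\<lambda>x. (g x)\<^sup>2)"
  shows "integrable M (\<lambda>x. f x * g x)"
proof (rule Bochner_Integration.integrable_bound)
  show "integrable M (\<lambda>x. (f x)\<^sup>2 + (g x)\<^sup>2)" using assms by simp
  have "\<bar>a * b\<bar> \<le> a\<^sup>2 + b\<^sup>2" for a b :: real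
  proof -
    have "0 \<le> (\<bar>a\<bar> - \<bar>b\<bar>)\<^sup>2" "0 \<le> \<bar>a\<bar> * \<bar>b\<bar>" by auto
    then have "\<bar>a\<bar> * \<bar>b\<bar> \<le> a\<^sup>2 + b\<^sup>2" unfolding power2_diff power2_abs by linarith
    then show ?thesis by (simp add: abs_mult)
  qed
  then show "AE x in M. norm (f x * g x) \<le> norm ((f x)\<^sup>2 + (g x)\<^sup>2)" by (simp add: abs_mult)
qed simp

lemma L2_mult_integrable:
  "u \<in> L2_space \<Omega> \<Longrightarrow> v \<in> L2_space \<Omega> \<Longrightarrow> integrable (lebesgue_on \<Omega>) (\<lambda>x. u x * v x)"
  by (intro integrable_mult_of_squares L2_spaceD)

lemma integrable_square_add_cmult:
  fixes f g :: "'b \<Rightarrow> real"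
  assumes [measurable]: "f \<in> borel_measurable M" "g \<in> borel_measurable M"
    and "integrable M (\<lambda>x. (f x)\<^sup>2)" "integrable M (\<lambda>x. (g x)\<^sup>2)"
  shows "integrable M (\<lambda>x. (f x + c * g x)\<^sup>2)"
proof -
  have "integrable M (\<lambda>x. (f x)\<^sup>2 + 2 * c * (f x * g x) + c\<^sup>2 * (g x)\<^sup>2)"
    using assms integrable_mult_of_squares[OF assms] by simp
  then show ?thesis by (simp add: power2_sum algebra_simps power2_eq_square)
qed

lemma L2_add_cmult:
  assumes "u \<in> L2_space \<Omega>" "v \<in> L2_space \<Omega>" shows "(\<lambda>x. u x + c * v x) \<in> L2_space \<Omega>"
  using assms integrable_square_add_cmult[of u "lebesgue_on \<Omega>" v c] by (auto simp: L2_space_def)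

interpretation L2: semi_inner "L2_space \<Omega>" "L2_inner \<Omega>" for \<Omega> :: "'a::euclidean_space set"
proof
  show "(\<lambda>_. 0) \<in> L2_space \<Omega>" by (simp add: L2_space_def)
  show "L2_inner \<Omega> u v = L2_inner \<Omega> v u" for u v by (simp add: L2_inner_def mult.commute)
  show "0 \<le> L2_inner \<Omega> u u" for u by (simp add: L2_inner_def)
  show "L2_inner \<Omega> (\<lambda>x. u x + c * v x) w = L2_inner \<Omega> u w + c * L2_inner \<Omega> v w"
    if "u \<in> L2_space \<Omega>" "v \<in> L2_space \<Omega>" "w \<in> L2_space \<Omega>" for u v w c
    using L2_mult_integrable[OF that(1,3)] L2_mult_integrable[OF that(2,3)]
    by (simp add: L2_inner_def distrib_right mult.assoc)
qed (rule L2_add_cmult)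

lemma L2_nrm_eq: "L2.nrm \<Omega> u = L2_norm \<Omega> u"
  by (simp add: L2.nrm_def L2_norm_def)

lemma L2_dist_nrm: "L2_dist \<Omega> u v = L2.nrm \<Omega> (\<lambda>x. u x - v x)"
  by (simp add: L2_dist_def L2_nrm_eq)

lemma L2_dist_nonneg: "0 \<le> L2_dist \<Omega> u v"
  by (simp add: L2_dist_def L2_norm_def L2_inner_def)

lemma L2_dist_sym: "L2_dist \<Omega> u v = L2_dist \<Omega> v u"
  by (simp add: L2_dist_def L2_norm_def L2_inner_def algebra_simps)

lemma L2_dist_triangle:
  "u \<in> L2_space \<Omega> \<Longrightarrow> v \<in> L2_space \<Omega> \<Longrightarrow> w \<in> L2_space \<Omega> \<Longrightarrow>
   L2_dist \<Omega> u w \<le> L2_dist \<Omega> u v + L2_dist \<Omega> v w"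
  unfolding L2_dist_nrm by (rule L2.nrm_triangle_diff)

lemma L2_inner_cong_AE:
  assumes "AE x in lebesgue_on \<Omega>. u x = u' x" "AE x in lebesgue_on \<Omega>. v x = v' x"
    and "u \<in> L2_space \<Omega>" "u' \<in> L2_space \<Omega>" "v \<in> L2_space \<Omega>" "v' \<in> L2_space \<Omega>"
  shows "L2_inner \<Omega> u v = L2_inner \<Omega> u' v'"
  unfolding L2_inner_def
  using assms(1,2) assms(3-6)[THEN L2_spaceD(1)] by (intro integral_cong_AE) auto

lemma L2_norm_eq_0_iff:
  assumes "u \<in> L2_space \<Omega>"
  shows "L2_norm \<Omega> u = 0 \<longleftrightarrow> (AE x in lebesgue_on \<Omega>. u x = 0)"
  using integral_nonneg_eq_0_iff_AE[OF L2_spaceD(2)[OF assms]]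
  by (simp add: L2_norm_def L2_inner_def power2_eq_square)

lemma L2_dist_eq_0_iff:
  "u \<in> L2_space \<Omega> \<Longrightarrow> v \<in> L2_space \<Omega> \<Longrightarrow>
    L2_dist \<Omega> u v = 0 \<longleftrightarrow> (AE x in lebesgue_on \<Omega>. u x = v x)"
  using L2_norm_eq_0_iff[OF L2.diff[of u \<Omega> v]] by (simp add: L2_dist_def)

lemma L2_norm_sq: "(L2_norm \<Omega> u)\<^sup>2 = (LINT x|lebesgue_on \<Omega>. (u x)\<^sup>2)"
  by (simp add: L2_norm_def L2_inner_def power2_eq_square)

lemma L2_norm_mono:
  assumes "u \<in> borel_measurable (lebesgue_on \<Omega>)" "v \<in> L2_space \<Omega>"
    and "AE x in lebesgue_on \<Omega>. \<bar>u x\<bar> \<le> \<bar>v x\<bar>"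
  shows "u \<in> L2_space \<Omega>" "L2_norm \<Omega> u \<le> L2_norm \<Omega> v"
proof -
  have le: "AE x in lebesgue_on \<Omega>. (u x)\<^sup>2 \<le> (v x)\<^sup>2"
    using assms(3) by eventually_elim (simp add: abs_le_square_iff)
  have "integrable (lebesgue_on \<Omega>) (\<lambda>x. (u x)\<^sup>2)"
  proof (rule Bochner_Integration.integrable_bound[OF L2_spaceD(2)[OF assms(2)]])
    show "AE x in lebesgue_on \<Omega>. norm ((u x)\<^sup>2) \<le> norm ((v x)\<^sup>2)" using le by simp
  qed (use assms(1) in measurable)
  then show u: "u \<in> L2_space \<Omega>" using assms(1) by (simp add: L2_space_def)
  show "L2_norm \<Omega> u \<le> L2_norm \<Omega> v"
    unfolding L2_norm_def L2_inner_def power2_eq_square[symmetric]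
    by (intro real_sqrt_le_mono integral_mono_AE L2_spaceD u assms le)
qed

lemma L2_dist_mono:
  assumes "u \<in> L2_space \<Omega>" "u' \<in> L2_space \<Omega>" "v \<in> L2_space \<Omega>" "v' \<in> L2_space \<Omega>"
    and "AE x in lebesgue_on \<Omega>. \<bar>u x - u' x\<bar> \<le> \<bar>v x - v' x\<bar>"
  shows "L2_dist \<Omega> u u' \<le> L2_dist \<Omega> v v'"
  unfolding L2_dist_def
  by (rule L2_norm_mono(2)[OF L2_spaceD(1)[OF L2.diff[OF assms(1,2)]] L2.diff[OF assms(3,4)] assms(5)])

lemma L2_space_cong_AE:
  assumes "u \<in> L2_space \<Omega>" "v \<in> borel_measurable (lebesgue_on \<Omega>)" "AE x in lebesgue_on \<Omega>. u x = v x"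
  shows "v \<in> L2_space \<Omega>"
proof (rule L2_norm_mono(1)[OF assms(2,1)])
  show "AE x in lebesgue_on \<Omega>. \<bar>v x\<bar> \<le> \<bar>u x\<bar>" using assms(3) by eventually_elim simp
qed

lemma L2_dist_cong_AE:
  assumes "u \<in> L2_space \<Omega>" "u' \<in> L2_space \<Omega>" "v \<in> L2_space \<Omega>" "v' \<in> L2_space \<Omega>"
    and "AE x in lebesgue_on \<Omega>. u x = u' x" "AE x in lebesgue_on \<Omega>. v x = v' x"
  shows "L2_dist \<Omega> u v = L2_dist \<Omega> u' v'"
proof (rule antisym)
  show "L2_dist \<Omega> u v \<le> L2_dist \<Omega> u' v'"
    by (rule L2_dist_mono[OF assms(1,3,2,4)]) (use assms(5,6) in eventually_elim, simp)
  show "L2_dist \<Omega> u' v' \<le> L2_dist \<Omega> u v"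
    by (rule L2_dist_mono[OF assms(2,4,1,3)]) (use assms(5,6) in eventually_elim, simp)
qed

lemma bounded_finite_measure:
  assumes "bounded \<Omega>" "\<Omega> \<in> sets lebesgue" shows "finite_measure (lebesgue_on \<Omega>)"
proof -
  have "\<Omega> \<in> lmeasurable" using assms by (simp add: bounded_set_imp_lmeasurable)
  then show ?thesis
    by (rule finite_measure_lebesgue_on)
qed

lemma L2_space_bounded:
  assumes "bounded \<Omega>" "\<Omega> \<in> sets lebesgue" "u \<in> borel_measurable (lebesgue_on \<Omega>)" "\<And>x. x \<in> \<Omega> \<Longrightarrow> \<bar>u x\<bar> \<le> C"
  shows "u \<in> L2_space \<Omega>"
proof -
  interpret finite_measure "lebesgue_on \<Omega>" using bounded_finite_measure assms by blast
  have "integrable (lebesgue_on \<Omega>) (\<lambda>x. (u x)\<^sup>2)"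
  proof (rule integrable_const_bound)
    show "AE x in lebesgue_on \<Omega>. norm ((u x)\<^sup>2) \<le> C\<^sup>2"
      using assms(4) by (intro AE_I2) (auto simp: space_restrict_space intro: power2_le_iff_abs_le[THEN iffD2] order_trans[OF abs_ge_zero])
  qed (use assms in simp)
  then show ?thesis using assms by (simp add: L2_space_def)
qed

lemma continuous_measurable_lebesgue_on:
  fixes f :: "'a::euclidean_space \<Rightarrow> real"
  assumes "continuous_on UNIV f" shows "f \<in> borel_measurable (lebesgue_on \<Omega>)"
  using assms by (intro measurable_restrict_space1 measurable_completion)
    (simp add: borel_measurable_continuous_onI)

lemma test_function_L2:
  assumes "bounded \<Omega>" "\<Omega> \<in> sets lebesgue" "\<phi> \<in> test_functions \<Omega>'"
  shows "\<phi> \<in> L2_space \<Omega>" "dderiv \<phi> y \<in> L2_space \<Omega>"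
proof -
  show "\<phi> \<in> L2_space \<Omega>"
    by (rule test_function_bounded[OF assms(3)])
      (rule L2_space_bounded[OF assms(1,2) continuous_measurable_lebesgue_on[OF
        test_function_continuous[OF assms(3)]]], blast)
  show "dderiv \<phi> y \<in> L2_space \<Omega>"
    by (rule test_function_dderiv_bounded[OF assms(3), of y])
      (rule L2_space_bounded[OF assms(1,2) continuous_measurable_lebesgue_on[OF
        test_function_dderiv_continuous[OF assms(3)]]], blast)
qed

text \<open>The squared increments are summable even with weights 2^k, so the weighted series is
  finite almost everywhere. The inequality b \<le> 2^k b^2 + 2^(-k) then makes the increments
  themselves absolutely summable at such points.\<close>

lemma L2_complete_subsequence:
  fixes us :: "nat \<Rightarrow> 'a::euclidean_space \<Rightarrow> real"
  assumes "\<And>n. us n \<in> L2_space \<Omega>"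
    and "\<And>k. (L2_dist \<Omega> (us (Suc k)) (us k))\<^sup>2 \<le> (1/4) ^ k"
  shows "AE x in lebesgue_on \<Omega>. convergent (\<lambda>k. us k x)"
proof -
  let ?M = "lebesgue_on \<Omega>"
  have [measurable]: "us n \<in> borel_measurable ?M" for n using assms(1) by (rule L2_spaceD)
  define d where "d k x = 2 ^ k * (us (Suc k) x - us k x)\<^sup>2" for k x
  have [measurable]: "d k \<in> borel_measurable ?M" for k unfolding d_def by measurable
  have d0: "0 \<le> d k x" for k x by (simp add: d_def)
  have "(\<integral>\<^sup>+x. ennreal (d k x) \<partial>?M) \<le> ennreal ((1/2) ^ k)" for k
  proof -
    have i: "integrable ?M (\<lambda>x. (us (Suc k) x - us k x)\<^sup>2)"
      using L2_spaceD(2)[OF L2.diff[OF assms(1) assms(1)]] .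
    have "(\<integral>\<^sup>+x. ennreal (d k x) \<partial>?M) = ennreal (2 ^ k * (L2_dist \<Omega> (us (Suc k)) (us k))\<^sup>2)"
      unfolding L2_dist_def L2_norm_sq d_def using i by (simp add: nn_integral_eq_integral)
    also have "\<dots> \<le> ennreal (2 ^ k * (1/4) ^ k)"
      using assms(2)[of k] by (intro ennreal_leI mult_left_mono) auto
    also have "(2::real) ^ k * (1/4) ^ k = (1/2) ^ k" by (simp flip: power_mult_distrib)
    finally show ?thesis .
  qed
  then have "(\<Sum>k. \<integral>\<^sup>+x. ennreal (d k x) \<partial>?M) \<le> (\<Sum>k. ennreal ((1/2) ^ k))"
    by (intro suminf_le) auto
  also have "\<dots> < \<infinity>"
    by (subst suminf_ennreal2) (auto intro: summable_geometric)
  finally have "(\<integral>\<^sup>+x. (\<Sum>k. ennreal (d k x)) \<partial>?M) \<noteq> \<infinity>" by (simp add: nn_integral_suminf)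
  then have "AE x in ?M. (\<Sum>k. ennreal (d k x)) \<noteq> \<infinity>"
    by (intro nn_integral_PInf_AE) auto
  then show ?thesis
  proof eventually_elim
    case (elim x)
    then have "summable (\<lambda>k. d k x)" using d0 by (intro summable_suminf_not_top) auto
    moreover have "summable (\<lambda>k. (1/2::real) ^ k)" by (intro summable_geometric) simp
    ultimately have sm: "summable (\<lambda>k. d k x + (1/2) ^ k)" by (rule summable_add)
    have le: "norm (us (Suc k) x - us k x) \<le> d k x + (1/2) ^ k" for k
    proof -
      have aux: "b \<le> a * b\<^sup>2 + 1 / a" if "a > 0" "b \<ge> 0" for a b :: real
      proof -
        have "0 \<le> (a * b - 1)\<^sup>2 / a" using that by simp
        also have "\<dots> = a * b\<^sup>2 - 2 * b + 1 / a"
          using that by (simp add: power2_eq_square field_simps)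
        finally show ?thesis using that by linarith
      qed
      show ?thesis
        using aux[of "2 ^ k" "\<bar>us (Suc k) x - us k x\<bar>"] by (simp add: d_def power_one_over)
    qed
    have "summable (\<lambda>k. us (Suc k) x - us k x)"
      by (rule summable_comparison_test'[OF sm le])
    then have "convergent (\<lambda>n. \<Sum>k<n. us (Suc k) x - us k x)" by (simp add: summable_iff_convergent)
    then have "convergent (\<lambda>n. us n x - us 0 x)" 
      using sum_lessThan_telescope[of "\<lambda>k. us k x"] by simp
    from convergent_add[OF this convergent_const[of "us 0 x"]] show ?case by simp
  qed
qed

text \<open>Fatou's lemma. In \<open>L2_complete\<close> it is applied to the differences of a fixed
  member and a fast subsequence, so it yields the distance to the limit together with its square
  integrability.\<close>

lemma L2_Fatou:
  fixes us :: "nat \<Rightarrow> 'a::euclidean_space \<Rightarrow> real"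
  assumes "\<And>n. us n \<in> L2_space \<Omega>" "u \<in> borel_measurable (lebesgue_on \<Omega>)"
    and "AE x in lebesgue_on \<Omega>. (\<lambda>k. us k x) \<longlonglongrightarrow> u x"
    and "\<And>k. k \<ge> N \<Longrightarrow> L2_norm \<Omega> (us k) \<le> e"
  shows "u \<in> L2_space \<Omega>" "L2_norm \<Omega> u \<le> e"
proof -
  let ?M = "lebesgue_on \<Omega>"
  have [measurable]: "us n \<in> borel_measurable ?M" "u \<in> borel_measurable ?M" for n
    using assms(1,2) L2_spaceD(1) by auto
  have e: "0 \<le> e" using order_trans[OF L2.nrm_nonneg[OF assms(1)] assms(4)[unfolded L2_nrm_eq[symmetric]]] by blast
  have "(\<integral>\<^sup>+x. ennreal ((u x)\<^sup>2) \<partial>?M) = (\<integral>\<^sup>+x. liminf (\<lambda>k. ennreal ((us k x)\<^sup>2)) \<partial>?M)"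
  proof (rule nn_integral_cong_AE)
    show "AE x in ?M. ennreal ((u x)\<^sup>2) = liminf (\<lambda>k. ennreal ((us k x)\<^sup>2))"
      using assms(3)
    proof eventually_elim
      case (elim x)
      then have "(\<lambda>k. ennreal ((us k x)\<^sup>2)) \<longlonglongrightarrow> ennreal ((u x)\<^sup>2)"
        by (intro tendsto_ennrealI tendsto_power)
      from lim_imp_Liminf[OF _ this] show ?case by simp
    qed
  qed
  also have "\<dots> \<le> liminf (\<lambda>k. \<integral>\<^sup>+x. ennreal ((us k x)\<^sup>2) \<partial>?M)"
    by (rule nn_integral_liminf) simp
  also have "\<dots> \<le> ennreal (e\<^sup>2)"
  proof (rule Liminf_le)
    show "\<forall>\<^sub>F k in sequentially. (\<integral>\<^sup>+x. ennreal ((us k x)\<^sup>2) \<partial>?M) \<le> ennreal (e\<^sup>2)"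
      unfolding eventually_sequentially
    proof (intro exI[of _ N] allI impI)
      fix k assume "N \<le> k"
      have "(\<integral>\<^sup>+x. ennreal ((us k x)\<^sup>2) \<partial>?M) = ennreal ((L2_norm \<Omega> (us k))\<^sup>2)"
        unfolding L2_norm_sq using L2_spaceD(2)[OF assms(1)] by (simp add: nn_integral_eq_integral)
      also have "\<dots> \<le> ennreal (e\<^sup>2)"
        using assms(4)[OF \<open>N \<le> k\<close>] L2.nrm_nonneg[OF assms(1)[of k]]
        by (intro ennreal_leI power_mono) (simp_all add: L2_nrm_eq)
      finally show "(\<integral>\<^sup>+x. ennreal ((us k x)\<^sup>2) \<partial>?M) \<le> ennreal (e\<^sup>2)" .
    qed
  qed simp
  finally have fin: "(\<integral>\<^sup>+x. ennreal ((u x)\<^sup>2) \<partial>?M) \<le> ennreal (e\<^sup>2)" .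
  then have i: "integrable ?M (\<lambda>x. (u x)\<^sup>2)"
    by (intro integrableI_nonneg) (auto intro: le_less_trans)
  then show "u \<in> L2_space \<Omega>" by (simp add: L2_space_def)
  have "ennreal ((L2_norm \<Omega> u)\<^sup>2) \<le> ennreal (e\<^sup>2)"
    unfolding L2_norm_sq using fin i by (simp add: nn_integral_eq_integral)
  then have "(L2_norm \<Omega> u)\<^sup>2 \<le> e\<^sup>2" by simp
  then show "L2_norm \<Omega> u \<le> e" using e by (rule power2_le_imp_le)
qed

theorem L2_complete:
  assumes "\<And>n. us n \<in> L2_space \<Omega>" "L2.cauchy \<Omega> us"
  obtains u where "u \<in> L2_space \<Omega>" "(\<lambda>n. L2_dist \<Omega> (us n) u) \<longlonglongrightarrow> 0"
proof -
  have c: "\<exists>M. \<forall>m\<ge>M. \<forall>n\<ge>M. L2_dist \<Omega> (us m) (us n) < e" if "e > 0" for e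
    using L2.cauchyD[OF assms(2,1) that] by (simp add: L2_dist_nrm)
  \<comment> \<open>A Cauchy modulus as a function of the tolerance, so that the subsequence can be
    defined by recursion.\<close>
  define M where "M e = (SOME M. \<forall>m\<ge>M. \<forall>n\<ge>M. L2_dist \<Omega> (us m) (us n) < e)" for e
  have M: "L2_dist \<Omega> (us m) (us n) < e" if "e > 0" "m \<ge> M e" "n \<ge> M e" for e m n
    using someI_ex[OF c[OF that(1)]] that unfolding M_def by blast
  define r where "r = rec_nat (M 1) (\<lambda>k i. max i (M ((1/2) ^ Suc k)))"
  have r0: "r 0 = M 1" and rS: "r (Suc k) = max (r k) (M ((1/2) ^ Suc k))" for k
    by (simp_all add: r_def)
  have rM: "r k \<ge> M ((1/2) ^ k)" for k by (cases k) (simp_all add: r0 rS)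
  have mono: "r k \<le> r j" if "k \<le> j" for k j
    using that by (induction j rule: dec_induct) (auto simp: rS)
  let ?v = "\<lambda>k. us (r k)"
  have "(L2_dist \<Omega> (?v (Suc k)) (?v k))\<^sup>2 \<le> (1/4) ^ k" for k
  proof -
    have "L2_dist \<Omega> (?v (Suc k)) (?v k) < (1/2) ^ k"
      using rM[of k] mono[of k "Suc k"] by (intro M) auto
    then have "(L2_dist \<Omega> (?v (Suc k)) (?v k))\<^sup>2 \<le> ((1/2) ^ k)\<^sup>2"
      by (intro power_mono) (auto simp: L2_dist_nonneg)
    then show ?thesis by (simp add: power2_eq_square flip: power_mult_distrib)
  qed
  then have conv: "AE x in lebesgue_on \<Omega>. convergent (\<lambda>k. ?v k x)"
    using assms(1) by (intro L2_complete_subsequence) auto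
  define u where "u x = lim (\<lambda>k. ?v k x)" for x
  have [measurable]: "us n \<in> borel_measurable (lebesgue_on \<Omega>)" for n using assms(1) by (rule L2_spaceD)
  have um: "u \<in> borel_measurable (lebesgue_on \<Omega>)"
    unfolding u_def by (rule borel_measurable_lim_metric) simp
  have lim: "AE x in lebesgue_on \<Omega>. (\<lambda>k. ?v k x) \<longlonglongrightarrow> u x"
    using conv by eventually_elim (simp add: u_def convergent_LIMSEQ_iff)
  have main: "(\<lambda>x. us n x - u x) \<in> L2_space \<Omega> \<and> L2_dist \<Omega> (us n) u \<le> e + e"
    if "e > 0" "n \<ge> M e" for e n
  proof -
    obtain j where j: "(1/2) ^ j < e" using real_arch_pow_inv[of e "1/2"] \<open>e > 0\<close> by auto
    have close: "L2_norm \<Omega> (\<lambda>x. us n x - ?v k x) \<le> e + e" if "k \<ge> j" for k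
    proof -
      \<comment> \<open>An index large enough for both comparisons: with \<open>us n\<close> at
        tolerance e, and with \<open>?v k\<close> at tolerance 2^(-j).\<close>
      let ?i = "max (r k) (M e)"
      have "L2_dist \<Omega> (us n) (?v k) \<le> L2_dist \<Omega> (us n) (us ?i) + L2_dist \<Omega> (us ?i) (?v k)"
        by (intro L2_dist_triangle assms)
      moreover have "L2_dist \<Omega> (us n) (us ?i) < e" using \<open>n \<ge> M e\<close> \<open>e > 0\<close> by (intro M) auto
      moreover have "L2_dist \<Omega> (us ?i) (?v k) < (1/2) ^ j"
      proof (rule M)
        show "M ((1/2) ^ j) \<le> r k" using rM[of j] mono[OF that] by simp
        then show "M ((1/2) ^ j) \<le> ?i" by simp
      qed simp
      ultimately show ?thesis using j by (simp add: L2_dist_def)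
    qed
    have L: "(\<lambda>x. us n x - ?v k x) \<in> L2_space \<Omega>" for k by (intro L2.diff assms)
    have m: "(\<lambda>x. us n x - u x) \<in> borel_measurable (lebesgue_on \<Omega>)" using um by simp
    have l: "AE x in lebesgue_on \<Omega>. (\<lambda>k. us n x - ?v k x) \<longlonglongrightarrow> us n x - u x"
      using lim by eventually_elim (intro tendsto_intros)
    show ?thesis using L2_Fatou[OF L m l close] by (simp add: L2_dist_def)
  qed
  show thesis
  proof
    \<comment> \<open>So far only differences with u are known to be in L^2; subtracting one of them
      from a member of the sequence recovers u.\<close>
    have "(\<lambda>x. us (M 1) x - (us (M 1) x - u x)) \<in> L2_space \<Omega>"
      by (rule L2.diff[OF assms(1)]) (use main[of 1 "M 1"] in simp)
    then show "u \<in> L2_space \<Omega>" by simp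
    show "(\<lambda>n. L2_dist \<Omega> (us n) u) \<longlonglongrightarrow> 0"
    proof (rule LIMSEQ_I)
      fix e :: real assume "e > 0"
      then have "norm (L2_dist \<Omega> (us n) u - 0) < e" if "n \<ge> M (e / 3)" for n
        using main[of "e / 3" n] that L2_dist_nonneg[of \<Omega> "us n" u] by simp
      then show "\<exists>N. \<forall>n\<ge>N. norm (L2_dist \<Omega> (us n) u - 0) < e" by blast
    qed
  qed
qed

subsection \<open>Riesz representation and the fundamental lemma of the calculus of variations\<close>

lemma L2_norm_nonneg: "0 \<le> L2_norm \<Omega> u"
  by (simp add: L2_norm_def L2_inner_def)

lemma L2_Cauchy_Schwarz:
  "u \<in> L2_space \<Omega> \<Longrightarrow> v \<in> L2_space \<Omega> \<Longrightarrow> \<bar>L2_inner \<Omega> u v\<bar> \<le> L2_norm \<Omega> u * L2_norm \<Omega> v"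
  using L2.Cauchy_Schwarz[of u \<Omega> v] by (simp add: L2_nrm_eq)

lemma L2_inner_tendsto:
  assumes "\<And>n. us n \<in> L2_space \<Omega>" "u \<in> L2_space \<Omega>" "v \<in> L2_space \<Omega>"
    and "(\<lambda>n. L2_dist \<Omega> (us n) u) \<longlonglongrightarrow> 0"
  shows "(\<lambda>n. L2_inner \<Omega> (us n) v) \<longlonglongrightarrow> L2_inner \<Omega> u v"
proof -
  have "(\<lambda>n. L2_inner \<Omega> (\<lambda>x. us n x - u x) v) \<longlonglongrightarrow> 0"
    by (rule L2.null_inner_tendsto[of _ _ "\<lambda>_. v"])
      (use assms in \<open>auto simp: L2_dist_nrm intro: L2.diff\<close>)
  then show ?thesis using assms by (simp add: L2.diff_left LIM_zero_iff)
qed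

lemma L2_norm_tendsto:
  assumes "\<And>n. us n \<in> L2_space \<Omega>" "u \<in> L2_space \<Omega>" "(\<lambda>n. L2_dist \<Omega> (us n) u) \<longlonglongrightarrow> 0"
  shows "(\<lambda>n. L2_norm \<Omega> (us n)) \<longlonglongrightarrow> L2_norm \<Omega> u"
proof -
  have "norm (L2_norm \<Omega> (us n) - L2_norm \<Omega> u) \<le> L2_dist \<Omega> (us n) u" for n
    using L2.nrm_diff_ge[OF assms(1,2)] by (simp add: L2_dist_nrm L2_nrm_eq)
  then have "(\<lambda>n. L2_norm \<Omega> (us n) - L2_norm \<Omega> u) \<longlonglongrightarrow> 0"
    by (intro Lim_null_comparison[OF always_eventually assms(3)]) blast
  then show ?thesis by (simp add: LIM_zero_iff)
qed

text \<open>V need not be complete, so the representing element is the L^2 limit of a sequence in V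
  that minimizes the squared norm minus 2 l. The sequence is returned as well: it records that h
  lies in the closure of V, which lets h serve as an orthogonal projection.\<close>

lemma L2_Riesz:
  assumes "V \<subseteq> L2_space \<Omega>" "semi_inner V (L2_inner \<Omega>)"
    and l_lin: "\<And>u v c. u \<in> V \<Longrightarrow> v \<in> V \<Longrightarrow> l (\<lambda>x. u x + c * v x) = l u + c * l v"
    and l_bound: "\<And>u. u \<in> V \<Longrightarrow> \<bar>l u\<bar> \<le> C * L2_norm \<Omega> u" and "0 \<le> C"
  obtains h vs where "h \<in> L2_space \<Omega>" "L2_norm \<Omega> h \<le> C" "\<And>v. v \<in> V \<Longrightarrow> l v = L2_inner \<Omega> h v"
    "\<And>n. vs n \<in> V" "(\<lambda>n. L2_dist \<Omega> (vs n) h) \<longlonglongrightarrow> 0"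
proof -
  interpret V: semi_inner V "L2_inner \<Omega>" by fact
  have bound: "\<bar>l u\<bar> \<le> C * V.nrm u" if "u \<in> V" for u
    using l_bound[OF that] by (simp add: L2_nrm_eq)
  let ?m = "V.minimum l"
  obtain vs where vs: "\<And>n. vs n \<in> V" "(\<lambda>n. L2_inner \<Omega> (vs n) (vs n) - 2 * l (vs n)) \<longlonglongrightarrow> ?m"
    using V.minimizing_sequence_exists[OF l_lin bound] by blast
  have vsL: "vs n \<in> L2_space \<Omega>" for n using vs(1) assms(1) by blast
  have "V.cauchy vs" using V.minimizing_cauchy[OF l_lin bound vs] .
  then obtain h where h: "h \<in> L2_space \<Omega>" "(\<lambda>n. L2_dist \<Omega> (vs n) h) \<longlonglongrightarrow> 0"
    using L2_complete[of vs \<Omega>] vsL by blast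
  let ?e = "\<lambda>n. sqrt (L2_inner \<Omega> (vs n) (vs n) - 2 * l (vs n) - ?m)"
  have e0: "?e \<longlonglongrightarrow> 0"
    using tendsto_real_sqrt[OF tendsto_diff[OF vs(2) tendsto_const[of ?m]]]
    unfolding diff_self real_sqrt_zero .
  have EL: "\<bar>L2_inner \<Omega> (vs n) v - l v\<bar> \<le> ?e n * L2_norm \<Omega> v" if "v \<in> V" for n v
    using V.minimizing_Euler_Lagrange[OF l_lin bound vs(1) that] unfolding L2_nrm_eq .
  have rep: "l v = L2_inner \<Omega> h v" if v: "v \<in> V" for v
  proof -
    have "(\<lambda>n. ?e n * L2_norm \<Omega> v) \<longlonglongrightarrow> 0" using tendsto_mult_left_zero[OF e0] .
    then have "(\<lambda>n. L2_inner \<Omega> (vs n) v - l v) \<longlonglongrightarrow> 0"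
      by (rule Lim_null_comparison[rotated]) (use EL[OF v] in simp)
    then have "(\<lambda>n. L2_inner \<Omega> (vs n) v) \<longlonglongrightarrow> l v" by (simp add: LIM_zero_iff)
    moreover have "(\<lambda>n. L2_inner \<Omega> (vs n) v) \<longlonglongrightarrow> L2_inner \<Omega> h v"
      using v assms(1) by (intro L2_inner_tendsto vsL h) auto
    ultimately show ?thesis by (rule LIMSEQ_unique)
  qed
  have "L2_norm \<Omega> (vs n) \<le> C + ?e n" for n
  proof -
    \<comment> \<open>Testing the approximate Euler--Lagrange equation with \<open>vs n\<close>
      itself bounds its norm by C plus an error that tends to 0.\<close>
    have "(L2_norm \<Omega> (vs n))\<^sup>2 = (L2_inner \<Omega> (vs n) (vs n) - l (vs n)) + l (vs n)"
      using L2.nrm_sq[OF vsL] by (simp add: L2_nrm_eq)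
    also have "\<dots> \<le> ?e n * L2_norm \<Omega> (vs n) + C * L2_norm \<Omega> (vs n)"
      using EL[OF vs(1), of n n] l_bound[OF vs(1), of n] by linarith
    finally have le: "L2_norm \<Omega> (vs n) * L2_norm \<Omega> (vs n) \<le> (C + ?e n) * L2_norm \<Omega> (vs n)"
      unfolding power2_eq_square distrib_right by linarith
    have "?m \<le> L2_inner \<Omega> (vs n) (vs n) - 2 * l (vs n)" by (rule V.minimum_le[OF l_lin bound vs(1)])
    then have e: "0 \<le> ?e n" by (intro real_sqrt_ge_zero) linarith
    show ?thesis
    proof (cases "L2_norm \<Omega> (vs n) = 0")
      case False
      then have "0 < L2_norm \<Omega> (vs n)" using L2_norm_nonneg[of \<Omega> "vs n"] by simp
      then show ?thesis using le by (rule mult_right_le_imp_le[rotated])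
    qed (use e \<open>0 \<le> C\<close> in linarith)
  qed
  moreover have "(\<lambda>n. L2_norm \<Omega> (vs n)) \<longlonglongrightarrow> L2_norm \<Omega> h" by (intro L2_norm_tendsto vsL h)
  moreover have "(\<lambda>n. C + ?e n) \<longlonglongrightarrow> C" using tendsto_add[OF tendsto_const e0, of C] by simp
  ultimately have "L2_norm \<Omega> h \<le> C" by (intro LIMSEQ_le) auto
  then show thesis using that h rep vs(1) by blast
qed

lemma test_functions_semi_inner:
  assumes "bounded \<Omega>" "\<Omega> \<in> sets lebesgue"
  shows "semi_inner (test_functions \<Omega>) (L2_inner \<Omega>)"
proof
  show "L2_inner \<Omega> (\<lambda>x. u x + c * v x) w = L2_inner \<Omega> u w + c * L2_inner \<Omega> v w"
    if "u \<in> test_functions \<Omega>" "v \<in> test_functions \<Omega>" "w \<in> test_functions \<Omega>" for u v w c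
    using that by (intro L2.lin test_function_L2[OF assms])
  show "L2_inner \<Omega> u v = L2_inner \<Omega> v u" for u v by (simp add: L2_inner_def mult.commute)
  show "0 \<le> L2_inner \<Omega> u u" for u by (simp add: L2_inner_def)
qed (intro zero_test_function test_function_add_cmult)+

lemma L2_integrable:
  assumes "bounded \<Omega>" "\<Omega> \<in> sets lebesgue" "g \<in> L2_space \<Omega>"
  shows "integrable (lebesgue_on \<Omega>) g"
proof -
  have "(\<lambda>_. 1) \<in> L2_space \<Omega>" by (rule L2_space_bounded[OF assms(1,2), of _ 1]) auto
  from L2_mult_integrable[OF assms(3) this] show ?thesis by simp
qed

lemma L2_inner_indicator_limit:
  assumes "bounded \<Omega>" "\<Omega> \<in> sets lebesgue" "g \<in> L2_space \<Omega>"
  shows "(\<lambda>n. L2_inner \<Omega> g (bump (real (Suc n)) p q)) \<longlonglongrightarrow> L2_inner \<Omega> g (indicator (box p q))"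
  unfolding L2_inner_def
proof (rule integral_dominated_convergence[where w="\<lambda>x. \<bar>g x\<bar>"])
  have [measurable]: "g \<in> borel_measurable (lebesgue_on \<Omega>)" using assms by (rule_tac L2_spaceD)
  have [measurable]: "bump k p q \<in> borel_measurable (lebesgue_on \<Omega>)" for k
    by (intro continuous_measurable_lebesgue_on Ck_imp_continuous[OF Ck_bump])
  have [measurable]: "(indicator (box p q) :: 'a \<Rightarrow> real) \<in> borel_measurable (lebesgue_on \<Omega>)"
    by (intro measurable_restrict_space1 measurable_completion) simp
  show "(\<lambda>x. g x * indicator (box p q) x) \<in> borel_measurable (lebesgue_on \<Omega>)"
    "(\<lambda>x. g x * bump (real (Suc n)) p q x) \<in> borel_measurable (lebesgue_on \<Omega>)" for n by measurable
  show "integrable (lebesgue_on \<Omega>) (\<lambda>x. \<bar>g x\<bar>)" using L2_integrable[OF assms] by simp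
  show "AE x in lebesgue_on \<Omega>. (\<lambda>n. g x * bump (real (Suc n)) p q x) \<longlonglongrightarrow> g x * indicator (box p q) x"
    by (intro always_eventually allI tendsto_mult tendsto_const bump_tendsto)
  show "AE x in lebesgue_on \<Omega>. norm (g x * bump (real (Suc n)) p q x) \<le> \<bar>g x\<bar>" for n
    using bump_bounds[of "real (Suc n)" p q]
    by (intro always_eventually allI) (simp add: abs_mult mult_left_le del: of_nat_Suc)
qed

text \<open>Bumps converge boundedly to indicators of boxes, so the integral of g over every box in
  \<Omega> vanishes; Lebesgue differentiation over small cubes then gives g = 0 almost
  everywhere.\<close>

theorem fundamental_lemma:
  assumes "open \<Omega>" "bounded \<Omega>" "g \<in> L2_space \<Omega>"
    and "\<And>\<phi>. \<phi> \<in> test_functions \<Omega> \<Longrightarrow> L2_inner \<Omega> g \<phi> = 0"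
  shows "AE x in lebesgue_on \<Omega>. g x = 0"
proof -
  have \<Omega>: "\<Omega> \<in> sets lebesgue" using assms(1) by auto
  have gi: "integrable (lebesgue_on \<Omega>) g" by (rule L2_integrable[OF assms(2) \<Omega> assms(3)])
  define f where "f x = indicator \<Omega> x *\<^sub>R g x" for x
  have fi: "integrable lebesgue f"
    using gi \<Omega> unfolding f_def by (subst (asm) integrable_restrict_space) auto
  have "f integrable_on UNIV"
    using fi by (rule integrable_on_lebesgue)
  then have "f integrable_on cbox p q" for p q by (rule integrable_on_subcbox) simp
  then obtain N where N: "negligible N" "\<And>x e. x \<notin> N \<Longrightarrow> 0 < e \<Longrightarrow> \<exists>d>0. \<forall>h. 0 < h \<and> h < d \<longrightarrow>
      norm (integral (cbox x (x + h *\<^sub>R One)) f /\<^sub>R h ^ DIM('a) - f x) < e"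
    using integrable_ccontinuous_explicit[of f] by blast
  have z: "integral (cbox p q) f = 0" if "cbox p q \<subseteq> \<Omega>" for p q
  proof -
    have "L2_inner \<Omega> g (bump (real (Suc n)) p q) = 0" for n
      using that by (intro assms(4) bump_test_function) auto
    then have "L2_inner \<Omega> g (indicator (box p q)) = 0"
      using L2_inner_indicator_limit[OF assms(2) \<Omega> assms(3), of p q] by (simp add: LIMSEQ_const_iff)
    moreover have "L2_inner \<Omega> g (indicator (box p q)) = integral\<^sup>L (lebesgue_on (box p q)) f"
    proof -
      have "L2_inner \<Omega> g (indicator (box p q))
          = integral\<^sup>L lebesgue (\<lambda>x. indicator \<Omega> x *\<^sub>R (g x * indicator (box p q) x))"
        unfolding L2_inner_def using \<Omega> by (intro integral_restrict_space) simp
      also have "\<dots> = integral\<^sup>L lebesgue (\<lambda>x. indicator (box p q) x *\<^sub>R f x)"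
        by (intro Bochner_Integration.integral_cong) (auto simp: f_def)
      also have "\<dots> = integral\<^sup>L (lebesgue_on (box p q)) f"
        by (intro integral_restrict_space[symmetric]) simp
      finally show ?thesis .
    qed
    moreover have "integral\<^sup>L (lebesgue_on (box p q)) f = integral (box p q) f"
    proof (rule lebesgue_integral_eq_integral)
      have "integrable lebesgue (\<lambda>x. indicator (box p q) x *\<^sub>R f x)"
        by (rule integrable_mult_indicator[OF _ fi]) simp
      then show "integrable (lebesgue_on (box p q)) f"
        by (subst integrable_restrict_space) simp_all
    qed simp
    ultimately show ?thesis by (simp add: integral_open_interval)
  qed
  have "f x = 0" if x: "x \<notin> N" "x \<in> \<Omega>" for x
  proof (rule ccontr)
    assume "f x \<noteq> 0"
    then obtain d where d: "d > 0" "\<And>h. 0 < h \<Longrightarrow> h < d \<Longrightarrow>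
      norm (integral (cbox x (x + h *\<^sub>R One)) f /\<^sub>R h ^ DIM('a) - f x) < norm (f x)"
      using N(2)[OF x(1), of "norm (f x)"] by auto
    obtain r where r: "r > 0" "cball x r \<subseteq> \<Omega>" using assms(1) x(2) open_contains_cball by blast
    \<comment> \<open>Half of d makes h < d strict; a cube of side r / DIM('a) has l^1 diameter r
      and hence stays inside the ball.\<close>
    define h where "h = min (d / 2) (r / DIM('a))"
    have h: "0 < h" "h < d" "h * DIM('a) \<le> r" unfolding h_def using d(1) r(1)
      by (auto simp: min_def field_simps)
    have "cbox x (x + h *\<^sub>R One) \<subseteq> cball x r"
    proof
      fix y assume y: "y \<in> cbox x (x + h *\<^sub>R One)"
      have "norm (y - x) \<le> (\<Sum>i\<in>Basis. \<bar>(y - x) \<bullet> i\<bar>)" by (rule norm_le_l1)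
      also have "\<dots> \<le> (\<Sum>i\<in>(Basis::'a set). h)"
        using y by (intro sum_mono) (auto simp: mem_box inner_diff_left inner_add_left)
      also have "\<dots> \<le> r" using h by (simp add: mult.commute)
      finally show "y \<in> cball x r" by (simp add: dist_norm norm_minus_commute)
    qed
    then show False using d(2)[OF h(1,2)] z[of x "x + h *\<^sub>R One"] r(2) by auto
  qed
  then have "AE x in lebesgue. x \<in> \<Omega> \<longrightarrow> g x = 0"
    using N(1) by (intro AE_I'[of N]) (auto simp: negligible_iff_null_sets f_def)
  then show ?thesis using \<Omega> by (simp add: AE_restrict_space_iff)
qed

subsection \<open>Translations and weak derivatives\<close>

lemma lebesgue_distr_translation:
  fixes a :: "'a::euclidean_space"
  shows "distr lebesgue lebesgue (\<lambda>x. x + a) = lebesgue"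
    and measurable_lebesgue_translation: "(\<lambda>x. x + a) \<in> lebesgue \<rightarrow>\<^sub>M lebesgue"
proof -
  \<comment> \<open>Translation as the affine map whose scalings are all 1.\<close>
  have eq: "(\<lambda>x. a + (\<Sum>j\<in>Basis. (1 * (x \<bullet> j)) *\<^sub>R j)) = (\<lambda>x::'a. x + a)"
    by (simp add: euclidean_representation add.commute)
  show "(\<lambda>x. x + a) \<in> lebesgue \<rightarrow>\<^sub>M lebesgue"
    using lebesgue_affine_measurable[of "\<lambda>_. 1" a] unfolding eq by simp
  show "distr lebesgue lebesgue (\<lambda>x. x + a) = lebesgue"
    using lebesgue_affine_euclidean[of "\<lambda>_. 1" a] unfolding eq by (simp add: density_1)
qed

lemma integral_lebesgue_translation:
  fixes f :: "'a::euclidean_space \<Rightarrow> real"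
  assumes "f \<in> borel_measurable lebesgue"
  shows "(LINT x|lebesgue. f (x + a)) = (LINT x|lebesgue. f x)"
    and "integrable lebesgue (\<lambda>x. f (x + a)) \<longleftrightarrow> integrable lebesgue f"
  using integral_distr[OF measurable_lebesgue_translation assms, of a]
    integrable_distr_eq[OF measurable_lebesgue_translation assms, of a]
  by (simp_all add: lebesgue_distr_translation)

lemma borel_measurable_lebesgue_on_iff:
  fixes f :: "'a::euclidean_space \<Rightarrow> real"
  assumes "S \<in> sets lebesgue"
  shows "f \<in> borel_measurable (lebesgue_on S) \<longleftrightarrow> (\<lambda>x. indicator S x * f x) \<in> borel_measurable lebesgue"
  using assms borel_measurable_restrict_space_iff[of S lebesgue f] by simp

lemma translate_measurable:
  fixes v :: "'a::euclidean_space \<Rightarrow> real"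
  assumes "v \<in> borel_measurable (lebesgue_on \<Omega>)" "\<Omega> \<in> sets lebesgue" "\<omega> \<in> sets lebesgue"
    and "(\<lambda>x. x + a) ` \<omega> \<subseteq> \<Omega>"
  shows "(\<lambda>x. v (x + a)) \<in> borel_measurable (lebesgue_on \<omega>)"
proof -
  have [measurable]: "(\<lambda>x. indicator \<Omega> x * v x) \<in> borel_measurable lebesgue"
    using assms borel_measurable_lebesgue_on_iff by blast
  have "(\<lambda>x. indicator \<Omega> (x + a) * v (x + a)) \<in> borel_measurable lebesgue"
    using measurable_compose[OF measurable_lebesgue_translation, of "\<lambda>x. indicator \<Omega> x * v x" borel a]
    by simp
  moreover have "(\<lambda>x. indicator \<omega> x :: real) \<in> borel_measurable lebesgue" using assms(3) by simp
  ultimately have "(\<lambda>x. indicator \<omega> x * (indicator \<Omega> (x + a) * v (x + a))) \<in> borel_measurable lebesgue"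
    by (rule borel_measurable_times[rotated])
  moreover have "(\<lambda>x. indicator \<omega> x * (indicator \<Omega> (x + a) * v (x + a))) = (\<lambda>x. indicator \<omega> x * v (x + a))"
    using assms(4) by (auto simp: indicator_def fun_eq_iff)
  ultimately show ?thesis using borel_measurable_lebesgue_on_iff[OF assms(3)] by metis
qed

text \<open>Both integrals are those of extensions by zero over the whole space, where Lebesgue
  measure is translation invariant. As \<omega> + a may be a proper subset of \<Omega>, f has to
  vanish on the rest.\<close>

lemma integral_translate:
  fixes f :: "'a::euclidean_space \<Rightarrow> real"
  assumes "f \<in> borel_measurable (lebesgue_on \<Omega>)" "\<Omega> \<in> sets lebesgue" "\<omega> \<in> sets lebesgue"
    and "(\<lambda>x. x + a) ` \<omega> \<subseteq> \<Omega>" "\<And>x. x + a \<in> \<Omega> \<Longrightarrow> x \<notin> \<omega> \<Longrightarrow> f (x + a) = 0"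
  shows "(LINT x|lebesgue_on \<Omega>. f x) = (LINT x|lebesgue_on \<omega>. f (x + a))"
    and "integrable (lebesgue_on \<Omega>) f \<longleftrightarrow> integrable (lebesgue_on \<omega>) (\<lambda>x. f (x + a))"
proof -
  have m: "(\<lambda>x. indicator \<Omega> x * f x) \<in> borel_measurable lebesgue"
    using assms borel_measurable_lebesgue_on_iff by blast
  have eq: "(\<lambda>x. indicator \<Omega> (x + a) * f (x + a)) = (\<lambda>x. indicator \<omega> x * f (x + a))"
    using assms(4,5) by (auto simp: indicator_def fun_eq_iff)
  show "(LINT x|lebesgue_on \<Omega>. f x) = (LINT x|lebesgue_on \<omega>. f (x + a))"
    using integral_lebesgue_translation(1)[OF m, of a] assms(2,3)
    unfolding eq by (simp add: integral_restrict_space)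
  show "integrable (lebesgue_on \<Omega>) f \<longleftrightarrow> integrable (lebesgue_on \<omega>) (\<lambda>x. f (x + a))"
    using integral_lebesgue_translation(2)[OF m, of a] assms(2,3)
    unfolding eq by (simp add: integrable_restrict_space)
qed

lemma L2_translate:
  fixes v :: "'a::euclidean_space \<Rightarrow> real"
  assumes "v \<in> L2_space \<Omega>" "\<Omega> \<in> sets lebesgue" "\<omega> \<in> sets lebesgue" "(\<lambda>x. x + a) ` \<omega> \<subseteq> \<Omega>"
  shows "(\<lambda>x. v (x + a)) \<in> L2_space \<omega>"
proof -
  have m: "(\<lambda>x. v (x + a)) \<in> borel_measurable (lebesgue_on \<omega>)"
    using assms by (intro translate_measurable L2_spaceD(1))
  \<comment> \<open>The cutoff to \<omega> + a supplies the vanishing that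
    \<open>integral_translate\<close> asks for.\<close>
  let ?f = "\<lambda>x. indicator ((\<lambda>x. x + a) ` \<omega>) x * (v x)\<^sup>2"
  have S: "(\<lambda>x. x + a) ` \<omega> \<in> sets lebesgue"
    using lebesgue_sets_translation[OF assms(3), of a] by (simp add: add.commute)
  have [measurable]: "v \<in> borel_measurable (lebesgue_on \<Omega>)" using assms(1) by (rule L2_spaceD)
  have [measurable]: "(\<lambda>x. indicator ((\<lambda>x. x + a) ` \<omega>) x :: real) \<in> borel_measurable (lebesgue_on \<Omega>)"
    using S by (intro measurable_restrict_space1) simp
  have fm: "?f \<in> borel_measurable (lebesgue_on \<Omega>)" by measurable
  have "integrable (lebesgue_on \<Omega>) ?f"
    by (rule Bochner_Integration.integrable_bound[OF L2_spaceD(2)[OF assms(1)] fm])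
      (auto simp: indicator_def)
  then have "integrable (lebesgue_on \<omega>) (\<lambda>x. ?f (x + a))"
    by (subst integral_translate(2)[OF fm assms(2,3,4), symmetric]) (auto simp: indicator_def)
  then have "integrable (lebesgue_on \<omega>) (\<lambda>x. (v (x + a))\<^sup>2)"
    by (rule Bochner_Integration.integrable_cong[THEN iffD1, OF refl, rotated])
      (auto simp: space_restrict_space indicator_def)
  then show ?thesis using m by (simp add: L2_space_def)
qed

lemma L2_subset:
  fixes v :: "'a::euclidean_space \<Rightarrow> real"
  assumes "v \<in> L2_space \<Omega>" "\<Omega> \<in> sets lebesgue" "\<omega> \<in> sets lebesgue" "\<omega> \<subseteq> \<Omega>"
  shows "v \<in> L2_space \<omega>"
  using L2_translate[OF assms(1-3), of 0] assms(4) by simp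

text \<open>One side of this identity is differentiable in the shift because the test function is
  smooth; the other exhibits the translates of v.\<close>

lemma L2_inner_translate:
  fixes v :: "'a::euclidean_space \<Rightarrow> real"
  assumes "v \<in> borel_measurable (lebesgue_on \<Omega>)" "\<Omega> \<in> sets lebesgue" "\<omega> \<in> sets lebesgue"
    and "\<phi> \<in> test_functions \<omega>" "(\<lambda>x. x + a) ` \<omega> \<subseteq> \<Omega>"
  shows "L2_inner \<Omega> v (\<lambda>x. \<phi> (x - a)) = L2_inner \<omega> (\<lambda>x. v (x + a)) \<phi>"
proof -
  obtain K where K: "K \<subseteq> \<omega>" "\<And>x. x \<notin> K \<Longrightarrow> \<phi> x = 0"
    using test_function_support[OF assms(4)] by metis
  have "(\<lambda>x. \<phi> (x - a)) \<in> borel_measurable (lebesgue_on \<Omega>)"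
    using test_function_continuous[OF test_function_translate[OF assms(4,5)]]
    by (rule continuous_measurable_lebesgue_on)
  then have m: "(\<lambda>x. v x * \<phi> (x - a)) \<in> borel_measurable (lebesgue_on \<Omega>)" using assms(1) by simp
  show ?thesis
    unfolding L2_inner_def
    using integral_translate(1)[OF m assms(2,3,5)] K by auto
qed

lemma L2_norm_translate_test_function:
  assumes "\<Omega> \<in> sets lebesgue" "\<omega> \<in> sets lebesgue"
    and "\<phi> \<in> test_functions \<omega>" "(\<lambda>x. x + a) ` \<omega> \<subseteq> \<Omega>"
  shows "L2_norm \<Omega> (\<lambda>x. \<phi> (x - a)) = L2_norm \<omega> \<phi>"
proof -
  have "(\<lambda>x. \<phi> (x - a)) \<in> borel_measurable (lebesgue_on \<Omega>)"
    using test_function_continuous[OF test_function_translate[OF assms(3,4)]]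
    by (rule continuous_measurable_lebesgue_on)
  from L2_inner_translate[OF this assms] show ?thesis by (simp add: L2_norm_def)
qed

lemma test_function_line_DERIV:
  assumes "\<phi> \<in> test_functions \<Omega>"
  shows "((\<lambda>t. \<phi> (x - t *\<^sub>R y)) has_real_derivative - dderiv \<phi> y (x - t *\<^sub>R y)) (at t)"
proof -
  have "((\<lambda>t. \<phi> (x - t *\<^sub>R y)) has_derivative
      (\<lambda>s. frechet_derivative \<phi> (at (x - t *\<^sub>R y)) (- (s *\<^sub>R y)))) (at t)"
    by (rule has_derivative_compose[OF _ test_function_has_derivative[OF assms]])
      (auto intro!: derivative_eq_intros)
  moreover have "frechet_derivative \<phi> (at (x - t *\<^sub>R y)) (- (s *\<^sub>R y)) = (- dderiv \<phi> y (x - t *\<^sub>R y)) * s" for s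
  proof -
    have l: "linear (frechet_derivative \<phi> (at (x - t *\<^sub>R y)))"
      using test_function_differentiable[OF assms] by (rule linear_frechet_derivative)
    show ?thesis by (simp add: linear_neg[OF l] linear_cmul[OF l])
  qed
  ultimately show ?thesis
    unfolding has_field_derivative_def by (elim has_derivative_eq_rhs) auto
qed

text \<open>Differentiation under the integral: the difference quotients of \<phi> are dominated by
  a bound of its derivative, and v is integrable since \<Omega> is bounded. All derivatives fall on
  \<phi>, so v may be any L^2 function.\<close>

lemma L2_inner_translate_DERIV:
  fixes v :: "'a::euclidean_space \<Rightarrow> real"
  assumes "bounded \<Omega>" "\<Omega> \<in> sets lebesgue" "v \<in> L2_space \<Omega>" "\<phi> \<in> test_functions \<Omega>'"
  shows "((\<lambda>t. L2_inner \<Omega> v (\<lambda>x. \<phi> (x - t *\<^sub>R y))) has_real_derivative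
     - L2_inner \<Omega> v (\<lambda>x. dderiv \<phi> y (x - t *\<^sub>R y))) (at t)"
proof -
  let ?M = "lebesgue_on \<Omega>"
  let ?\<psi> = "\<lambda>t x. \<phi> (x - t *\<^sub>R y)"
  obtain B where B: "0 \<le> B" "\<And>x. \<bar>dderiv \<phi> y x\<bar> \<le> B"
    using test_function_dderiv_bounded[OF assms(4)] by blast
  have vm[measurable]: "v \<in> borel_measurable ?M" using assms(3) by (rule L2_spaceD)
  have cont: "continuous_on UNIV (?\<psi> t)" for t
    using test_function_continuous[OF assms(4)]
    by (rule continuous_on_compose2[of UNIV \<phi>]) (auto intro!: continuous_intros)
  have \<psi>m[measurable]: "?\<psi> t \<in> borel_measurable ?M" for t
    by (rule continuous_measurable_lebesgue_on[OF cont])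
  have "continuous_on UNIV (\<lambda>x. dderiv \<phi> y (x - t *\<^sub>R y))"
    using test_function_dderiv_continuous[OF assms(4), of y]
    by (rule continuous_on_compose2[of UNIV "dderiv \<phi> y"]) (auto intro!: continuous_intros)
  then have dm[measurable]: "(\<lambda>x. dderiv \<phi> y (x - t *\<^sub>R y)) \<in> borel_measurable ?M"
    by (rule continuous_measurable_lebesgue_on)
  obtain A where A: "\<And>x. \<bar>\<phi> x\<bar> \<le> A" using test_function_bounded[OF assms(4)] by blast
  have \<psi>L2: "?\<psi> t \<in> L2_space \<Omega>" for t
    by (rule L2_space_bounded[OF assms(1,2) \<psi>m]) (rule A)
  have vi: "integrable ?M v" by (rule L2_integrable[OF assms(1-3)])
  have "((\<lambda>h. (L2_inner \<Omega> v (?\<psi> (t + h)) - L2_inner \<Omega> v (?\<psi> t)) / h) \<longlongrightarrow>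
     - L2_inner \<Omega> v (\<lambda>x. dderiv \<phi> y (x - t *\<^sub>R y))) (at 0)"
    unfolding tendsto_at_iff_sequentially
  proof (intro allI impI)
    fix X :: "nat \<Rightarrow> real" assume X: "\<forall>i. X i \<in> UNIV - {0}" "X \<longlonglongrightarrow> 0"
    have lim: "(\<lambda>i. LINT x|?M. v x * ((?\<psi> (t + X i) x - ?\<psi> t x) / X i)) \<longlonglongrightarrow>
       (LINT x|?M. v x * (- dderiv \<phi> y (x - t *\<^sub>R y)))"
    proof (rule integral_dominated_convergence[where w="\<lambda>x. B * \<bar>v x\<bar>"])
      show "integrable ?M (\<lambda>x. B * \<bar>v x\<bar>)" using vi by simp
      show "AE x in ?M. (\<lambda>i. v x * ((?\<psi> (t + X i) x - ?\<psi> t x) / X i)) \<longlonglongrightarrow> v x * (- dderiv \<phi> y (x - t *\<^sub>R y))"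
      proof (intro always_eventually allI tendsto_mult tendsto_const)
        fix x
        have "((\<lambda>h. (\<phi> (x - (t + h) *\<^sub>R y) - \<phi> (x - t *\<^sub>R y)) / h) \<longlongrightarrow> - dderiv \<phi> y (x - t *\<^sub>R y)) (at 0)"
          using test_function_line_DERIV[OF assms(4), of x y t] by (simp add: DERIV_def)
        then show "(\<lambda>i. (\<phi> (x - (t + X i) *\<^sub>R y) - \<phi> (x - t *\<^sub>R y)) / X i) \<longlonglongrightarrow> - dderiv \<phi> y (x - t *\<^sub>R y)"
          using X unfolding tendsto_at_iff_sequentially by (auto simp: o_def)
      qed
      show "AE x in ?M. norm (v x * ((?\<psi> (t + X i) x - ?\<psi> t x) / X i)) \<le> B * \<bar>v x\<bar>" for i
      proof (intro always_eventually allI)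
        fix x
        \<comment> \<open>Mean value inequality along the line through x in direction y.\<close>
        have "norm (?\<psi> (t + X i) x - ?\<psi> t x) \<le> B * norm (t + X i - t)"
          by (rule field_differentiable_bound[of UNIV "\<lambda>t. ?\<psi> t x" "\<lambda>t. - dderiv \<phi> y (x - t *\<^sub>R y)"])
            (use test_function_line_DERIV[OF assms(4)] B in auto)
        then have "\<bar>(?\<psi> (t + X i) x - ?\<psi> t x) / X i\<bar> \<le> B"
          using X(1)[rule_format, of i] by (simp add: field_simps)
        from mult_right_mono[OF this abs_ge_zero[of "v x"]]
        show "norm (v x * ((?\<psi> (t + X i) x - ?\<psi> t x) / X i)) \<le> B * \<bar>v x\<bar>"
          by (simp only: real_norm_def abs_mult mult.commute)
      qed
    qed measurable
    have "L2_inner \<Omega> v (?\<psi> (t + X i)) - L2_inner \<Omega> v (?\<psi> t) = L2_inner \<Omega> v (\<lambda>x. ?\<psi> (t + X i) x - ?\<psi> t x)" for i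
      by (rule L2.diff_right[OF \<psi>L2 \<psi>L2 assms(3), symmetric])
    then have eq: "(L2_inner \<Omega> v (?\<psi> (t + X i)) - L2_inner \<Omega> v (?\<psi> t)) / X i
       = (LINT x|?M. v x * ((?\<psi> (t + X i) x - ?\<psi> t x) / X i))" for i
      by (simp add: L2_inner_def)
    have "(LINT x|?M. v x * (- dderiv \<phi> y (x - t *\<^sub>R y))) = - L2_inner \<Omega> v (\<lambda>x. dderiv \<phi> y (x - t *\<^sub>R y))"
      by (simp add: L2_inner_def)
    then show "((\<lambda>h. (L2_inner \<Omega> v (?\<psi> (t + h)) - L2_inner \<Omega> v (?\<psi> t)) / h) \<circ> X) \<longlonglongrightarrow>
      - L2_inner \<Omega> v (\<lambda>x. dderiv \<phi> y (x - t *\<^sub>R y))"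
      using lim unfolding o_def eq by simp
  qed
  then show ?thesis by (simp add: DERIV_def)
qed

text \<open>A dual description of a distributional derivative along y of L^2 norm at most C. It
  names no derivative, so it involves no choice, survives L^2 limits, and can be compared with
  difference quotients.\<close>

definition weak_deriv_bound :: "'a::euclidean_space set \<Rightarrow> ('a \<Rightarrow> real) \<Rightarrow> 'a \<Rightarrow> real \<Rightarrow> bool" where
  "weak_deriv_bound \<Omega> u y C \<longleftrightarrow>
     (\<forall>\<phi>\<in>test_functions \<Omega>. \<bar>L2_inner \<Omega> u (dderiv \<phi> y)\<bar> \<le> C * L2_norm \<Omega> \<phi>)"

lemma weak_deriv_boundD:
  "weak_deriv_bound \<Omega> u y C \<Longrightarrow> \<phi> \<in> test_functions \<Omega> \<Longrightarrow>
    \<bar>L2_inner \<Omega> u (dderiv \<phi> y)\<bar> \<le> C * L2_norm \<Omega> \<phi>"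
  by (simp add: weak_deriv_bound_def)

lemma weak_deriv_bound_scaleR:
  assumes "weak_deriv_bound \<Omega> u y C"
  shows "weak_deriv_bound \<Omega> u (t *\<^sub>R y) (\<bar>t\<bar> * C)"
  unfolding weak_deriv_bound_def
proof
  fix \<phi> assume \<phi>: "\<phi> \<in> test_functions \<Omega>"
  have "dderiv \<phi> (t *\<^sub>R y) = (\<lambda>x. t * dderiv \<phi> y x)"
    using linear_cmul[OF linear_frechet_derivative[OF test_function_differentiable[OF \<phi>]]] by auto
  then have "L2_inner \<Omega> u (dderiv \<phi> (t *\<^sub>R y)) = t * L2_inner \<Omega> u (dderiv \<phi> y)"
    by (simp add: L2_inner_def mult.left_commute)
  then show "\<bar>L2_inner \<Omega> u (dderiv \<phi> (t *\<^sub>R y))\<bar> \<le> \<bar>t\<bar> * C * L2_norm \<Omega> \<phi>"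
    using weak_deriv_boundD[OF assms \<phi>] by (simp add: abs_mult mult.assoc mult_left_mono)
qed

text \<open>
  The function \<open>t \<mapsto> \<integral> u(x) \<phi>(x - ty) dx\<close> has derivative \<open>- \<integral> u \<partial>\<^sub>y\<phi>(\<cdot> - ty)\<close>, so the mean value
  theorem bounds the pairing of \<open>u(\<cdot> + y) - u\<close> with every test function; Riesz representation turns this
  into a norm bound.
\<close>

theorem translation_bound:
  fixes u :: "'a::euclidean_space \<Rightarrow> real"
  assumes "open \<Omega>" "bounded \<Omega>" "u \<in> L2_space \<Omega>" "weak_deriv_bound \<Omega> u y C" "0 \<le> C"
    and "open \<omega>" and sub: "\<And>t. 0 \<le> t \<Longrightarrow> t \<le> 1 \<Longrightarrow> (\<lambda>x. x + t *\<^sub>R y) ` \<omega> \<subseteq> \<Omega>"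
  shows "(\<lambda>x. u (x + y) - u x) \<in> L2_space \<omega>" "L2_norm \<omega> (\<lambda>x. u (x + y) - u x) \<le> C"
proof -
  have \<Omega>: "\<Omega> \<in> sets lebesgue" and \<omega>: "\<omega> \<in> sets lebesgue" using assms by auto
  have \<omega>\<Omega>: "\<omega> \<subseteq> \<Omega>" using sub[of 0] by simp
  then have b\<omega>: "bounded \<omega>" using assms(2) bounded_subset by blast
  have s1: "(\<lambda>x. x + y) ` \<omega> \<subseteq> \<Omega>" using sub[of 1] by simp
  have L2: "(\<lambda>x. u (x + y)) \<in> L2_space \<omega>" "u \<in> L2_space \<omega>"
    using L2_translate[OF assms(3) \<Omega> \<omega> s1] L2_subset[OF assms(3) \<Omega> \<omega> \<omega>\<Omega>] by auto
  let ?w = "\<lambda>x. u (x + y) - u x"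
  show w: "?w \<in> L2_space \<omega>" by (rule L2.diff[OF L2])
  have um: "u \<in> borel_measurable (lebesgue_on \<Omega>)" using assms(3) by (rule L2_spaceD)
  have bound: "\<bar>L2_inner \<omega> ?w \<phi>\<bar> \<le> C * L2_norm \<omega> \<phi>" if \<phi>: "\<phi> \<in> test_functions \<omega>" for \<phi>
  proof -
    let ?a = "\<lambda>t. L2_inner \<Omega> u (\<lambda>x. \<phi> (x - t *\<^sub>R y))"
    have a: "?a t = L2_inner \<omega> (\<lambda>x. u (x + t *\<^sub>R y)) \<phi>" if "0 \<le> t" "t \<le> 1" for t
      by (rule L2_inner_translate[OF um \<Omega> \<omega> \<phi> sub[OF that]])
    have "norm (?a 1 - ?a 0) \<le> C * L2_norm \<omega> \<phi> * norm (1 - 0 :: real)"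
    proof (rule field_differentiable_bound[of "{0..1}" ?a "\<lambda>t. - L2_inner \<Omega> u (\<lambda>x. dderiv \<phi> y (x - t *\<^sub>R y))"])
      fix t :: real assume t: "t \<in> {0..1}"
      show "(?a has_real_derivative - L2_inner \<Omega> u (\<lambda>x. dderiv \<phi> y (x - t *\<^sub>R y))) (at t within {0..1})"
        by (rule has_field_derivative_at_within[OF L2_inner_translate_DERIV[OF assms(2) \<Omega> assms(3) \<phi>]])
      have st: "(\<lambda>x. x + t *\<^sub>R y) ` \<omega> \<subseteq> \<Omega>" using sub t by simp
      let ?\<psi> = "\<lambda>x. \<phi> (x - t *\<^sub>R y)"
      have \<psi>: "?\<psi> \<in> test_functions \<Omega>" by (rule test_function_translate[OF \<phi> st])
      have "dderiv ?\<psi> y = (\<lambda>x. dderiv \<phi> y (x - t *\<^sub>R y))"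
        using frechet_derivative_translate(2)[OF test_function_differentiable[OF \<phi>]] by auto
      then show "norm (- L2_inner \<Omega> u (\<lambda>x. dderiv \<phi> y (x - t *\<^sub>R y))) \<le> C * L2_norm \<omega> \<phi>"
        using weak_deriv_boundD[OF assms(4) \<psi>] L2_norm_translate_test_function[OF \<Omega> \<omega> \<phi> st] by simp
    qed auto
    moreover have "?a 1 - ?a 0 = L2_inner \<omega> ?w \<phi>"
      using a[of 1] a[of 0] L2.diff_left[OF L2 test_function_L2(1)[OF b\<omega> \<omega> \<phi>]] by simp
    ultimately show ?thesis by simp
  qed
  obtain h where h: "h \<in> L2_space \<omega>" "L2_norm \<omega> h \<le> C"
    "\<And>\<phi>. \<phi> \<in> test_functions \<omega> \<Longrightarrow> L2_inner \<omega> ?w \<phi> = L2_inner \<omega> h \<phi>"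
  proof (rule L2_Riesz[of "test_functions \<omega>" \<omega> "L2_inner \<omega> ?w" C])
    show "test_functions \<omega> \<subseteq> L2_space \<omega>" using test_function_L2(1)[OF b\<omega> \<omega>] by blast
    show "L2_inner \<omega> ?w (\<lambda>x. f x + c * g x) = L2_inner \<omega> ?w f + c * L2_inner \<omega> ?w g"
      if "f \<in> test_functions \<omega>" "g \<in> test_functions \<omega>" for f g c
      using that by (intro L2.lin_right w test_function_L2(1)[OF b\<omega> \<omega>])
  qed (use bound test_functions_semi_inner[OF b\<omega> \<omega>] \<open>0 \<le> C\<close> that in auto)
  \<comment> \<open>Riesz representation bounds only h; as h and the difference pair equally with
    all test functions, the fundamental lemma identifies them.\<close>
  have "AE x in lebesgue_on \<omega>. ?w x - h x = 0"
  proof (rule fundamental_lemma[OF assms(6) b\<omega> L2.diff[OF w h(1)]])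
    fix \<phi> assume "\<phi> \<in> test_functions \<omega>"
    then show "L2_inner \<omega> (\<lambda>x. ?w x - h x) \<phi> = 0"
      using h L2.diff_left[OF w h(1) test_function_L2(1)[OF b\<omega> \<omega>]] by simp
  qed
  then have "AE x in lebesgue_on \<omega>. \<bar>?w x\<bar> \<le> \<bar>h x\<bar>" by eventually_elim simp
  then show "L2_norm \<omega> ?w \<le> C"
    using L2_norm_mono(2)[OF L2_spaceD(1)[OF w] h(1)] h(2) by linarith
qed

text \<open>K has a positive distance d to the complement of \<Omega>. A neighbourhood of radius d/2
  leaves room for shifts of length d/3, as 1/2 + 1/3 < 1. The set \<omega> is open so that the
  fundamental lemma and translation estimates apply on it.\<close>

lemma compact_open_thickening:
  fixes K :: "'a::euclidean_space set"
  assumes "compact K" "K \<subseteq> \<Omega>" "open \<Omega>"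
  obtains \<omega> e where "open \<omega>" "K \<subseteq> \<omega>" "\<omega> \<subseteq> \<Omega>" "0 < e" "\<And>z. norm z \<le> e \<Longrightarrow> (\<lambda>x. x + z) ` \<omega> \<subseteq> \<Omega>"
proof -
  have "closed (- \<Omega>)" "K \<inter> - \<Omega> = {}" using assms by auto
  from separate_compact_closed[OF assms(1) this]
  obtain d where d: "0 < d" "\<And>x y. x \<in> K \<Longrightarrow> y \<notin> \<Omega> \<Longrightarrow> d \<le> dist x y" by auto
  let ?\<omega> = "\<Union>x\<in>K. ball x (d / 2)"
  have th: "(\<lambda>x. x + z) ` ?\<omega> \<subseteq> \<Omega>" if "norm z \<le> d / 3" for z
  proof
    fix p assume "p \<in> (\<lambda>x. x + z) ` ?\<omega>"
    then obtain x q where "x \<in> K" "dist x q < d / 2" "p = q + z" by auto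
    then have "dist x p < d"
      using dist_triangle[of x p q] that d(1) by (simp add: dist_norm)
    then show "p \<in> \<Omega>" using d(2)[OF \<open>x \<in> K\<close>, of p] by force
  qed
  show thesis
  proof (rule that[of ?\<omega> "d / 3"])
    show "?\<omega> \<subseteq> \<Omega>" using th[of 0] d(1) by simp
    show "K \<subseteq> ?\<omega>" using d(1) by auto
  qed (use th d(1) in auto)
qed

text \<open>
  Contractions do not increase difference quotients, hence do not increase weak derivatives; this
  replaces the chain rule for truncations.
\<close>

theorem weak_deriv_bound_contraction:
  fixes u :: "'a::euclidean_space \<Rightarrow> real"
  assumes "open \<Omega>" "bounded \<Omega>" "u \<in> L2_space \<Omega>" "weak_deriv_bound \<Omega> u y C" "0 \<le> C"
    and T: "\<And>a b. \<bar>T a - T b\<bar> \<le> \<bar>a - b\<bar>" and Tu: "(\<lambda>x. T (u x)) \<in> L2_space \<Omega>"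
  shows "weak_deriv_bound \<Omega> (\<lambda>x. T (u x)) y C"
  unfolding weak_deriv_bound_def
proof
  fix \<phi> assume \<phi>: "\<phi> \<in> test_functions \<Omega>"
  let ?v = "\<lambda>x. T (u x)"
  have \<Omega>: "\<Omega> \<in> sets lebesgue" using assms(1) by auto
  obtain K where K: "compact K" "K \<subseteq> \<Omega>" "\<And>x. x \<notin> K \<Longrightarrow> \<phi> x = 0"
    using test_function_support[OF \<phi>] by metis
  obtain \<omega> e where \<omega>: "open \<omega>" "K \<subseteq> \<omega>" "\<omega> \<subseteq> \<Omega>" "0 < e" "\<And>z. norm z \<le> e \<Longrightarrow> (\<lambda>x. x + z) ` \<omega> \<subseteq> \<Omega>"
    using compact_open_thickening[OF K(1,2) assms(1)] by blast
  have \<omega>s: "\<omega> \<in> sets lebesgue" using \<omega>(1) by auto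
  have b\<omega>: "bounded \<omega>" using assms(2) \<omega>(3) bounded_subset by blast
  have \<phi>\<omega>: "\<phi> \<in> test_functions \<omega>"
    using \<phi> K \<omega>(2) by (intro test_functionI[of \<phi> K]) (auto simp: test_functions_def)
  have n\<phi>: "L2_norm \<omega> \<phi> = L2_norm \<Omega> \<phi>"
    using L2_norm_translate_test_function[OF \<Omega> \<omega>s \<phi>\<omega>, of 0] \<omega>(3) by simp
  let ?a = "\<lambda>t. L2_inner \<Omega> ?v (\<lambda>x. \<phi> (x - t *\<^sub>R y))"
  \<comment> \<open>Keeps t y within the permitted shifts for t \<le> d, also when y = 0.\<close>
  define d where "d = e / (norm y + 1)"
  have d: "0 < d" "d * norm y \<le> e"
  proof -
    have n: "0 < norm y + 1" by (simp add: add_nonneg_pos)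
    then show "0 < d" using \<omega>(4) by (simp add: d_def)
    have "d * (norm y + 1) = e" using n by (simp add: d_def)
    then show "d * norm y \<le> e" using \<open>0 < d\<close> by (simp add: algebra_simps)
  qed
  have vm: "?v \<in> borel_measurable (lebesgue_on \<Omega>)" using Tu by (rule L2_spaceD)
  have bound: "\<bar>(?a t - ?a 0) / t\<bar> \<le> C * L2_norm \<Omega> \<phi>" if t: "0 < t" "t \<le> d" for t
  proof -
    have ts: "(\<lambda>x. x + s *\<^sub>R y) ` \<omega> \<subseteq> \<Omega>" if "0 \<le> s" "s \<le> t" for s
    proof (rule \<omega>(5))
      have "s * norm y \<le> d * norm y" using that t by (intro mult_right_mono) auto
      then show "norm (s *\<^sub>R y) \<le> e" using that d by simp
    qed
    have sub: "(\<lambda>x. x + s *\<^sub>R (t *\<^sub>R y)) ` \<omega> \<subseteq> \<Omega>" if "0 \<le> s" "s \<le> 1" for s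
      using ts[of "s * t"] that t by (simp add: mult_left_le_one_le)
    have a: "?a s = L2_inner \<omega> (\<lambda>x. ?v (x + s *\<^sub>R y)) \<phi>" if "0 \<le> s" "s \<le> t" for s
      by (rule L2_inner_translate[OF vm \<Omega> \<omega>s \<phi>\<omega> ts[OF that]])
    have L2: "(\<lambda>x. ?v (x + t *\<^sub>R y)) \<in> L2_space \<omega>" "?v \<in> L2_space \<omega>"
      using L2_translate[OF Tu \<Omega> \<omega>s ts[of t]] L2_subset[OF Tu \<Omega> \<omega>s \<omega>(3)] t by auto
    \<comment> \<open>Applied to the shortened direction t y, the estimate yields the factor t that
      cancels in the difference quotient.\<close>
    have tb: "(\<lambda>x. u (x + t *\<^sub>R y) - u x) \<in> L2_space \<omega>" "L2_norm \<omega> (\<lambda>x. u (x + t *\<^sub>R y) - u x) \<le> t * C"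
      using translation_bound[OF assms(1-3) weak_deriv_bound_scaleR[OF assms(4), of t] _ \<omega>(1) sub] t assms(5)
      by auto
    have "?a t - ?a 0 = L2_inner \<omega> (\<lambda>x. ?v (x + t *\<^sub>R y) - ?v x) \<phi>"
      using a[of t] a[of 0] t L2.diff_left[OF L2 test_function_L2(1)[OF b\<omega> \<omega>s \<phi>\<omega>]] by simp
    then have "\<bar>?a t - ?a 0\<bar> \<le> L2_norm \<omega> (\<lambda>x. ?v (x + t *\<^sub>R y) - ?v x) * L2_norm \<omega> \<phi>"
      using L2_Cauchy_Schwarz[OF L2.diff[OF L2] test_function_L2(1)[OF b\<omega> \<omega>s \<phi>\<omega>]] by simp
    also have "\<dots> \<le> t * C * L2_norm \<omega> \<phi>"
    proof (rule mult_right_mono[OF _ L2_norm_nonneg])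
      have "L2_norm \<omega> (\<lambda>x. ?v (x + t *\<^sub>R y) - ?v x) \<le> L2_norm \<omega> (\<lambda>x. u (x + t *\<^sub>R y) - u x)"
        by (rule L2_norm_mono(2)[OF L2_spaceD(1)[OF L2.diff[OF L2]] tb(1)]) (simp add: T)
      then show "L2_norm \<omega> (\<lambda>x. ?v (x + t *\<^sub>R y) - ?v x) \<le> t * C" using tb(2) by simp
    qed
    finally show ?thesis using t unfolding n\<phi> by (simp add: field_simps)
  qed
  have "((\<lambda>t. (?a t - ?a 0) / (t - 0)) \<longlongrightarrow> - L2_inner \<Omega> ?v (\<lambda>x. dderiv \<phi> y (x - 0 *\<^sub>R y))) (at 0)"
    using L2_inner_translate_DERIV[OF assms(2) \<Omega> Tu \<phi>, of y 0] unfolding has_field_derivative_iff .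
  \<comment> \<open>The quotients are bounded for t > 0, so the limit is taken from the
    right.\<close>
  then have "((\<lambda>t. (?a t - ?a 0) / t) \<longlongrightarrow> - L2_inner \<Omega> ?v (dderiv \<phi> y)) (at_right 0)"
    by (auto intro: tendsto_within_subset)
  then have "((\<lambda>t. \<bar>(?a t - ?a 0) / t\<bar>) \<longlongrightarrow> \<bar>- L2_inner \<Omega> ?v (dderiv \<phi> y)\<bar>) (at_right 0)"
    by (rule tendsto_rabs)
  moreover have "\<forall>\<^sub>F t in at_right 0. \<bar>(?a t - ?a 0) / t\<bar> \<le> C * L2_norm \<Omega> \<phi>"
    using bound d(1) by (auto simp: eventually_at_right intro!: exI[of _ d])
  ultimately have "\<bar>- L2_inner \<Omega> ?v (dderiv \<phi> y)\<bar> \<le> C * L2_norm \<Omega> \<phi>"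
    by (intro tendsto_upperbound) auto
  then show "\<bar>L2_inner \<Omega> ?v (dderiv \<phi> y)\<bar> \<le> C * L2_norm \<Omega> \<phi>" by simp
qed

subsection \<open>Weak gradients\<close>

lemma weak_gradientD:
  assumes "is_L2_weak_gradient \<Omega> u g"
  shows "g \<in> borel_measurable (lebesgue_on \<Omega>)"
    and "integrable (lebesgue_on \<Omega>) (\<lambda>x. (norm (g x))\<^sup>2)"
    and "\<phi> \<in> test_functions \<Omega> \<Longrightarrow> b \<in> Basis \<Longrightarrow>
      L2_inner \<Omega> u (dderiv \<phi> b) = - L2_inner \<Omega> (\<lambda>x. g x \<bullet> b) \<phi>"
  using assms by (simp_all add: is_L2_weak_gradient_def L2_inner_def)

lemma inner_L2:
  fixes g :: "'a::euclidean_space \<Rightarrow> 'a"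
  assumes "g \<in> borel_measurable (lebesgue_on \<Omega>)" "integrable (lebesgue_on \<Omega>) (\<lambda>x. (norm (g x))\<^sup>2)"
  shows "(\<lambda>x. g x \<bullet> y) \<in> L2_space \<Omega>"
    and "L2_norm \<Omega> (\<lambda>x. g x \<bullet> y) \<le> norm y * sqrt (LINT x|lebesgue_on \<Omega>. (norm (g x))\<^sup>2)"
proof -
  note [measurable] = assms(1)
  have m: "(\<lambda>x. g x \<bullet> y) \<in> borel_measurable (lebesgue_on \<Omega>)" by measurable
  have n: "(\<lambda>x. norm y * norm (g x)) \<in> L2_space \<Omega>"
    using assms(2) by (simp add: L2_space_def power_mult_distrib)
  have le: "AE x in lebesgue_on \<Omega>. \<bar>g x \<bullet> y\<bar> \<le> \<bar>norm y * norm (g x)\<bar>"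
    using Cauchy_Schwarz_ineq2[of "g _" y] by (intro always_eventually) (simp add: mult.commute)
  show "(\<lambda>x. g x \<bullet> y) \<in> L2_space \<Omega>" by (rule L2_norm_mono(1)[OF m n le])
  have "L2_norm \<Omega> (\<lambda>x. norm y * norm (g x)) = norm y * sqrt (LINT x|lebesgue_on \<Omega>. (norm (g x))\<^sup>2)"
  proof -
    have "norm y * norm (g x) * (norm y * norm (g x)) = (norm y)\<^sup>2 * (norm (g x))\<^sup>2" for x
      by (simp add: power2_eq_square)
    then show ?thesis unfolding L2_norm_def L2_inner_def by (simp add: real_sqrt_mult)
  qed
  then show "L2_norm \<Omega> (\<lambda>x. g x \<bullet> y) \<le> norm y * sqrt (LINT x|lebesgue_on \<Omega>. (norm (g x))\<^sup>2)"
    using L2_norm_mono(2)[OF m n le] by simp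
qed

lemma weak_gradient_L2:
  "is_L2_weak_gradient \<Omega> u g \<Longrightarrow> (\<lambda>x. g x \<bullet> y) \<in> L2_space \<Omega>"
  by (rule inner_L2(1)[OF weak_gradientD(1,2)])

text \<open>Linearity in the direction: the definition of a weak gradient tests only basis
  vectors.\<close>

lemma weak_gradient_direction:
  fixes u :: "'a::euclidean_space \<Rightarrow> real"
  assumes "bounded \<Omega>" "\<Omega> \<in> sets lebesgue" "u \<in> L2_space \<Omega>" "is_L2_weak_gradient \<Omega> u g" "\<phi> \<in> test_functions \<Omega>"
  shows "L2_inner \<Omega> u (dderiv \<phi> y) = - L2_inner \<Omega> (\<lambda>x. g x \<bullet> y) \<phi>"
proof -
  note t = test_function_L2[OF assms(1,2,5)]
  have i: "integrable (lebesgue_on \<Omega>) (\<lambda>x. (y \<bullet> b) * (u x * dderiv \<phi> b x))" for b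
    by (rule integrable_mult_right[OF L2_mult_integrable[OF assms(3) t(2)]])
  have j: "integrable (lebesgue_on \<Omega>) (\<lambda>x. (y \<bullet> b) * (g x \<bullet> b * \<phi> x))" for b
    using L2_mult_integrable[OF weak_gradient_L2[OF assms(4)] t(1)] by simp
  have "L2_inner \<Omega> u (dderiv \<phi> y) = (LINT x|lebesgue_on \<Omega>. (\<Sum>b\<in>Basis. (y \<bullet> b) * (u x * dderiv \<phi> b x)))"
    unfolding L2_inner_def
    by (intro Bochner_Integration.integral_cong refl)
      (subst dderiv_eq_sum[OF test_function_differentiable[OF assms(5)]],
        simp add: sum_distrib_left mult.left_commute)
  also have "\<dots> = (\<Sum>b\<in>Basis. (y \<bullet> b) * L2_inner \<Omega> u (dderiv \<phi> b))"
    unfolding L2_inner_def integral_mult_right_zero[symmetric]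
    by (rule Bochner_Integration.integral_sum[OF i])
  also have "\<dots> = (\<Sum>b\<in>Basis. - ((y \<bullet> b) * L2_inner \<Omega> (\<lambda>x. g x \<bullet> b) \<phi>))"
    by (intro sum.cong refl) (simp add: weak_gradientD(3)[OF assms(4,5)])
  also have "\<dots> = - (\<Sum>b\<in>Basis. (LINT x|lebesgue_on \<Omega>. (y \<bullet> b) * (g x \<bullet> b * \<phi> x)))"
    by (simp add: sum_negf L2_inner_def)
  also have "(\<Sum>b\<in>Basis. (LINT x|lebesgue_on \<Omega>. (y \<bullet> b) * (g x \<bullet> b * \<phi> x)))
     = (LINT x|lebesgue_on \<Omega>. (\<Sum>b\<in>Basis. (y \<bullet> b) * (g x \<bullet> b * \<phi> x)))"
    by (rule Bochner_Integration.integral_sum[OF j, symmetric])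
  also have "\<dots> = L2_inner \<Omega> (\<lambda>x. g x \<bullet> y) \<phi>"
    unfolding L2_inner_def
    by (intro Bochner_Integration.integral_cong refl)
      (subst euclidean_inner[of "g _" y], simp add: sum_distrib_left sum_distrib_right mult_ac)
  finally show ?thesis .
qed

lemma weak_gradient_imp_bound:
  fixes u :: "'a::euclidean_space \<Rightarrow> real"
  assumes "bounded \<Omega>" "\<Omega> \<in> sets lebesgue" "u \<in> L2_space \<Omega>" "is_L2_weak_gradient \<Omega> u g"
  shows "weak_deriv_bound \<Omega> u y (L2_norm \<Omega> (\<lambda>x. g x \<bullet> y))"
  unfolding weak_deriv_bound_def
  using weak_gradient_direction[OF assms]
    L2_Cauchy_Schwarz[OF weak_gradient_L2[OF assms(4)] test_function_L2(1)[OF assms(1,2)]] by simp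

text \<open>The converse of \<open>weak_gradient_imp_bound\<close>: Riesz representation of the
  functionals \<phi> \<mapsto> - \<integral> u \<partial>_b \<phi> gives the components. The
  estimate of the whole gradient has constant 1 in front of the sum of squares, so that truncation
  will not increase the energy.\<close>

lemma weak_gradient_exists:
  fixes u :: "'a::euclidean_space \<Rightarrow> real"
  assumes "open \<Omega>" "bounded \<Omega>" "u \<in> L2_space \<Omega>"
    and "\<And>b. b \<in> Basis \<Longrightarrow> weak_deriv_bound \<Omega> u b (C b)" "\<And>b. b \<in> Basis \<Longrightarrow> 0 \<le> C b"
  obtains g where "is_L2_weak_gradient \<Omega> u g" "(LINT x|lebesgue_on \<Omega>. (norm (g x))\<^sup>2) \<le> (\<Sum>b\<in>Basis. (C b)\<^sup>2)"
proof -
  have \<Omega>: "\<Omega> \<in> sets lebesgue" using assms(1) by auto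
  note t = test_function_L2[OF assms(2) \<Omega>]
  have "\<exists>h. h \<in> L2_space \<Omega> \<and> L2_norm \<Omega> h \<le> C b \<and>
      (\<forall>\<phi>\<in>test_functions \<Omega>. - L2_inner \<Omega> u (dderiv \<phi> b) = L2_inner \<Omega> h \<phi>)" if b: "b \<in> Basis" for b
  proof (rule L2_Riesz[of "test_functions \<Omega>" \<Omega> "\<lambda>\<phi>. - L2_inner \<Omega> u (dderiv \<phi> b)" "C b"])
    show "test_functions \<Omega> \<subseteq> L2_space \<Omega>" using t(1) by blast
    show "semi_inner (test_functions \<Omega>) (L2_inner \<Omega>)" by (rule test_functions_semi_inner[OF assms(2) \<Omega>])
    show "- L2_inner \<Omega> u (dderiv (\<lambda>x. f x + c * g x) b)
        = - L2_inner \<Omega> u (dderiv f b) + c * - L2_inner \<Omega> u (dderiv g b)"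
      if fg: "f \<in> test_functions \<Omega>" "g \<in> test_functions \<Omega>" for f g c
      unfolding dderiv_add_cmult[OF fg] using L2.lin_right[OF t(2)[OF fg(1)] t(2)[OF fg(2)] assms(3)] by simp
    show "\<bar>- L2_inner \<Omega> u (dderiv \<phi> b)\<bar> \<le> C b * L2_norm \<Omega> \<phi>" if "\<phi> \<in> test_functions \<Omega>" for \<phi>
      using weak_deriv_boundD[OF assms(4)[OF b] that] by simp
    show "0 \<le> C b" by (rule assms(5)[OF b])
  qed blast
  then obtain h where h: "\<And>b. b \<in> Basis \<Longrightarrow> h b \<in> L2_space \<Omega>" "\<And>b. b \<in> Basis \<Longrightarrow> L2_norm \<Omega> (h b) \<le> C b"
    "\<And>b \<phi>. b \<in> Basis \<Longrightarrow> \<phi> \<in> test_functions \<Omega> \<Longrightarrow> - L2_inner \<Omega> u (dderiv \<phi> b) = L2_inner \<Omega> (h b) \<phi>"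
    by metis
  define g where "g x = (\<Sum>b\<in>Basis. h b x *\<^sub>R b)" for x
  have gb: "g x \<bullet> b = h b x" if "b \<in> Basis" for b x using that by (simp add: g_def inner_sum_left_Basis)
  have sq: "(norm (g x))\<^sup>2 = (\<Sum>b\<in>Basis. (h b x)\<^sup>2)" for x
    unfolding power2_norm_eq_inner by (subst euclidean_inner) (simp add: gb power2_eq_square)
  have i: "integrable (lebesgue_on \<Omega>) (\<lambda>x. (h b x)\<^sup>2)" if "b \<in> Basis" for b
    by (rule L2_spaceD(2)[OF h(1)[OF that]])
  have "g \<in> borel_measurable (lebesgue_on \<Omega>)"
    unfolding g_def using L2_spaceD(1)[OF h(1)] by measurable
  then have "is_L2_weak_gradient \<Omega> u g"
    unfolding is_L2_weak_gradient_def sq using i h(3)[symmetric] by (auto simp: gb L2_inner_def)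
  moreover have "(LINT x|lebesgue_on \<Omega>. (norm (g x))\<^sup>2) = (\<Sum>b\<in>Basis. (L2_norm \<Omega> (h b))\<^sup>2)"
    unfolding sq L2_norm_sq using i by (rule Bochner_Integration.integral_sum)
  moreover have "\<dots> \<le> (\<Sum>b\<in>Basis. (C b)\<^sup>2)"
    using h(2) by (intro sum_mono power_mono L2_norm_nonneg) auto
  ultimately show thesis using that by simp
qed

text \<open>As \<open>weak_gradient\<close> is an arbitrary choice, uniqueness almost everywhere is
  what makes it linear and the form independent of the choice.\<close>

lemma weak_gradient_unique:
  fixes u :: "'a::euclidean_space \<Rightarrow> real"
  assumes "open \<Omega>" "bounded \<Omega>" "is_L2_weak_gradient \<Omega> u g" "is_L2_weak_gradient \<Omega> u h"
  shows "AE x in lebesgue_on \<Omega>. g x = h x"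
proof -
  have \<Omega>: "\<Omega> \<in> sets lebesgue" using assms(1) by auto
  have "AE x in lebesgue_on \<Omega>. g x \<bullet> b - h x \<bullet> b = 0" if b: "b \<in> Basis" for b
  proof (rule fundamental_lemma[OF assms(1,2)])
    note L2 = weak_gradient_L2[OF assms(3)] weak_gradient_L2[OF assms(4)]
    show "(\<lambda>x. g x \<bullet> b - h x \<bullet> b) \<in> L2_space \<Omega>" by (rule L2.diff[OF L2])
    fix \<phi> assume \<phi>: "\<phi> \<in> test_functions \<Omega>"
    show "L2_inner \<Omega> (\<lambda>x. g x \<bullet> b - h x \<bullet> b) \<phi> = 0"
      using L2.diff_left[OF L2 test_function_L2(1)[OF assms(2) \<Omega> \<phi>]]
        weak_gradientD(3)[OF assms(3) \<phi> b] weak_gradientD(3)[OF assms(4) \<phi> b] by simp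
  qed
  then have "AE x in lebesgue_on \<Omega>. \<forall>b\<in>Basis. g x \<bullet> b - h x \<bullet> b = 0"
    by (intro AE_finite_allI) auto
  then show ?thesis by eventually_elim (auto intro: euclidean_eqI)
qed

lemma is_L2_weak_gradient_add_cmult:
  fixes u :: "'a::euclidean_space \<Rightarrow> real"
  assumes "bounded \<Omega>" "\<Omega> \<in> sets lebesgue" "u \<in> L2_space \<Omega>" "v \<in> L2_space \<Omega>"
    and "is_L2_weak_gradient \<Omega> u g" "is_L2_weak_gradient \<Omega> v h"
  shows "is_L2_weak_gradient \<Omega> (\<lambda>x. u x + c * v x) (\<lambda>x. g x + c *\<^sub>R h x)"
  unfolding is_L2_weak_gradient_def
proof (intro conjI ballI)
  note g = weak_gradientD[OF assms(5)] and h = weak_gradientD[OF assms(6)]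
  note [measurable] = g(1) h(1)
  show "(\<lambda>x. g x + c *\<^sub>R h x) \<in> borel_measurable (lebesgue_on \<Omega>)" by measurable
  show "integrable (lebesgue_on \<Omega>) (\<lambda>x. (norm (g x + c *\<^sub>R h x))\<^sup>2)"
  proof (rule Bochner_Integration.integrable_bound)
    show "integrable (lebesgue_on \<Omega>) (\<lambda>x. (norm (g x) + \<bar>c\<bar> * norm (h x))\<^sup>2)"
      by (rule integrable_square_add_cmult) (use g h in auto)
    show "AE x in lebesgue_on \<Omega>. norm ((norm (g x + c *\<^sub>R h x))\<^sup>2) \<le> norm ((norm (g x) + \<bar>c\<bar> * norm (h x))\<^sup>2)"
      using norm_triangle_ineq[of "g _" "c *\<^sub>R h _"]
      by (intro always_eventually allI) (auto intro!: power_mono)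
  qed measurable
  fix \<phi> and b :: 'a assume \<phi>: "\<phi> \<in> test_functions \<Omega>" and b: "b \<in> Basis"
  have "L2_inner \<Omega> (\<lambda>x. u x + c * v x) (dderiv \<phi> b) = - L2_inner \<Omega> (\<lambda>x. g x \<bullet> b + c * (h x \<bullet> b)) \<phi>"
    unfolding L2.lin[OF assms(3,4) test_function_L2(2)[OF assms(1,2) \<phi>]]
      L2.lin[OF weak_gradient_L2[OF assms(5)] weak_gradient_L2[OF assms(6)] test_function_L2(1)[OF assms(1,2) \<phi>]]
      g(3)[OF \<phi> b] h(3)[OF \<phi> b] by simp
  then show "(LINT x|lebesgue_on \<Omega>. (u x + c * v x) * dderiv \<phi> b x)
      = - (LINT x|lebesgue_on \<Omega>. ((g x + c *\<^sub>R h x) \<bullet> b) * \<phi> x)"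
    by (simp add: L2_inner_def inner_add_left)
qed

lemma weak_gradient_works: "u \<in> H1 \<Omega> \<Longrightarrow> is_L2_weak_gradient \<Omega> u (weak_gradient \<Omega> u)"
  unfolding H1_def weak_gradient_def using someI_ex[of "is_L2_weak_gradient \<Omega> u"] by blast

lemma H1_L2: "u \<in> H1 \<Omega> \<Longrightarrow> u \<in> L2_space \<Omega>"
  by (simp add: H1_def)

lemma H1_add_cmult:
  assumes "bounded \<Omega>" "\<Omega> \<in> sets lebesgue" "u \<in> H1 \<Omega>" "v \<in> H1 \<Omega>"
  shows "(\<lambda>x. u x + c * v x) \<in> H1 \<Omega>"
  using is_L2_weak_gradient_add_cmult[OF assms(1,2) H1_L2[OF assms(3)] H1_L2[OF assms(4)]
      weak_gradient_works[OF assms(3)] weak_gradient_works[OF assms(4)], of c]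
    L2_add_cmult[OF H1_L2[OF assms(3)] H1_L2[OF assms(4)], of c]
  unfolding H1_def by blast

lemma weak_gradient_add_cmult:
  assumes "open \<Omega>" "bounded \<Omega>" "u \<in> H1 \<Omega>" "v \<in> H1 \<Omega>"
  shows "AE x in lebesgue_on \<Omega>. weak_gradient \<Omega> (\<lambda>x. u x + c * v x) x
    = weak_gradient \<Omega> u x + c *\<^sub>R weak_gradient \<Omega> v x"
proof -
  have \<Omega>: "\<Omega> \<in> sets lebesgue" using assms(1) by auto
  show ?thesis
    by (rule weak_gradient_unique[OF assms(1,2) weak_gradient_works[OF H1_add_cmult[OF assms(2) \<Omega> assms(3,4)]]
        is_L2_weak_gradient_add_cmult[OF assms(2) \<Omega> H1_L2[OF assms(3)] H1_L2[OF assms(4)]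
      weak_gradient_works[OF assms(3)] weak_gradient_works[OF assms(4)]]])
qed

lemma test_function_mult:
  assumes "\<phi> \<in> test_functions \<Omega>" "\<psi> \<in> test_functions \<Omega>"
  shows "(\<lambda>x. \<phi> x * \<psi> x) \<in> test_functions \<Omega>"
    and "dderiv (\<lambda>x. \<phi> x * \<psi> x) y x = \<phi> x * dderiv \<psi> y x + dderiv \<phi> y x * \<psi> x"
proof -
  obtain K where K: "compact K" "K \<subseteq> \<Omega>" "\<And>x. x \<notin> K \<Longrightarrow> \<phi> x = 0"
    using test_function_support[OF assms(1)] by metis
  show "(\<lambda>x. \<phi> x * \<psi> x) \<in> test_functions \<Omega>"
  proof (rule test_functionI[OF _ K(1,2)])
    show "Ck k (\<lambda>x. \<phi> x * \<psi> x)" for k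
      using assms by (intro Ck_mult) (simp_all add: test_functions_def)
  qed (simp add: K(3))
  have "((\<lambda>x. \<phi> x * \<psi> x) has_derivative
      (\<lambda>y. \<phi> x * dderiv \<psi> y x + dderiv \<phi> y x * \<psi> x)) (at x)"
    using assms by (intro has_derivative_mult test_function_has_derivative)
  from frechet_derivative_at[OF this]
  show "dderiv (\<lambda>x. \<phi> x * \<psi> x) y x = \<phi> x * dderiv \<psi> y x + dderiv \<phi> y x * \<psi> x" by metis
qed

text \<open>Small translations move the support of \<phi> inside \<Omega>, so the integral of
  \<phi>(x - t y) over \<Omega> is constant for t near 0; its derivative at 0 is minus the integral
  in question.\<close>

lemma integral_dderiv_test_function:
  fixes \<phi> :: "'a::euclidean_space \<Rightarrow> real"
  assumes "open \<Omega>" "bounded \<Omega>" "\<phi> \<in> test_functions \<Omega>"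
  shows "L2_inner \<Omega> (\<lambda>_. 1) (dderiv \<phi> y) = 0"
proof -
  have \<Omega>: "\<Omega> \<in> sets lebesgue" using assms(1) by auto
  have one: "(\<lambda>_. 1) \<in> L2_space \<Omega>" by (rule L2_space_bounded[OF assms(2) \<Omega>, of _ 1]) auto
  obtain K where K: "compact K" "K \<subseteq> \<Omega>" "\<And>x. x \<notin> K \<Longrightarrow> \<phi> x = 0"
    using test_function_support[OF assms(3)] by metis
  obtain \<omega> e where \<omega>: "open \<omega>" "K \<subseteq> \<omega>" "\<omega> \<subseteq> \<Omega>" "0 < e" "\<And>z. norm z \<le> e \<Longrightarrow> (\<lambda>x. x + z) ` \<omega> \<subseteq> \<Omega>"
    using compact_open_thickening[OF K(1,2) assms(1)] by blast
  have \<omega>s: "\<omega> \<in> sets lebesgue" using \<omega>(1) by auto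
  have \<phi>\<omega>: "\<phi> \<in> test_functions \<omega>"
    using assms(3) K \<omega>(2) by (intro test_functionI[of \<phi> K]) (auto simp: test_functions_def)
  let ?a = "\<lambda>t. L2_inner \<Omega> (\<lambda>_. 1) (\<lambda>x. \<phi> (x - t *\<^sub>R y))"
  have n: "0 < norm y + 1" by (simp add: add_nonneg_pos)
  have "?a t = L2_inner \<omega> (\<lambda>_. 1) \<phi>" if "\<bar>t\<bar> < e / (norm y + 1)" for t
  proof (rule L2_inner_translate[OF L2_spaceD(1)[OF one] \<Omega> \<omega>s \<phi>\<omega> \<omega>(5)])
    have "\<bar>t\<bar> * (norm y + 1) \<le> e" using that n by (simp add: field_simps)
    then show "norm (t *\<^sub>R y) \<le> e" by (simp add: algebra_simps)
  qed
  then have "\<forall>\<^sub>F t in nhds 0. ?a t = L2_inner \<omega> (\<lambda>_. 1) \<phi>"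
    using \<omega>(4) n by (auto simp: eventually_nhds_metric dist_real_def intro!: exI[of _ "e / (norm y + 1)"])
  then have "(?a has_real_derivative 0) (at 0) \<longleftrightarrow>
      ((\<lambda>_. L2_inner \<omega> (\<lambda>_. 1) \<phi>) has_real_derivative 0) (at 0)"
    by (intro DERIV_cong_ev) auto
  then have "(?a has_real_derivative 0) (at 0)" by simp
  moreover have "(?a has_real_derivative - L2_inner \<Omega> (\<lambda>_. 1) (\<lambda>x. dderiv \<phi> y (x - 0 *\<^sub>R y))) (at 0)"
    by (rule L2_inner_translate_DERIV[OF assms(2) \<Omega> one assms(3)])
  ultimately show ?thesis using DERIV_unique by fastforce
qed

text \<open>The derivative of \<phi> \<psi> integrates to 0, and by the product rule this is
  integration by parts against every test function \<psi>.\<close>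

lemma test_function_H1:
  fixes \<phi> :: "'a::euclidean_space \<Rightarrow> real"
  assumes "open \<Omega>" "bounded \<Omega>" "\<phi> \<in> test_functions \<Omega>"
  shows "\<phi> \<in> H1 \<Omega>"
proof -
  have \<Omega>: "\<Omega> \<in> sets lebesgue" using assms(1) by auto
  note t = test_function_L2[OF assms(2) \<Omega>]
  have "weak_deriv_bound \<Omega> \<phi> b (L2_norm \<Omega> (dderiv \<phi> b))" for b
    unfolding weak_deriv_bound_def
  proof
    fix \<psi> assume \<psi>: "\<psi> \<in> test_functions \<Omega>"
    have "0 = L2_inner \<Omega> (\<lambda>_. 1) (dderiv (\<lambda>x. \<phi> x * \<psi> x) b)"
      by (rule integral_dderiv_test_function[OF assms(1,2) test_function_mult(1)[OF assms(3) \<psi>], symmetric])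
    also have "\<dots> = L2_inner \<Omega> \<phi> (dderiv \<psi> b) + L2_inner \<Omega> (dderiv \<phi> b) \<psi>"
      using L2_mult_integrable[OF t(1)[OF assms(3)] t(2)[OF \<psi>]] L2_mult_integrable[OF t(2)[OF assms(3)] t(1)[OF \<psi>]]
      by (simp add: L2_inner_def test_function_mult(2)[OF assms(3) \<psi>])
    finally show "\<bar>L2_inner \<Omega> \<phi> (dderiv \<psi> b)\<bar> \<le> L2_norm \<Omega> (dderiv \<phi> b) * L2_norm \<Omega> \<psi>"
      using L2_Cauchy_Schwarz[OF t(2)[OF assms(3)] t(1)[OF \<psi>], of b] by linarith
  qed
  then obtain g where "is_L2_weak_gradient \<Omega> \<phi> g"
    using weak_gradient_exists[OF assms(1,2) t(1)[OF assms(3)], of "\<lambda>b. L2_norm \<Omega> (dderiv \<phi> b)"]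
      L2_norm_nonneg by blast
  then show ?thesis using t(1)[OF assms(3)] by (auto simp: H1_def)
qed

subsection \<open>The boundary form\<close>

lemma semi_inner_subspace:
  assumes "semi_inner V B" "P \<subseteq> V" "(\<lambda>_. 0) \<in> P"
    and "\<And>u v c. u \<in> P \<Longrightarrow> v \<in> P \<Longrightarrow> (\<lambda>x. u x + c * v x) \<in> P"
  shows "semi_inner P B"
proof -
  interpret V: semi_inner V B by fact
  show ?thesis
    using assms(2-4) by unfold_locales (auto intro: V.lin V.sym V.nonneg dest!: subsetD[OF assms(2)])
qed

lemma semi_inner_sum:
  assumes "semi_inner P A" "semi_inner P B" "0 \<le> \<mu>"
  shows "semi_inner P (\<lambda>u v. A u v + \<mu> * B u v)"
proof -
  interpret A: semi_inner P A by fact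
  interpret B: semi_inner P B by fact
  show ?thesis
    by unfold_locales
      (simp_all add: A.zero A.add_cmult A.lin B.lin A.sym[of _ _] B.sym[of _ _] A.nonneg B.nonneg assms(3) algebra_simps)
qed

lemma weak_gradient_inner_integrable:
  assumes "u \<in> H1 \<Omega>" "v \<in> H1 \<Omega>"
  shows "integrable (lebesgue_on \<Omega>) (\<lambda>x. weak_gradient \<Omega> u x \<bullet> weak_gradient \<Omega> v x)"
proof (rule Bochner_Integration.integrable_bound)
  note g = weak_gradientD[OF weak_gradient_works[OF assms(1)]] weak_gradientD[OF weak_gradient_works[OF assms(2)]]
  note [measurable] = g(1) g(4)
  show "integrable (lebesgue_on \<Omega>) (\<lambda>x. norm (weak_gradient \<Omega> u x) * norm (weak_gradient \<Omega> v x))"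
    by (rule integrable_mult_of_squares) (use g in auto)
  show "AE x in lebesgue_on \<Omega>. norm (weak_gradient \<Omega> u x \<bullet> weak_gradient \<Omega> v x)
      \<le> norm (norm (weak_gradient \<Omega> u x) * norm (weak_gradient \<Omega> v x))"
    by (intro always_eventually allI) (simp add: Cauchy_Schwarz_ineq2)
qed (use weak_gradientD(1)[OF weak_gradient_works[OF assms(1)]]
    weak_gradientD(1)[OF weak_gradient_works[OF assms(2)]] in measurable)

text \<open>Turns the \<theta>-term into an L^2 product of functions that depend linearly on u, so
  that it is treated like the \<kappa>-term.\<close>

definition jump :: "('a \<Rightarrow> real) \<Rightarrow> 'a \<times> 'a \<Rightarrow> real" where
  "jump u = (\<lambda>(x, y). u x - u y)"

lemma jump_add_cmult: "jump (\<lambda>x. u x + c * v x) p = jump u p + c * jump v p"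
  by (simp add: jump_def case_prod_beta algebra_simps)

locale boundary_pair =
  fixes \<Omega> :: "'a::euclidean_space set" and \<kappa> :: "'a measure" and \<theta> :: "('a \<times> 'a) measure"
  assumes open_\<Omega>: "open \<Omega>" and bounded_\<Omega>: "bounded \<Omega>"
    and sets_\<kappa>: "sets \<kappa> = sets (restrict_space borel (frontier \<Omega>))"
    and sets_\<theta>: "sets \<theta> = sets (restrict_space borel (off_diagonal \<Omega>))"
begin

abbreviation "P \<equiv> form_domain \<Omega> \<kappa> \<theta>"
abbreviation "E \<equiv> bdry_form \<Omega> \<kappa> \<theta>"

lemma sets_\<Omega>: "\<Omega> \<in> sets lebesgue"
  using open_\<Omega> by auto

lemma measurable_\<kappa>:
  assumes "continuous_on (closure \<Omega>) u" shows "u \<in> borel_measurable \<kappa>"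
proof -
  have "continuous_on (frontier \<Omega>) u"
    using assms by (rule continuous_on_subset) (simp add: frontier_def)
  then show ?thesis
    using borel_measurable_continuous_on_restrict measurable_cong_sets[OF sets_\<kappa> refl] by blast
qed

lemma measurable_jump:
  assumes "continuous_on (closure \<Omega>) u" shows "jump u \<in> borel_measurable \<theta>"
proof -
  have "continuous_on (frontier \<Omega>) u"
    using assms by (rule continuous_on_subset) (simp add: frontier_def)
  then have "continuous_on (off_diagonal \<Omega>) (\<lambda>p. u (fst p))" "continuous_on (off_diagonal \<Omega>) (\<lambda>p. u (snd p))"
    by (auto elim!: continuous_on_compose2 intro!: continuous_intros simp: off_diagonal_def)
  then have "continuous_on (off_diagonal \<Omega>) (jump u)"
    unfolding jump_def case_prod_beta by (rule continuous_on_diff)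
  then show ?thesis
    using borel_measurable_continuous_on_restrict measurable_cong_sets[OF sets_\<theta> refl] by blast
qed

lemma Cc_closure_iff: "u \<in> Cc_closure \<Omega> \<longleftrightarrow> continuous_on (closure \<Omega>) u"
proof -
  have "support_on (closure \<Omega>) u \<subseteq> closure \<Omega>" by (auto simp: support_on_def)
  then have "bounded (support_on (closure \<Omega>) u)"
    using bounded_closure[OF bounded_\<Omega>] bounded_subset by blast
  then show ?thesis by (simp add: Cc_closure_def)
qed

text \<open>Replaces finiteness of nonnegative integrals by integrability, the form in which
  linearity of the Bochner integrals in \<open>bdry_form\<close> applies.\<close>

lemma form_domain_iff:
  "u \<in> P \<longleftrightarrow> u \<in> H1 \<Omega> \<and> continuous_on (closure \<Omega>) u \<and>
     integrable \<kappa> (\<lambda>x. (u x)\<^sup>2) \<and> integrable \<theta> (\<lambda>p. (jump u p)\<^sup>2)"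
proof (cases "continuous_on (closure \<Omega>) u")
  case True
  note [measurable] = measurable_\<kappa>[OF True] measurable_jump[OF True]
  have "integrable \<kappa> (\<lambda>x. (u x)\<^sup>2) \<longleftrightarrow> (\<integral>\<^sup>+x. ennreal ((u x)\<^sup>2) \<partial>\<kappa>) < \<infinity>"
    by (simp add: integrable_iff_bounded)
  moreover have "integrable \<theta> (\<lambda>p. (jump u p)\<^sup>2) \<longleftrightarrow> (\<integral>\<^sup>+(x, y). ennreal ((u x - u y)\<^sup>2) \<partial>\<theta>) < \<infinity>"
    by (simp add: integrable_iff_bounded) (simp add: jump_def split_def)
  ultimately show ?thesis
    using True by (auto simp: form_domain_def Cc_closure_iff ennreal_add_less_top)
qed (simp add: form_domain_def Cc_closure_iff)

lemma form_domainD: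
  assumes "u \<in> P"
  shows "u \<in> H1 \<Omega>" "continuous_on (closure \<Omega>) u" "u \<in> L2_space \<Omega>"
    "u \<in> borel_measurable \<kappa>" "jump u \<in> borel_measurable \<theta>"
    "integrable \<kappa> (\<lambda>x. (u x)\<^sup>2)" "integrable \<theta> (\<lambda>p. (jump u p)\<^sup>2)"
  using assms form_domain_iff[of u] measurable_\<kappa>[of u] measurable_jump[of u] by (auto simp: H1_L2)

lemma form_eq:
  "E u v = (LINT x|lebesgue_on \<Omega>. weak_gradient \<Omega> u x \<bullet> weak_gradient \<Omega> v x)
     + (LINT x|\<kappa>. u x * v x) + (LINT p|\<theta>. jump u p * jump v p)"
  by (simp add: bdry_form_def jump_def split_def)

lemma form_domain_add_cmult:
  assumes "u \<in> P" "v \<in> P" shows "(\<lambda>x. u x + c * v x) \<in> P"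
proof -
  note u = form_domainD[OF assms(1)] and v = form_domainD[OF assms(2)]
  have "integrable \<kappa> (\<lambda>x. (u x + c * v x)\<^sup>2)"
    by (rule integrable_square_add_cmult[OF u(4) v(4) u(6) v(6)])
  moreover have "integrable \<theta> (\<lambda>p. (jump (\<lambda>x. u x + c * v x) p)\<^sup>2)"
    unfolding jump_add_cmult by (rule integrable_square_add_cmult[OF u(5) v(5) u(7) v(7)])
  moreover have "(\<lambda>x. u x + c * v x) \<in> H1 \<Omega>"
    by (rule H1_add_cmult[OF bounded_\<Omega> sets_\<Omega> u(1) v(1)])
  moreover have "continuous_on (closure \<Omega>) (\<lambda>x. u x + c * v x)"
    using u(2) v(2) by (intro continuous_intros)
  ultimately show ?thesis unfolding form_domain_iff by blast
qed

lemma zero_H1: "(\<lambda>_. 0) \<in> H1 \<Omega>"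
  by (rule test_function_H1[OF open_\<Omega> bounded_\<Omega> zero_test_function])

sublocale F: semi_inner P E
proof
  show "(\<lambda>_. 0) \<in> P" using zero_H1 by (simp add: form_domain_iff jump_def case_prod_beta)
  show "E u v = E v u" for u v by (simp add: form_eq inner_commute mult.commute)
  show "0 \<le> E u u" for u
    unfolding form_eq by (intro add_nonneg_nonneg Bochner_Integration.integral_nonneg) auto
  show "E (\<lambda>x. u x + c * v x) w = E u w + c * E v w" if "u \<in> P" "v \<in> P" "w \<in> P" for u v w c
  proof -
    note u = form_domainD[OF that(1)] and v = form_domainD[OF that(2)] and w = form_domainD[OF that(3)]
    let ?M = "lebesgue_on \<Omega>" and ?g = "weak_gradient \<Omega>"
    note gu = weak_gradient_inner_integrable[OF u(1) w(1)] and gv = weak_gradient_inner_integrable[OF v(1) w(1)]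
    have uv: "(\<lambda>x. u x + c * v x) \<in> H1 \<Omega>" by (rule H1_add_cmult[OF bounded_\<Omega> sets_\<Omega> u(1) v(1)])
    have "(LINT x|?M. ?g (\<lambda>x. u x + c * v x) x \<bullet> ?g w x) = (LINT x|?M. ?g u x \<bullet> ?g w x + c * (?g v x \<bullet> ?g w x))"
    proof (rule integral_cong_AE)
      \<comment> \<open>The chosen gradient of a sum agrees with the sum of the chosen gradients
        only almost everywhere.\<close>
      show "AE x in ?M. ?g (\<lambda>x. u x + c * v x) x \<bullet> ?g w x = ?g u x \<bullet> ?g w x + c * (?g v x \<bullet> ?g w x)"
        using weak_gradient_add_cmult[OF open_\<Omega> bounded_\<Omega> u(1) v(1), of c]
        by eventually_elim (simp add: inner_add_left)
    qed (use weak_gradient_inner_integrable[OF uv w(1)] gu gv in auto)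
    also have "\<dots> = (LINT x|?M. ?g u x \<bullet> ?g w x) + c * (LINT x|?M. ?g v x \<bullet> ?g w x)"
      using gu gv by simp
    finally have 1: "(LINT x|?M. ?g (\<lambda>x. u x + c * v x) x \<bullet> ?g w x)
        = (LINT x|?M. ?g u x \<bullet> ?g w x) + c * (LINT x|?M. ?g v x \<bullet> ?g w x)" .
    have 2: "(LINT x|\<kappa>. (u x + c * v x) * w x) = (LINT x|\<kappa>. u x * w x) + c * (LINT x|\<kappa>. v x * w x)"
      using integrable_mult_of_squares[OF u(4) w(4) u(6) w(6)] integrable_mult_of_squares[OF v(4) w(4) v(6) w(6)]
      by (simp add: distrib_right mult.assoc)
    have 3: "(LINT p|\<theta>. jump (\<lambda>x. u x + c * v x) p * jump w p)
        = (LINT p|\<theta>. jump u p * jump w p) + c * (LINT p|\<theta>. jump v p * jump w p)"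
      using integrable_mult_of_squares[OF u(5) w(5) u(7) w(7)] integrable_mult_of_squares[OF v(5) w(5) v(7) w(7)]
      by (simp add: jump_add_cmult distrib_right mult.assoc)
    show ?thesis unfolding form_eq 1 2 3 by (simp add: algebra_simps)
  qed
qed (rule form_domain_add_cmult)

lemma gradient_le_form:
  assumes "u \<in> P"
  shows "(LINT x|lebesgue_on \<Omega>. (norm (weak_gradient \<Omega> u x))\<^sup>2) \<le> E u u"
  unfolding form_eq by (simp add: power2_norm_eq_inner)

lemma form_domain_weak_deriv_bound:
  assumes "u \<in> P"
  shows "weak_deriv_bound \<Omega> u y (norm y * sqrt (E u u))"
proof -
  note u = form_domainD[OF assms]
  note g = weak_gradient_works[OF u(1)]
  have "L2_norm \<Omega> (\<lambda>x. weak_gradient \<Omega> u x \<bullet> y) \<le> norm y * sqrt (E u u)"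
    using inner_L2(2)[OF weak_gradientD(1,2)[OF g], of y]
      mult_left_mono[OF real_sqrt_le_mono[OF gradient_le_form[OF assms]], of "norm y"] by simp
  then show ?thesis
    using weak_gradient_imp_bound[OF bounded_\<Omega> sets_\<Omega> u(3) g, of y] L2_norm_nonneg[of \<Omega>]
    unfolding weak_deriv_bound_def by (meson mult_right_mono order_trans)
qed

text \<open>The Markov property for every contraction fixing 0. The boundary terms decrease
  pointwise; for the gradient term the directional bounds along the basis pass to T \<circ> u, and
  Riesz representation reassembles them into a gradient.\<close>

lemma form_domain_contraction:
  assumes u: "u \<in> P" and T: "\<And>a b. \<bar>T a - T b\<bar> \<le> \<bar>a - b\<bar>" and T0: "T 0 = 0"
  shows "(\<lambda>x. T (u x)) \<in> P" "E (\<lambda>x. T (u x)) (\<lambda>x. T (u x)) \<le> E u u"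
proof -
  let ?v = "\<lambda>x. T (u x)" and ?M = "lebesgue_on \<Omega>"
  note ud = form_domainD[OF u]
  note g = weak_gradient_works[OF ud(1)]
  have "continuous_on UNIV T"
    unfolding continuous_on_iff using T by (auto simp: dist_real_def intro: le_less_trans)
  then have Tm: "T \<in> borel_measurable borel" and Tc: "continuous_on (closure \<Omega>) ?v"
    using ud(2) by (auto intro: borel_measurable_continuous_onI continuous_on_compose2[of UNIV T])
  have le: "\<bar>T a\<bar> \<le> \<bar>a\<bar>" for a using T[of a 0] T0 by simp
  then have le2: "(T a)\<^sup>2 \<le> a\<^sup>2" for a by (simp add: abs_le_square_iff)
  have jle: "(jump ?v p)\<^sup>2 \<le> (jump u p)\<^sup>2" for p
    unfolding jump_def case_prod_beta using T by (simp flip: abs_le_square_iff)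
  have vL2: "?v \<in> L2_space \<Omega>"
    by (rule L2_norm_mono(1)[OF measurable_compose[OF L2_spaceD(1)[OF ud(3)] Tm] ud(3)]) (simp add: le)
  let ?C = "\<lambda>b. L2_norm \<Omega> (\<lambda>x. weak_gradient \<Omega> u x \<bullet> b)"
  have "weak_deriv_bound \<Omega> ?v b (?C b)" for b
    by (rule weak_deriv_bound_contraction[OF open_\<Omega> bounded_\<Omega> ud(3)
      weak_gradient_imp_bound[OF bounded_\<Omega> sets_\<Omega> ud(3) g] L2_norm_nonneg T vL2])
  then obtain h where h: "is_L2_weak_gradient \<Omega> ?v h"
    "(LINT x|?M. (norm (h x))\<^sup>2) \<le> (\<Sum>b\<in>Basis. (?C b)\<^sup>2)"
    using weak_gradient_exists[OF open_\<Omega> bounded_\<Omega> vL2, of ?C] L2_norm_nonneg by blast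
  then have vH: "?v \<in> H1 \<Omega>" using vL2 by (auto simp: H1_def)
  have \<kappa>i: "integrable \<kappa> (\<lambda>x. (?v x)\<^sup>2)"
    by (rule Bochner_Integration.integrable_bound[OF ud(6)])
      (use measurable_\<kappa>[OF Tc] le2 in auto)
  have \<theta>i: "integrable \<theta> (\<lambda>p. (jump ?v p)\<^sup>2)"
    by (rule Bochner_Integration.integrable_bound[OF ud(7)])
      (use measurable_jump[OF Tc] jle in auto)
  show "?v \<in> P" unfolding form_domain_iff using vH Tc \<kappa>i \<theta>i by blast
  \<comment> \<open>The directional bounds are sharp: their squares add up to the gradient energy of
    u, so nothing is lost.\<close>
  have "(\<Sum>b\<in>Basis. (?C b)\<^sup>2) = (LINT x|?M. (\<Sum>b\<in>Basis. (weak_gradient \<Omega> u x \<bullet> b)\<^sup>2))"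
    unfolding L2_norm_sq
    by (rule Bochner_Integration.integral_sum[symmetric]) (rule L2_spaceD(2)[OF weak_gradient_L2[OF g]])
  also have "\<dots> = (LINT x|?M. weak_gradient \<Omega> u x \<bullet> weak_gradient \<Omega> u x)"
    by (intro Bochner_Integration.integral_cong refl)
      (simp add: power2_eq_square euclidean_inner[symmetric])
  finally have "(LINT x|?M. (norm (h x))\<^sup>2) \<le> (LINT x|?M. weak_gradient \<Omega> u x \<bullet> weak_gradient \<Omega> u x)"
    using h(2) by simp
  moreover have "(LINT x|?M. weak_gradient \<Omega> ?v x \<bullet> weak_gradient \<Omega> ?v x) = (LINT x|?M. (norm (h x))\<^sup>2)"
  proof (rule integral_cong_AE)
    show "AE x in ?M. weak_gradient \<Omega> ?v x \<bullet> weak_gradient \<Omega> ?v x = (norm (h x))\<^sup>2"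
      using weak_gradient_unique[OF open_\<Omega> bounded_\<Omega> weak_gradient_works[OF vH] h(1)]
      by eventually_elim (simp add: power2_norm_eq_inner)
  qed (use weak_gradient_inner_integrable[OF vH vH] weak_gradientD(2)[OF h(1)] in auto)
  moreover have "(LINT x|\<kappa>. ?v x * ?v x) \<le> (LINT x|\<kappa>. u x * u x)"
    unfolding power2_eq_square[symmetric] by (rule integral_mono[OF \<kappa>i ud(6)]) (rule le2)
  moreover have "(LINT p|\<theta>. jump ?v p * jump ?v p) \<le> (LINT p|\<theta>. jump u p * jump u p)"
    unfolding power2_eq_square[symmetric] by (rule integral_mono[OF \<theta>i ud(7)]) (rule jle)
  ultimately show "E ?v ?v \<le> E u u" unfolding form_eq by simp
qed

text \<open>Test functions vanish on the frontier, so both boundary integrals are 0. They thus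
  belong to the form domain whatever the measures are, which gives the forms of a sequence common
  elements.\<close>

lemma test_function_form_domain:
  assumes "\<phi> \<in> test_functions \<Omega>" shows "\<phi> \<in> P"
proof -
  have z: "\<phi> x = 0" if "x \<in> frontier \<Omega>" for x
    using test_function_support[OF assms] that open_\<Omega> by (metis Diff_iff frontier_def interior_open subsetD)
  have "space \<kappa> = frontier \<Omega>" "space \<theta> = off_diagonal \<Omega>"
    using sets_eq_imp_space_eq[OF sets_\<kappa>] sets_eq_imp_space_eq[OF sets_\<theta>] by (auto simp: space_restrict_space)
  then have "\<And>x. x \<in> space \<kappa> \<Longrightarrow> (\<phi> x)\<^sup>2 = 0" "\<And>p. p \<in> space \<theta> \<Longrightarrow> (jump \<phi> p)\<^sup>2 = 0"
    using z by (auto simp: jump_def off_diagonal_def)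
  then have "integrable \<kappa> (\<lambda>x. (\<phi> x)\<^sup>2)" "integrable \<theta> (\<lambda>p. (jump \<phi> p)\<^sup>2)"
    by (simp_all cong: Bochner_Integration.integrable_cong)
  then show ?thesis
    unfolding form_domain_iff
    using test_function_H1[OF open_\<Omega> bounded_\<Omega> assms] test_function_continuous[OF assms]
    by (auto intro: continuous_on_subset)
qed

end

subsection \<open>Compactness\<close>

lemma bounded_inner_sequences_subsequence:
  fixes a :: "nat \<Rightarrow> nat \<Rightarrow> real"
  assumes "\<And>k n. \<bar>a k n\<bar> \<le> M k"
  obtains r where "strict_mono r" "\<And>k. convergent (\<lambda>n. a k (r n))"
proof -
  interpret subseqs "\<lambda>k r. convergent (\<lambda>n. a k (r n))"
  proof
    fix k and s :: "nat \<Rightarrow> nat"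
    have "bounded (range (\<lambda>n. a k (s n)))"
      using assms by (intro boundedI[of _ "M k"]) auto
    then obtain l r where "strict_mono r" "((\<lambda>n. a k (s n)) \<circ> r) \<longlonglongrightarrow> l"
      using bounded_imp_convergent_subsequence by blast
    then show "\<exists>r'. strict_mono r' \<and> convergent (\<lambda>n. a k ((s \<circ> r') n))"
      by (auto simp: o_def convergent_def)
  qed
  show thesis
  proof (rule that[OF subseq_diagseq])
    fix k
    have "convergent (\<lambda>n. a k ((diagseq \<circ> (+) (Suc k)) n))"
    proof (rule diagseq_holds)
      fix k s and r :: "nat \<Rightarrow> nat" assume "strict_mono r" "convergent (\<lambda>n. a k (s n))"
      then show "convergent (\<lambda>n. a k ((s \<circ> r) n))"
        using convergent_subseq_convergent[of "\<lambda>n. a k (s n)" r] by (simp add: o_def)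
    qed
    \<comment> \<open>From index k + 1 on, the diagonal sequence is a subsequence of the one
      selected at stage k.\<close>
    then have "convergent (\<lambda>n. a k (diagseq (n + Suc k)))" by (simp add: o_def add.commute)
    then show "convergent (\<lambda>n. a k (diagseq n))"
      using convergent_ignore_initial_segment[of "\<lambda>n. a k (diagseq n)" "Suc k"] by simp
  qed
qed

text \<open>
  Once the pairings with the members of the sequence converge, the set of \<open>w\<close> whose pairings converge
  is a closed subspace containing the sequence; projecting onto it shows that it is everything.
\<close>

theorem L2_weak_compactness:
  fixes us :: "nat \<Rightarrow> 'a::euclidean_space \<Rightarrow> real"
  assumes us: "\<And>n. us n \<in> L2_space \<Omega>" and K: "\<And>n. L2_norm \<Omega> (us n) \<le> K"
  obtains r where "strict_mono r" "\<And>v. v \<in> L2_space \<Omega> \<Longrightarrow> convergent (\<lambda>n. L2_inner \<Omega> (us (r n)) v)"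
proof -
  have "\<bar>L2_inner \<Omega> (us n) (us k)\<bar> \<le> K * L2_norm \<Omega> (us k)" for n k
    using L2_Cauchy_Schwarz[OF us us, of n k] mult_right_mono[OF K L2_norm_nonneg, of n \<Omega> "us k"] by linarith
  from bounded_inner_sequences_subsequence[of "\<lambda>k n. L2_inner \<Omega> (us n) (us k)", OF this]
  obtain r where r: "strict_mono r" "\<And>k. convergent (\<lambda>n. L2_inner \<Omega> (us (r n)) (us k))" by blast
  let ?w = "\<lambda>n. us (r n)"
  define V where "V = {v \<in> L2_space \<Omega>. convergent (\<lambda>n. L2_inner \<Omega> (?w n) v)}"
  have VL: "V \<subseteq> L2_space \<Omega>" by (auto simp: V_def)
  have si: "semi_inner V (L2_inner \<Omega>)"
  proof (rule semi_inner_subspace[OF L2.semi_inner_axioms VL])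
    show "(\<lambda>_. 0) \<in> V" by (simp add: V_def L2.zero L2_inner_def convergent_const)
    show "(\<lambda>x. u x + c * v x) \<in> V" if "u \<in> V" "v \<in> V" for u v c
    proof -
      have "L2_inner \<Omega> (?w n) (\<lambda>x. u x + c * v x) = L2_inner \<Omega> (?w n) u + c * L2_inner \<Omega> (?w n) v" for n
        using that us by (intro L2.lin_right) (auto simp: V_def)
      then show ?thesis
        using that by (auto simp: V_def L2_add_cmult intro!: convergent_add convergent_mult convergent_const)
    qed
  qed
  have "convergent (\<lambda>n. L2_inner \<Omega> (?w n) v)" if v: "v \<in> L2_space \<Omega>" for v
  proof -
    \<comment> \<open>h is the orthogonal projection of v onto the closure of V. The sequence lies
      in V, so its pairings with v and with h agree.\<close>
    obtain h vs where h: "h \<in> L2_space \<Omega>" "\<And>w. w \<in> V \<Longrightarrow> L2_inner \<Omega> v w = L2_inner \<Omega> h w"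
      "\<And>n. vs n \<in> V" "(\<lambda>n. L2_dist \<Omega> (vs n) h) \<longlonglongrightarrow> 0"
    proof (rule L2_Riesz[OF VL si, of "L2_inner \<Omega> v" "L2_norm \<Omega> v"])
      show "L2_inner \<Omega> v (\<lambda>x. f x + c * g x) = L2_inner \<Omega> v f + c * L2_inner \<Omega> v g"
        if "f \<in> V" "g \<in> V" for f g c
        using that VL by (intro L2.lin_right v) auto
      show "\<bar>L2_inner \<Omega> v f\<bar> \<le> L2_norm \<Omega> v * L2_norm \<Omega> f" if "f \<in> V" for f
        using that VL by (intro L2_Cauchy_Schwarz v) auto
    qed (use L2_norm_nonneg in blast)+
    have "L2_inner \<Omega> (?w n) v = L2_inner \<Omega> (?w n) h" for n
    proof -
      have "?w n \<in> V" using us r(2) by (simp add: V_def)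
      then show ?thesis using h(2) us h(1) v by (metis L2.sym)
    qed
    moreover have "Cauchy (\<lambda>n. L2_inner \<Omega> (?w n) h)"
    proof (rule metric_CauchyI)
      fix e :: real assume e: "0 < e"
      have K0: "0 \<le> K" using K[of 0] L2_norm_nonneg[of \<Omega> "us 0"] by linarith
      \<comment> \<open>Three errors of e/3: h is replaced by \<open>vs k\<close> twice, and the
        pairings with \<open>vs k\<close> are Cauchy. K + 1 avoids division by 0.\<close>
      define d where "d = e / (3 * (K + 1))"
      have d: "0 < d" "K * d < e / 3" using e K0 by (auto simp: d_def field_simps)
      obtain k where k: "L2_dist \<Omega> (vs k) h < d"
        using order_tendstoD(2)[OF h(4) d(1)] by (auto simp: eventually_sequentially)
      have "convergent (\<lambda>n. L2_inner \<Omega> (?w n) (vs k))" using h(3)[of k] by (simp add: V_def)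
      then have "Cauchy (\<lambda>n. L2_inner \<Omega> (?w n) (vs k))" by (rule convergent_Cauchy)
      then obtain N where N: "\<And>m n. m \<ge> N \<Longrightarrow> n \<ge> N \<Longrightarrow>
        dist (L2_inner \<Omega> (?w m) (vs k)) (L2_inner \<Omega> (?w n) (vs k)) < e / 3"
        using e unfolding Cauchy_def by (meson divide_pos_pos zero_less_numeral)
      have near: "\<bar>L2_inner \<Omega> (?w n) (vs k) - L2_inner \<Omega> (?w n) h\<bar> < e / 3" for n
      proof -
        have vk: "vs k \<in> L2_space \<Omega>" using h(3) VL by blast
        have "\<bar>L2_inner \<Omega> (?w n) (vs k) - L2_inner \<Omega> (?w n) h\<bar> \<le> L2_norm \<Omega> (?w n) * L2_dist \<Omega> (vs k) h"
          using L2_Cauchy_Schwarz[OF us L2.diff[OF vk h(1)], of "r n"] L2.diff_right[OF vk h(1) us, of "r n"]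
          by (simp add: L2_dist_def)
        also have "\<dots> \<le> K * d"
          using k K0 by (intro mult_mono K) (auto simp: L2_dist_nonneg)
        finally show ?thesis using d(2) by linarith
      qed
      have "dist (L2_inner \<Omega> (?w m) h) (L2_inner \<Omega> (?w n) h) < e" if "m \<ge> N" "n \<ge> N" for m n
        using N[OF that] near[of m] near[of n] unfolding dist_real_def by linarith
      then show "\<exists>M. \<forall>m\<ge>M. \<forall>n\<ge>M. dist (L2_inner \<Omega> (?w m) h) (L2_inner \<Omega> (?w n) h) < e" by blast
    qed
    ultimately show ?thesis by (simp add: Cauchy_convergent_iff)
  qed
  then show thesis using that r(1) by blast
qed

text \<open>Averaging over translates requires joint measurability of (x, z) \<mapsto> u (z + x) and
  Tonelli for \<open>lborel\<close>. For that u has to be Borel, not merely Lebesgue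
  measurable.\<close>

lemma L2_borel_version:
  fixes u :: "'a::euclidean_space \<Rightarrow> real"
  assumes "u \<in> L2_space \<Omega>" "\<Omega> \<in> sets lebesgue"
  obtains u' where "u' \<in> borel_measurable borel" "AE x in lebesgue_on \<Omega>. u x = u' x" "u' \<in> L2_space \<Omega>"
proof -
  have "(\<lambda>x. indicator \<Omega> x * u x) \<in> borel_measurable lebesgue"
    using L2_spaceD(1)[OF assms(1)] borel_measurable_lebesgue_on_iff[OF assms(2)] by blast
  then obtain u' where u': "u' \<in> borel_measurable lborel" "AE x in lborel. indicator \<Omega> x * u x = u' x"
    using completion_ex_borel_measurable_real by blast
  have "AE x in lebesgue. x \<in> \<Omega> \<longrightarrow> u x = u' x"
    using AE_completion[OF u'(2)] by eventually_elim (auto simp: indicator_def)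
  then have ae: "AE x in lebesgue_on \<Omega>. u x = u' x" using assms(2) by (simp add: AE_restrict_space_iff)
  have m: "u' \<in> borel_measurable borel" using u'(1) by simp
  then have "u' \<in> borel_measurable (lebesgue_on \<Omega>)"
    by (intro measurable_restrict_space1 measurable_completion) simp
  from that[OF m ae L2_space_cong_AE[OF assms(1) this ae]] show thesis .
qed

lemma weak_deriv_bound_cong_AE:
  assumes "bounded \<Omega>" "\<Omega> \<in> sets lebesgue" "u \<in> L2_space \<Omega>" "u' \<in> L2_space \<Omega>"
    "AE x in lebesgue_on \<Omega>. u x = u' x" "weak_deriv_bound \<Omega> u y C"
  shows "weak_deriv_bound \<Omega> u' y C"
  unfolding weak_deriv_bound_def
proof
  fix \<phi> assume \<phi>: "\<phi> \<in> test_functions \<Omega>"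
  note t = test_function_L2(2)[OF assms(1,2) \<phi>, of y]
  have "L2_inner \<Omega> u (dderiv \<phi> y) = L2_inner \<Omega> u' (dderiv \<phi> y)"
    by (rule L2_inner_cong_AE[OF assms(5) _ assms(3,4) t t]) simp
  then show "\<bar>L2_inner \<Omega> u' (dderiv \<phi> y)\<bar> \<le> C * L2_norm \<Omega> \<phi>"
    using weak_deriv_boundD[OF assms(6) \<phi>] by simp
qed

text \<open>The mean over the ball around x, written over a fixed ball: then u minus its average is
  a mean of differences u(x) - u(z + x), to which \<open>translation_bound\<close> applies.\<close>

definition ball_average :: "real \<Rightarrow> ('a::euclidean_space \<Rightarrow> real) \<Rightarrow> 'a \<Rightarrow> real" where
  "ball_average d u x = (LINT z|lborel. indicator (ball 0 d) z * u (z + x)) / measure lborel (ball 0 d :: 'a set)"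

lemma integral_lebesgue_on_borel:
  fixes f :: "'a::euclidean_space \<Rightarrow> real"
  assumes "f \<in> borel_measurable borel" "S \<in> sets borel"
  shows "(LINT x|lebesgue_on S. f x) = (LINT x|lborel. indicator S x * f x)"
proof -
  have [measurable]: "f \<in> borel_measurable borel" "S \<in> sets borel" by fact+
  have "(LINT x|lebesgue_on S. f x) = (LINT x|lebesgue. indicator S x * f x)"
    using assms by (simp add: integral_restrict_space)
  also have "\<dots> = (LINT x|lborel. indicator S x * f x)"
    by (rule integral_completion) measurable
  finally show ?thesis .
qed

lemma nn_integral_lebesgue_on_borel:
  fixes f :: "'a::euclidean_space \<Rightarrow> ennreal"
  assumes "S \<in> sets borel"
  shows "(\<integral>\<^sup>+x. f x \<partial>lebesgue_on S) = (\<integral>\<^sup>+x. f x * indicator S x \<partial>lborel)"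
  using assms by (simp add: nn_integral_restrict_space nn_integral_completion)

lemma measurable_ball_average:
  fixes u :: "'a::euclidean_space \<Rightarrow> real"
  assumes [measurable]: "u \<in> borel_measurable borel"
  shows "ball_average d u \<in> borel_measurable borel"
proof -
  have [measurable]: "ball (0::'a) d \<in> sets borel" by simp
  have "(\<lambda>(x, z). indicator (ball 0 d) z * u (z + x)) \<in> borel_measurable (borel \<Otimes>\<^sub>M borel)"
    by measurable
  then have "(\<lambda>(x, z). indicator (ball 0 d) z * u (z + x)) \<in> borel_measurable (borel \<Otimes>\<^sub>M lborel)"
    by (simp cong: measurable_cong_sets sets_pair_measure_cong)
  then have "(\<lambda>x. LINT z|lborel. indicator (ball 0 d) z * u (z + x)) \<in> borel_measurable borel"
    by (rule lborel.borel_measurable_lebesgue_integral)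
  then show ?thesis unfolding ball_average_def by (rule borel_measurable_divide) simp
qed

lemma nn_integral_L2:
  "f \<in> L2_space \<Omega> \<Longrightarrow> (\<integral>\<^sup>+x. ennreal ((f x)\<^sup>2) \<partial>lebesgue_on \<Omega>) = ennreal ((L2_norm \<Omega> f)\<^sup>2)"
  by (simp add: L2_norm_sq nn_integral_eq_integral L2_spaceD)

text \<open>As a pairing with a fixed L^2 function, the average at x converges along weakly
  convergent sequences. This is how weak convergence becomes pointwise.\<close>

lemma ball_average_eq:
  fixes u :: "'a::euclidean_space \<Rightarrow> real"
  assumes "u \<in> borel_measurable borel" "\<Omega> \<in> sets lebesgue" "(\<lambda>z. z + x) ` ball 0 d \<subseteq> \<Omega>"
  shows "ball_average d u x = L2_inner \<Omega> u (indicator (ball x d)) / measure lborel (ball 0 d :: 'a set)"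
proof -
  have [measurable]: "u \<in> borel_measurable borel" "ball x d \<in> sets borel" "ball (0::'a) d \<in> sets borel"
    using assms(1) by simp_all
  have m: "(\<lambda>y. u y * indicator (ball x d) y) \<in> borel_measurable (lebesgue_on \<Omega>)"
    by (intro measurable_restrict_space1 measurable_completion) measurable
  have ind: "indicator (ball x d) (z + x) = (indicator (ball 0 d) z :: real)" for z
    by (simp add: indicator_def dist_norm norm_minus_commute)
  have "L2_inner \<Omega> u (indicator (ball x d))
     = (LINT z|lebesgue_on (ball 0 d). u (z + x) * indicator (ball x d) (z + x))"
    unfolding L2_inner_def
    by (rule integral_translate(1)[OF m assms(2) _ assms(3)]) (auto simp: ind)
  also have "\<dots> = (LINT z|lborel. indicator (ball 0 d) z * (u (z + x) * indicator (ball x d) (z + x)))"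
    by (rule integral_lebesgue_on_borel) measurable
  also have "\<dots> = (LINT z|lborel. indicator (ball 0 d) z * u (z + x))"
    unfolding ind by (intro Bochner_Integration.integral_cong) (auto simp: indicator_def)
  finally show ?thesis by (simp add: ball_average_def)
qed

text \<open>Jensen's inequality over the ball bounds the squared error by the mean of squared
  translation differences; Tonelli exchanges the integrals, and each shift with |z| < d costs at
  most d C. Only C enters from u, so the averages approximate a whole sequence uniformly.\<close>

lemma ball_average_error:
  fixes u :: "'a::euclidean_space \<Rightarrow> real"
  assumes u[measurable]: "u \<in> borel_measurable borel" and uL: "u \<in> L2_space \<Omega>"
    and \<Omega>: "open \<Omega>" "bounded \<Omega>" and K: "compact K" "K \<subseteq> \<omega>" and \<omega>: "open \<omega>" "\<omega> \<subseteq> \<Omega>"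
    and thick: "\<And>z. norm z \<le> d \<Longrightarrow> (\<lambda>x. x + z) ` \<omega> \<subseteq> \<Omega>" and d: "0 < d"
    and bound: "\<And>y. weak_deriv_bound \<Omega> u y (norm y * C)" and C: "0 \<le> C"
  shows "(\<lambda>x. u x - ball_average d u x) \<in> L2_space K" "L2_norm K (\<lambda>x. u x - ball_average d u x) \<le> d * C"
proof -
  let ?B = "ball 0 d :: 'a set"
  let ?c = "measure lborel ?B"
  let ?A = "ball_average d u"
  have \<Omega>s: "\<Omega> \<in> sets lebesgue" using \<Omega>(1) by auto
  have [measurable]: "?B \<in> sets borel" by simp
  have [measurable]: "K \<in> sets borel" "\<omega> \<in> sets borel" using K \<omega> by (auto intro: borel_compact)
  note [measurable] = measurable_ball_average[OF u]
  have c: "0 < ?c" using content_ball_pos[OF d, of 0] by simp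
  have ec: "emeasure lborel ?B = ennreal ?c"
    by (rule emeasure_eq_ennreal_measure) (metis emeasure_lborel_ball_finite less_irrefl infinity_ennreal_def)
  have shift: "(\<integral>\<^sup>+x. ennreal ((u (z + x) - u x)\<^sup>2) * indicator K x \<partial>lborel) \<le> ennreal ((d * C)\<^sup>2)"
    if z: "z \<in> ?B" for z
  proof -
    have sub: "(\<lambda>x. x + t *\<^sub>R z) ` \<omega> \<subseteq> \<Omega>" if "0 \<le> t" "t \<le> 1" for t
    proof (rule thick)
      have "t * norm z \<le> 1 * norm z" using that by (intro mult_right_mono) auto
      then show "norm (t *\<^sub>R z) \<le> d" using z that by simp
    qed
    have "0 \<le> norm z * C" using C by simp
    note tb = translation_bound[OF \<Omega> uL bound this \<omega>(1) sub]
    have "(\<integral>\<^sup>+x. ennreal ((u (z + x) - u x)\<^sup>2) * indicator K x \<partial>lborel)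
       \<le> (\<integral>\<^sup>+x. ennreal ((u (x + z) - u x)\<^sup>2) * indicator \<omega> x \<partial>lborel)"
      using K(2) by (intro nn_integral_mono) (auto simp: indicator_def add.commute)
    also have "\<dots> = ennreal ((L2_norm \<omega> (\<lambda>x. u (x + z) - u x))\<^sup>2)"
      using nn_integral_L2[OF tb(1)] by (simp add: nn_integral_lebesgue_on_borel)
    also have "\<dots> \<le> ennreal ((d * C)\<^sup>2)"
    proof (intro ennreal_leI power_mono L2_norm_nonneg)
      have "norm z * C \<le> d * C" using z C by (intro mult_right_mono) auto
      then show "L2_norm \<omega> (\<lambda>x. u (x + z) - u x) \<le> d * C" using tb(2) by simp
    qed
    finally show ?thesis .
  qed
  have Jensen: "ennreal ((u x - ?A x)\<^sup>2) \<le>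
      ennreal (1 / ?c) * (\<integral>\<^sup>+z. ennreal ((u (z + x) - u x)\<^sup>2) * indicator ?B z \<partial>lborel)" if x: "x \<in> K" for x
  proof -
    have xB: "(\<lambda>z. z + x) ` ?B \<subseteq> \<Omega>"
    proof (intro image_subsetI)
      fix z assume "z \<in> ?B"
      then show "z + x \<in> \<Omega>" using thick[of z] x K(2) by (auto simp: add.commute)
    qed
    have uB: "(\<lambda>z. u (z + x)) \<in> L2_space ?B" by (rule L2_translate[OF uL \<Omega>s _ xB]) simp
    have constB: "(\<lambda>_. a) \<in> L2_space ?B" for a :: real
      by (rule L2_space_bounded[of _ _ "\<bar>a\<bar>"]) auto
    let ?f = "\<lambda>z. u (z + x) - u x"
    have fB: "?f \<in> L2_space ?B" by (rule L2.diff[OF uB constB])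
    have "?A x = L2_inner ?B (\<lambda>z. u (z + x)) (\<lambda>_. 1) / ?c"
      unfolding ball_average_def L2_inner_def by (subst integral_lebesgue_on_borel) auto
    moreover have cB: "L2_inner ?B (\<lambda>_. a) (\<lambda>_. 1) = a * ?c" for a
      unfolding L2_inner_def by (subst integral_lebesgue_on_borel) auto
    moreover have "u x = L2_inner ?B (\<lambda>_. u x) (\<lambda>_. 1) / ?c" unfolding cB using c by simp
    ultimately have "?A x - u x = L2_inner ?B ?f (\<lambda>_. 1) / ?c"
      using L2.diff_left[OF uB constB constB] by (simp add: diff_divide_distrib)
    \<comment> \<open>Jensen for the square, as Cauchy--Schwarz against the constant 1.\<close>
    moreover have "(L2_inner ?B ?f (\<lambda>_. 1))\<^sup>2 \<le> (L2_norm ?B ?f)\<^sup>2 * ?c"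
      using L2.Cauchy_Schwarz_sq[OF fB constB, of 1] L2.nrm_sq[OF fB] cB[of 1] by (simp add: L2_nrm_eq)
    moreover have "(i / ?c)\<^sup>2 \<le> (1 / ?c) * N" if "i\<^sup>2 \<le> N * ?c" for i N :: real
    proof -
      have "(i / ?c)\<^sup>2 \<le> N * ?c / ?c\<^sup>2" using that by (simp add: power_divide divide_right_mono)
      then show ?thesis using c by (simp add: power2_eq_square)
    qed
    ultimately have "(?A x - u x)\<^sup>2 \<le> (1 / ?c) * (L2_norm ?B ?f)\<^sup>2" by presburger
    then have "ennreal ((u x - ?A x)\<^sup>2) \<le> ennreal ((1 / ?c) * (L2_norm ?B ?f)\<^sup>2)"
      by (intro ennreal_leI) (simp add: power2_commute)
    also have "\<dots> = ennreal (1 / ?c) * (\<integral>\<^sup>+z. ennreal ((?f z)\<^sup>2) \<partial>lebesgue_on ?B)"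
      unfolding nn_integral_L2[OF fB] using c by (intro ennreal_mult) auto
    finally show ?thesis by (simp add: nn_integral_lebesgue_on_borel)
  qed
  have "(\<integral>\<^sup>+x. ennreal ((u x - ?A x)\<^sup>2) \<partial>lebesgue_on K)
    \<le> (\<integral>\<^sup>+x. (\<integral>\<^sup>+z. ennreal (1 / ?c) * (ennreal ((u (z + x) - u x)\<^sup>2) * indicator ?B z) * indicator K x \<partial>lborel) \<partial>lborel)"
    unfolding nn_integral_lebesgue_on_borel[OF \<open>K \<in> sets borel\<close>]
  proof (rule nn_integral_mono)
    fix x
    show "ennreal ((u x - ?A x)\<^sup>2) * indicator K x \<le>
      (\<integral>\<^sup>+z. ennreal (1 / ?c) * (ennreal ((u (z + x) - u x)\<^sup>2) * indicator ?B z) * indicator K x \<partial>lborel)"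
      using Jensen[of x] by (cases "x \<in> K") (auto simp: nn_integral_cmult)
  qed
  also have "\<dots> = (\<integral>\<^sup>+z. (\<integral>\<^sup>+x. ennreal (1 / ?c) * (ennreal ((u (z + x) - u x)\<^sup>2) * indicator ?B z) * indicator K x \<partial>lborel) \<partial>lborel)"
  proof (rule lborel_pair.Fubini')
    have "(\<lambda>(z, x). ennreal (1 / ?c) * (ennreal ((u (z + x) - u x)\<^sup>2) * indicator ?B z) * indicator K x)
      \<in> borel_measurable (borel \<Otimes>\<^sub>M borel)" by measurable
    then show "(\<lambda>(z, x). ennreal (1 / ?c) * (ennreal ((u (z + x) - u x)\<^sup>2) * indicator ?B z) * indicator K x)
      \<in> borel_measurable (lborel \<Otimes>\<^sub>M lborel)"
      by (simp cong: measurable_cong_sets sets_pair_measure_cong)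
  qed
  also have "\<dots> \<le> (\<integral>\<^sup>+z. ennreal (1 / ?c * (d * C)\<^sup>2) * indicator ?B z \<partial>lborel)"
  proof (rule nn_integral_mono)
    fix z
    have "(\<integral>\<^sup>+x. ennreal (1 / ?c) * (ennreal ((u (z + x) - u x)\<^sup>2) * indicator ?B z) * indicator K x \<partial>lborel)
      = (ennreal (1 / ?c) * indicator ?B z) * (\<integral>\<^sup>+x. ennreal ((u (z + x) - u x)\<^sup>2) * indicator K x \<partial>lborel)"
      by (subst nn_integral_cmult[symmetric]) (auto simp: mult_ac)
    also have "\<dots> \<le> (ennreal (1 / ?c) * indicator ?B z) * ennreal ((d * C)\<^sup>2)"
      using shift[of z] by (cases "z \<in> ?B") (auto intro: mult_left_mono)
    also have "\<dots> = ennreal (1 / ?c * (d * C)\<^sup>2) * indicator ?B z"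
      using c ennreal_mult[of "1 / ?c" "(d * C)\<^sup>2"] by (simp only: mult_ac) simp
    finally show "(\<integral>\<^sup>+x. ennreal (1 / ?c) * (ennreal ((u (z + x) - u x)\<^sup>2) * indicator ?B z) * indicator K x \<partial>lborel)
      \<le> ennreal (1 / ?c * (d * C)\<^sup>2) * indicator ?B z" .
  qed
  also have "\<dots> = ennreal (1 / ?c * (d * C)\<^sup>2) * ennreal ?c"
    by (simp add: nn_integral_cmult_indicator ec)
  also have "\<dots> = ennreal ((d * C)\<^sup>2)"
    using c by (subst ennreal_mult[symmetric]) auto
  finally have fin: "(\<integral>\<^sup>+x. ennreal ((u x - ?A x)\<^sup>2) \<partial>lebesgue_on K) \<le> ennreal ((d * C)\<^sup>2)" .
  have m: "(\<lambda>x. u x - ?A x) \<in> borel_measurable (lebesgue_on K)"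
    by (intro measurable_restrict_space1 measurable_completion) measurable
  have "integrable (lebesgue_on K) (\<lambda>x. (u x - ?A x)\<^sup>2)"
    using fin m by (intro integrableI_nonneg) (auto intro: le_less_trans)
  then show L: "(\<lambda>x. u x - ?A x) \<in> L2_space K" using m by (simp add: L2_space_def)
  have "(L2_norm K (\<lambda>x. u x - ?A x))\<^sup>2 \<le> (d * C)\<^sup>2"
    using fin unfolding nn_integral_L2[OF L] by (subst (asm) ennreal_le_iff) auto
  then show "L2_norm K (\<lambda>x. u x - ?A x) \<le> d * C"
    by (rule power2_le_imp_le) (use C d in simp)
qed

text \<open>Clipping at M turns a bound that would survive only almost everywhere into one at every
  point.\<close>

lemma L2_bounded_borel_version:
  fixes u :: "'a::euclidean_space \<Rightarrow> real"
  assumes "u \<in> L2_space \<Omega>" "\<Omega> \<in> sets lebesgue" "\<And>x. \<bar>u x\<bar> \<le> M"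
  obtains u' where "u' \<in> borel_measurable borel" "AE x in lebesgue_on \<Omega>. u x = u' x"
    "u' \<in> L2_space \<Omega>" "\<And>x. \<bar>u' x\<bar> \<le> M"
proof -
  obtain v where v: "v \<in> borel_measurable borel" "AE x in lebesgue_on \<Omega>. u x = v x"
    using L2_borel_version[OF assms(1,2)] by blast
  let ?u = "\<lambda>x. max (- M) (min M (v x))"
  have M: "0 \<le> M" using assms(3)[of 0] by simp
  have m: "?u \<in> borel_measurable borel" using v(1) by simp
  then have m': "?u \<in> borel_measurable (lebesgue_on \<Omega>)"
    by (intro measurable_restrict_space1 measurable_completion) simp
  have ae: "AE x in lebesgue_on \<Omega>. u x = ?u x"
    using v(2)
  proof eventually_elim
    case (elim x)
    then show ?case using assms(3)[of x] by (simp add: abs_le_iff)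
  qed
  have "\<bar>?u x\<bar> \<le> M" for x using M by auto
  from that[OF m ae L2_space_cong_AE[OF assms(1) m' ae] this] show thesis .
qed

lemma L2_norm_split:
  assumes "w \<in> L2_space \<Omega>" "\<Omega> \<in> sets lebesgue" "K \<in> sets lebesgue" "K \<subseteq> \<Omega>"
  shows "(L2_norm \<Omega> w)\<^sup>2 = (L2_norm K w)\<^sup>2 + (L2_norm (\<Omega> - K) w)\<^sup>2"
proof -
  have i: "integrable lebesgue (\<lambda>x. indicator A x *\<^sub>R (w x)\<^sup>2)" if "A \<in> sets lebesgue" "A \<subseteq> \<Omega>" for A
    using L2_spaceD(2)[OF L2_subset[OF assms(1,2) that]] that by (subst (asm) integrable_restrict_space) auto
  have D: "\<Omega> - K \<in> sets lebesgue" using assms by auto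
  have "(L2_norm \<Omega> w)\<^sup>2 = (LINT x|lebesgue. indicator K x *\<^sub>R (w x)\<^sup>2 + indicator (\<Omega> - K) x *\<^sub>R (w x)\<^sup>2)"
    unfolding L2_norm_sq using assms(2,4)
    by (subst integral_restrict_space) (auto intro!: Bochner_Integration.integral_cong simp: indicator_def)
  also have "\<dots> = (LINT x|lebesgue. indicator K x *\<^sub>R (w x)\<^sup>2) + (LINT x|lebesgue. indicator (\<Omega> - K) x *\<^sub>R (w x)\<^sup>2)"
    using i[of K] i[of "\<Omega> - K"] assms(3,4) D by (intro Bochner_Integration.integral_add) auto
  also have "\<dots> = (L2_norm K w)\<^sup>2 + (L2_norm (\<Omega> - K) w)\<^sup>2"
    unfolding L2_norm_sq using assms(3) D by (simp add: integral_restrict_space)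
  finally show ?thesis .
qed

lemma L2_norm_bounded_sq:
  assumes "w \<in> L2_space S" "S \<in> lmeasurable" "\<And>x. \<bar>w x\<bar> \<le> B"
  shows "(L2_norm S w)\<^sup>2 \<le> B\<^sup>2 * measure lebesgue S"
proof -
  have S: "S \<in> sets lebesgue" using assms(2) by auto
  have "(L2_norm S w)\<^sup>2 = (LINT x|lebesgue. indicator S x * (w x)\<^sup>2)"
    unfolding L2_norm_sq using S by (simp add: integral_restrict_space)
  also have "\<dots> \<le> (LINT x|lebesgue. indicator S x * B\<^sup>2)"
  proof (rule integral_mono)
    show "integrable lebesgue (\<lambda>x. indicator S x * (w x)\<^sup>2)"
      using L2_spaceD(2)[OF assms(1)] S by (simp add: integrable_restrict_space)
    show "integrable lebesgue (\<lambda>x. indicator S x * B\<^sup>2)"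
      using assms(2) by (intro integrable_mult_left impI integrable_real_indicator fmeasurableD2[THEN less_top[THEN iffD1]]) (auto simp: fmeasurable_def)
    show "indicator S x * (w x)\<^sup>2 \<le> indicator S x * B\<^sup>2" for x
      using power_mono[OF assms(3)[of x], of 2] by (auto simp: indicator_def)
  qed
  also have "\<dots> = B\<^sup>2 * measure lebesgue S" using S by simp
  finally show ?thesis .
qed

lemma indicator_ball_L2:
  assumes "bounded \<Omega>" "\<Omega> \<in> sets lebesgue"
  shows "indicator (ball x d) \<in> L2_space \<Omega>" "L2_norm \<Omega> (indicator (ball x d)) \<le> L2_norm \<Omega> (\<lambda>_. 1)"
proof -
  have m: "(indicator (ball x d) :: 'a \<Rightarrow> real) \<in> borel_measurable (lebesgue_on \<Omega>)"
    by (intro measurable_restrict_space1 measurable_completion)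
      (simp add: borel_measurable_indicator)
  have one: "(\<lambda>_. 1) \<in> L2_space \<Omega>" by (rule L2_space_bounded[OF assms, of _ 1]) auto
  have le: "AE y in lebesgue_on \<Omega>. \<bar>indicator (ball x d) y\<bar> \<le> \<bar>1::real\<bar>"
    by (intro always_eventually allI) (simp add: indicator_def)
  show "indicator (ball x d) \<in> L2_space \<Omega>" by (rule L2_norm_mono(1)[OF m one le])
  show "L2_norm \<Omega> (indicator (ball x d)) \<le> L2_norm \<Omega> (\<lambda>_. 1)" by (rule L2_norm_mono(2)[OF m one le])
qed

lemma bounded_pointwise_convergence_L2:
  fixes A :: "nat \<Rightarrow> 'a::euclidean_space \<Rightarrow> real"
  assumes K: "bounded K" "K \<in> sets lebesgue" and A: "\<And>n. A n \<in> borel_measurable borel"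
    and B: "\<And>n x. x \<in> K \<Longrightarrow> \<bar>A n x\<bar> \<le> B" and lim: "\<And>x. x \<in> K \<Longrightarrow> (\<lambda>n. A n x) \<longlonglongrightarrow> a x"
    and a: "a \<in> borel_measurable borel"
  shows "A n \<in> L2_space K" "a \<in> L2_space K" "(\<lambda>n. L2_dist K (A n) a) \<longlonglongrightarrow> 0"
proof -
  have m: "f \<in> borel_measurable borel \<Longrightarrow> f \<in> borel_measurable (lebesgue_on K)" for f :: "'a \<Rightarrow> real"
    by (intro measurable_restrict_space1 measurable_completion) simp
  have aB: "\<bar>a x\<bar> \<le> B" if "x \<in> K" for x
    using tendsto_rabs[OF lim[OF that]] by (rule tendsto_upperbound) (use B[OF that] in auto)
  show L: "A n \<in> L2_space K" for n by (rule L2_space_bounded[OF K m[OF A] B])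
  show aL: "a \<in> L2_space K" by (rule L2_space_bounded[OF K m[OF a] aB])
  have "(\<lambda>n. LINT x|lebesgue_on K. (A n x - a x)\<^sup>2) \<longlonglongrightarrow> (LINT x|lebesgue_on K. 0)"
  proof (rule integral_dominated_convergence[where w="\<lambda>_. (2 * B)\<^sup>2"])
    interpret finite_measure "lebesgue_on K" by (rule bounded_finite_measure[OF K])
    show "integrable (lebesgue_on K) (\<lambda>_. (2 * B)\<^sup>2)" by simp
    show "(\<lambda>x. (A n x - a x)\<^sup>2) \<in> borel_measurable (lebesgue_on K)" for n
      using m[OF A, of n] m[OF a] by simp
    show "AE x in lebesgue_on K. (\<lambda>n. (A n x - a x)\<^sup>2) \<longlonglongrightarrow> 0"
    proof (rule AE_I2)
      fix x assume "x \<in> space (lebesgue_on K)"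
      then have "x \<in> K" by simp
      from tendsto_power[OF tendsto_diff[OF lim[OF this] tendsto_const[of "a x"]], of 2]
      show "(\<lambda>n. (A n x - a x)\<^sup>2) \<longlonglongrightarrow> 0" by simp
    qed
    show "AE x in lebesgue_on K. norm ((A n x - a x)\<^sup>2) \<le> (2 * B)\<^sup>2" for n
    proof (rule AE_I2)
      fix x assume "x \<in> space (lebesgue_on K)"
      then have "x \<in> K" by simp
      then have "\<bar>A n x - a x\<bar> \<le> 2 * B" using B[of x n] aB[of x] by linarith
      from power_mono[OF this, of 2] show "norm ((A n x - a x)\<^sup>2) \<le> (2 * B)\<^sup>2" by simp
    qed
  qed simp
  then have "(\<lambda>n. (L2_dist K (A n) a)\<^sup>2) \<longlonglongrightarrow> 0" by (simp add: L2_dist_def L2_norm_sq)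
  from tendsto_real_sqrt[OF this] show "(\<lambda>n. L2_dist K (A n) a) \<longlonglongrightarrow> 0"
    by (simp add: L2_dist_nonneg)
qed

text \<open>
  No regularity of \<open>\<partial>\<Omega>\<close> is available, so the embedding of \<open>H\<^sup>1\<close> into \<open>L\<^sup>2\<close> is only locally compact; the
  uniform bound on the functions controls the part close to the boundary.
\<close>

theorem bounded_Rellich:
  fixes us :: "nat \<Rightarrow> 'a::euclidean_space \<Rightarrow> real"
  assumes \<Omega>: "open \<Omega>" "bounded \<Omega>" and us: "\<And>n. us n \<in> L2_space \<Omega>" and M: "\<And>n x. \<bar>us n x\<bar> \<le> M"
    and bound: "\<And>n y. weak_deriv_bound \<Omega> (us n) y (norm y * C)" and C: "0 \<le> C"
  obtains r where "strict_mono r" "L2.cauchy \<Omega> (\<lambda>n. us (r n))"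
proof -
  have \<Omega>s: "\<Omega> \<in> sets lebesgue" using \<Omega>(1) by auto
  have M0: "0 \<le> M" using M[of 0 0] by simp
  have constL: "(\<lambda>_. c) \<in> L2_space \<Omega>" for c :: real
    by (rule L2_space_bounded[OF \<Omega>(2) \<Omega>s, of _ "\<bar>c\<bar>"]) auto
  let ?N = "L2_norm \<Omega> (\<lambda>_. M)" and ?N1 = "L2_norm \<Omega> (\<lambda>_. 1)"
  have usN: "L2_norm \<Omega> u \<le> ?N" if "u \<in> L2_space \<Omega>" "\<And>x. \<bar>u x\<bar> \<le> M" for u
  proof (rule L2_norm_mono(2)[OF L2_spaceD(1)[OF that(1)] constL])
    show "AE x in lebesgue_on \<Omega>. \<bar>u x\<bar> \<le> \<bar>M\<bar>" using that(2) M0 by simp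
  qed
  obtain r where r: "strict_mono r"
    "\<And>v. v \<in> L2_space \<Omega> \<Longrightarrow> convergent (\<lambda>n. L2_inner \<Omega> (us (r n)) v)"
    using L2_weak_compactness[of us \<Omega> ?N, OF us usN[OF us M]] by blast
  have "\<exists>w. w \<in> borel_measurable borel \<and> (AE x in lebesgue_on \<Omega>. us (r n) x = w x) \<and>
      w \<in> L2_space \<Omega> \<and> (\<forall>x. \<bar>w x\<bar> \<le> M)" for n
    by (rule L2_bounded_borel_version[OF us \<Omega>s M, of "r n"]) blast
  then obtain w where w: "\<And>n. w n \<in> borel_measurable borel" "\<And>n. AE x in lebesgue_on \<Omega>. us (r n) x = w n x"
    "\<And>n. w n \<in> L2_space \<Omega>" "\<And>n x. \<bar>w n x\<bar> \<le> M"
    by metis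
  have wb: "weak_deriv_bound \<Omega> (w n) y (norm y * C)" for n y
    by (rule weak_deriv_bound_cong_AE[OF \<Omega>(2) \<Omega>s us w(3,2) bound])
  have wconv: "convergent (\<lambda>n. L2_inner \<Omega> (w n) v)" if "v \<in> L2_space \<Omega>" for v
    using r(2)[OF that] L2_inner_cong_AE[OF w(2) AE_I2 us w(3) that that] by simp
  have main: "\<exists>N. \<forall>m\<ge>N. \<forall>n\<ge>N. L2_dist \<Omega> (w m) (w n) < e" if e: "0 < e" for e
  proof -
    \<comment> \<open>Two functions bounded by M differ by at most 2 M, so a layer \<Omega> - K of
      measure at most s contributes at most e^2/4 to the squared distance.\<close>
    define s where "s = e\<^sup>2 / (16 * (M\<^sup>2 + 1))"
    have s: "0 < s" "(2 * M)\<^sup>2 * s \<le> e\<^sup>2 / 4"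
    proof -
      have p: "0 < M\<^sup>2 + 1" by (simp add: add_nonneg_pos)
      then show "0 < s" using e by (simp add: s_def)
      have "(2 * M)\<^sup>2 * s \<le> (4 * (M\<^sup>2 + 1)) * s" using \<open>0 < s\<close> by (simp add: power_mult_distrib)
      also have "\<dots> = e\<^sup>2 / 4"
      proof -
        have "4 * q * (e\<^sup>2 / (16 * q)) = e\<^sup>2 / 4" if "0 < q" for q using that by (simp add: field_simps)
        from this[OF p] show ?thesis by (simp only: s_def)
      qed
      finally show "(2 * M)\<^sup>2 * s \<le> e\<^sup>2 / 4" .
    qed
    obtain K where K: "closed K" "K \<subseteq> \<Omega>" "\<Omega> - K \<in> lmeasurable" "emeasure lebesgue (\<Omega> - K) < ennreal s"
      using sets_lebesgue_inner_closed[OF \<Omega>s s(1)] by blast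
    have Kc: "compact K" using K(1,2) \<Omega>(2) bounded_subset compact_eq_bounded_closed by blast
    have Ks: "K \<in> sets lebesgue" "bounded K" using Kc K(1) by (auto simp: compact_imp_bounded)
    have Km: "measure lebesgue (\<Omega> - K) \<le> s"
      using K(4) unfolding emeasure_eq_measure2[OF K(3)] by (subst (asm) ennreal_less_iff) auto
    obtain \<omega> e0 where \<omega>: "open \<omega>" "K \<subseteq> \<omega>" "\<omega> \<subseteq> \<Omega>" "0 < e0" "\<And>z. norm z \<le> e0 \<Longrightarrow> (\<lambda>x. x + z) ` \<omega> \<subseteq> \<Omega>"
      using compact_open_thickening[OF Kc K(2) \<Omega>(1)] by blast
    \<comment> \<open>Within the permitted shifts, and so small that averaging costs less than e/8
      on K.\<close>
    define d where "d = min e0 (e / (9 * (C + 1)))"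
    have d: "0 < d" "d \<le> e0" "d * C < e / 8"
    proof -
      show "0 < d" "d \<le> e0" using \<omega>(4) e C by (auto simp: d_def)
      have "d * C \<le> d * (C + 1)" using \<open>0 < d\<close> by simp
      also have "\<dots> \<le> e / (9 * (C + 1)) * (C + 1)" using C by (intro mult_right_mono) (auto simp: d_def)
      also have "\<dots> = e / 9" using C by (simp add: add_nonneg_eq_0_iff field_simps)
      finally show "d * C < e / 8" using e by linarith
    qed
    have thick: "\<And>z. norm z \<le> d \<Longrightarrow> (\<lambda>x. x + z) ` \<omega> \<subseteq> \<Omega>" using \<omega>(5) d(2) by auto
    let ?A = "\<lambda>n. ball_average d (w n)"
    let ?c = "measure lborel (ball 0 d :: 'a set)"
    define a where "a x = lim (\<lambda>n. ?A n x)" for x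
    have Am: "?A n \<in> borel_measurable borel" for n by (rule measurable_ball_average[OF w(1)])
    have am: "a \<in> borel_measurable borel" unfolding a_def by (rule borel_measurable_lim_metric[OF Am])
    have Aeq: "?A n x = L2_inner \<Omega> (w n) (indicator (ball x d)) / ?c" if "x \<in> K" for n x
    proof (rule ball_average_eq[OF w(1) \<Omega>s])
      show "(\<lambda>z. z + x) ` ball 0 d \<subseteq> \<Omega>"
      proof (intro image_subsetI)
        fix z :: 'a assume "z \<in> ball 0 d"
        then show "z + x \<in> \<Omega>" using thick[of z] that \<omega>(2) by (auto simp: add.commute)
      qed
    qed
    have Alim: "(\<lambda>n. ?A n x) \<longlonglongrightarrow> a x" if "x \<in> K" for x
    proof -
      obtain l where "(\<lambda>n. L2_inner \<Omega> (w n) (indicator (ball x d))) \<longlonglongrightarrow> l"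
        using wconv[OF indicator_ball_L2(1)[OF \<Omega>(2) \<Omega>s]] by (auto simp: convergent_def)
      then have "(\<lambda>n. L2_inner \<Omega> (w n) (indicator (ball x d)) * (1 / ?c)) \<longlonglongrightarrow> l * (1 / ?c)"
        by (intro tendsto_mult tendsto_const)
      then have "(\<lambda>n. ?A n x) \<longlonglongrightarrow> l * (1 / ?c)" by (simp add: Aeq[OF that])
      then show ?thesis unfolding a_def by (simp add: limI)
    qed
    have AB: "\<bar>?A n x\<bar> \<le> ?N * ?N1 / ?c" if "x \<in> K" for n x
    proof -
      have "\<bar>L2_inner \<Omega> (w n) (indicator (ball x d))\<bar> \<le> L2_norm \<Omega> (w n) * L2_norm \<Omega> (indicator (ball x d))"
        by (rule L2_Cauchy_Schwarz[OF w(3) indicator_ball_L2(1)[OF \<Omega>(2) \<Omega>s]])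
      also have "\<dots> \<le> ?N * ?N1"
        by (intro mult_mono usN w(3,4) indicator_ball_L2(2) \<Omega>(2) \<Omega>s L2_norm_nonneg)
      finally show ?thesis unfolding Aeq[OF that] by (simp add: divide_right_mono)
    qed
    \<comment> \<open>For this fixed d the averages converge pointwise on K and are bounded there,
      hence they converge in L^2(K).\<close>
    note conv = bounded_pointwise_convergence_L2[OF Ks(2,1) Am AB Alim am]
    obtain N where N: "\<And>n. n \<ge> N \<Longrightarrow> L2_dist K (?A n) a < e / 8"
      using order_tendstoD(2)[OF conv(3), of "e / 8"] e by (auto simp: eventually_sequentially)
    have wK: "w n \<in> L2_space K" for n by (rule L2_subset[OF w(3) \<Omega>s Ks(1) K(2)])
    have err: "L2_dist K (w n) (?A n) < e / 8" for n
      using ball_average_error(2)[OF w(1,3) \<Omega> Kc \<omega>(2,1,3) thick d(1) wb C, of n] d(3) by (simp add: L2_dist_def)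
    \<comment> \<open>One e/8 for averaging and one for the convergence of the averages; doubled,
      this gives e/2 on K.\<close>
    have half: "L2_dist K (w n) a < e / 4" if "n \<ge> N" for n
      using L2_dist_triangle[OF wK conv(1,2), of n n] err[of n] N[OF that] by linarith
    have "L2_dist \<Omega> (w m) (w n) < e" if mn: "m \<ge> N" "n \<ge> N" for m n
    proof -
      let ?D = "\<lambda>x. w m x - w n x"
      have D: "?D \<in> L2_space \<Omega>" by (rule L2.diff[OF w(3) w(3)])
      have "L2_dist K (w m) (w n) < e / 2"
        using L2_dist_triangle[OF wK conv(2) wK, of m n] half[OF mn(1)] half[OF mn(2)] L2_dist_sym[of K a "w n"]
        by linarith
      then have 1: "(L2_norm K ?D)\<^sup>2 < (e / 2)\<^sup>2"
        unfolding L2_dist_def by (intro power_strict_mono L2_norm_nonneg) auto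
      have Dm: "?D \<in> L2_space (\<Omega> - K)" using Ks(1) \<Omega>s by (intro L2_subset[OF D \<Omega>s]) auto
      have "\<bar>?D x\<bar> \<le> 2 * M" for x using w(4)[of m x] w(4)[of n x] by linarith
      from L2_norm_bounded_sq[OF Dm K(3) this]
      have "(L2_norm (\<Omega> - K) ?D)\<^sup>2 \<le> (2 * M)\<^sup>2 * measure lebesgue (\<Omega> - K)" .
      also have "\<dots> \<le> (2 * M)\<^sup>2 * s" by (rule mult_left_mono[OF Km]) simp
      also have "\<dots> \<le> e\<^sup>2 / 4" by (rule s(2))
      finally have "(L2_norm \<Omega> ?D)\<^sup>2 < e\<^sup>2 / 4 + e\<^sup>2 / 4"
        using 1 L2_norm_split[OF D \<Omega>s Ks(1) K(2)] by (simp add: power_divide)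
      also have "\<dots> \<le> e\<^sup>2" by simp
      finally have "(L2_norm \<Omega> ?D)\<^sup>2 < e\<^sup>2" .
      then show ?thesis unfolding L2_dist_def by (rule power2_less_imp_less) (use e in simp)
    qed
    then show ?thesis by blast
  qed
  have "L2_dist \<Omega> (us (r m)) (us (r n)) = L2_dist \<Omega> (w m) (w n)" for m n
    by (rule L2_dist_cong_AE[OF us w(3) us w(3) w(2) w(2)])
  then have "L2.cauchy \<Omega> (\<lambda>n. us (r n))"
    using main by (intro L2.cauchyI us) (simp add: L2_dist_nrm)
  then show thesis using that r(1) by blast
qed

subsection \<open>The closure of the form\<close>

lemma L2_inner_tendsto2:
  assumes "\<And>n. us n \<in> L2_space \<Omega>" "u \<in> L2_space \<Omega>" "\<And>n. vs n \<in> L2_space \<Omega>" "v \<in> L2_space \<Omega>"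
    and "(\<lambda>n. L2_dist \<Omega> (us n) u) \<longlonglongrightarrow> 0" "(\<lambda>n. L2_dist \<Omega> (vs n) v) \<longlonglongrightarrow> 0"
  shows "(\<lambda>n. L2_inner \<Omega> (us n) (vs n)) \<longlonglongrightarrow> L2_inner \<Omega> u v"
proof -
  have "convergent (\<lambda>n. L2_norm \<Omega> (vs n))"
    using L2_norm_tendsto[OF assms(3,4,6)] by (auto simp: convergent_def)
  then have "Bseq (\<lambda>n. L2_norm \<Omega> (vs n))" by (rule convergent_imp_Bseq)
  then obtain K where K: "\<And>n. norm (L2_norm \<Omega> (vs n)) \<le> K" by (auto simp: Bseq_def)
  have "(\<lambda>n. L2_inner \<Omega> (\<lambda>x. us n x - u x) (vs n)) \<longlonglongrightarrow> 0"
  proof (rule L2.null_inner_tendsto)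
    show "(\<lambda>n. L2.nrm \<Omega> (\<lambda>x. us n x - u x)) \<longlonglongrightarrow> 0" using assms(5) by (simp add: L2_dist_nrm)
    show "L2.nrm \<Omega> (vs n) \<le> K" for n using K[of n] by (simp add: L2_nrm_eq)
  qed (intro L2.diff assms)+
  moreover have "(\<lambda>n. L2_inner \<Omega> (vs n) u) \<longlonglongrightarrow> L2_inner \<Omega> v u"
    by (rule L2_inner_tendsto[OF assms(3,4,2,6)])
  ultimately have "(\<lambda>n. L2_inner \<Omega> (\<lambda>x. us n x - u x) (vs n) + L2_inner \<Omega> (vs n) u) \<longlonglongrightarrow> 0 + L2_inner \<Omega> v u"
    by (rule tendsto_add)
  moreover have "L2_inner \<Omega> (\<lambda>x. us n x - u x) (vs n) + L2_inner \<Omega> (vs n) u = L2_inner \<Omega> (us n) (vs n)" for n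
    unfolding L2.diff_left[OF assms(1,2,3)] L2.sym[OF assms(3,2)] by simp
  ultimately show ?thesis using L2.sym[OF assms(2,4)] by simp
qed

context boundary_pair
begin

abbreviation "D \<equiv> closure_domain \<Omega> \<kappa> \<theta>"
abbreviation "cf \<equiv> closure_form \<Omega> \<kappa> \<theta>"
abbreviation "apx \<equiv> approximates \<Omega> \<kappa> \<theta>"

lemma approximates_iff:
  "apx us u \<longleftrightarrow> (\<forall>n. us n \<in> P) \<and> (\<lambda>n. L2_dist \<Omega> (us n) u) \<longlonglongrightarrow> 0 \<and> F.cauchy us"
  by (simp add: approximates_def F.cauchy_def)

lemma approximatesD:
  assumes "apx us u"
  shows "us n \<in> P" "us n \<in> L2_space \<Omega>" "(\<lambda>n. L2_dist \<Omega> (us n) u) \<longlonglongrightarrow> 0" "F.cauchy us"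
  using assms form_domainD(3) by (auto simp: approximates_iff)

lemma closure_domainE:
  assumes "u \<in> D" obtains us where "u \<in> L2_space \<Omega>" "apx us u"
  using assms by (auto simp: closure_domain_def)

lemma closure_domainI: "u \<in> L2_space \<Omega> \<Longrightarrow> apx us u \<Longrightarrow> u \<in> D"
  by (auto simp: closure_domain_def)

lemma closure_domain_L2: "u \<in> D \<Longrightarrow> u \<in> L2_space \<Omega>"
  by (simp add: closure_domain_def)

lemma approximates_add_cmult:
  assumes "apx us u" "apx vs v" "u \<in> L2_space \<Omega>" "v \<in> L2_space \<Omega>"
  shows "apx (\<lambda>n x. us n x + c * vs n x) (\<lambda>x. u x + c * v x)"
proof -
  note u = approximatesD[OF assms(1)] and v = approximatesD[OF assms(2)]
  have "(\<lambda>n. L2_dist \<Omega> (us n) u + \<bar>c\<bar> * L2_dist \<Omega> (vs n) v) \<longlonglongrightarrow> 0 + \<bar>c\<bar> * 0"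
    by (intro tendsto_intros u(3) v(3))
  then have lim: "(\<lambda>n. L2_dist \<Omega> (us n) u + \<bar>c\<bar> * L2_dist \<Omega> (vs n) v) \<longlonglongrightarrow> 0" by simp
  have "L2_dist \<Omega> (\<lambda>x. us n x + c * vs n x) (\<lambda>x. u x + c * v x)
      \<le> L2_dist \<Omega> (us n) u + \<bar>c\<bar> * L2_dist \<Omega> (vs n) v" for n
  proof -
    note d = L2.diff[OF u(2)[of n] assms(3)] L2.diff[OF v(2)[of n] assms(4)]
    have "(\<lambda>x. (us n x + c * vs n x) - (u x + c * v x)) = (\<lambda>x. (us n x - u x) + c * (vs n x - v x))"
      by (auto simp: algebra_simps)
    then show ?thesis
      using L2.nrm_triangle[OF d(1) L2.cmult[OF d(2), of c]] L2.nrm_cmult[OF d(2), of c]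
      by (simp add: L2_dist_nrm)
  qed
  then have "(\<lambda>n. L2_dist \<Omega> (\<lambda>x. us n x + c * vs n x) (\<lambda>x. u x + c * v x)) \<longlonglongrightarrow> 0"
    by (intro Lim_null_comparison[OF always_eventually lim]) (simp add: L2_dist_nonneg)
  then show ?thesis
    unfolding approximates_iff using u v by (auto intro: form_domain_add_cmult F.cauchy_add_cmult)
qed

lemma approximates_diff:
  assumes "apx us u" "apx vs u" "u \<in> L2_space \<Omega>"
  shows "apx (\<lambda>n x. us n x - vs n x) (\<lambda>_. 0)"
  using approximates_add_cmult[OF assms(1,2,3,3), of "-1"] by simp

lemma closure_domain_add_cmult:
  assumes "u \<in> D" "v \<in> D" shows "(\<lambda>x. u x + c * v x) \<in> D"
  using assms by (elim closure_domainE) (blast intro: closure_domainI approximates_add_cmult L2_add_cmult)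

lemma approximates_const:
  assumes "u \<in> P" shows "apx (\<lambda>_. u) u"
  using assms F.zero_left[OF F.zero]
  by (simp add: approximates_iff F.cauchy_def L2_dist_def L2_norm_def L2_inner_def)

lemma form_domain_subset_closure: "P \<subseteq> D"
  using approximates_const closure_domainI form_domainD(3) by blast

text \<open>Both sides of the dual inequality converge along the approximation. In this way the
  closed form controls derivatives without a gradient of u being chosen.\<close>

lemma approximates_weak_deriv_bound:
  assumes "apx us u" "u \<in> L2_space \<Omega>" "(\<lambda>n. E (us n) (us n)) \<longlonglongrightarrow> e"
  shows "weak_deriv_bound \<Omega> u y (norm y * sqrt e)"
  unfolding weak_deriv_bound_def
proof
  fix \<phi> assume \<phi>: "\<phi> \<in> test_functions \<Omega>"
  note d = approximatesD[OF assms(1)]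
  have "(\<lambda>n. \<bar>L2_inner \<Omega> (us n) (dderiv \<phi> y)\<bar>) \<longlonglongrightarrow> \<bar>L2_inner \<Omega> u (dderiv \<phi> y)\<bar>"
    by (intro tendsto_rabs L2_inner_tendsto d(2,3) assms(2) test_function_L2(2)[OF bounded_\<Omega> sets_\<Omega> \<phi>])
  moreover have "(\<lambda>n. norm y * sqrt (E (us n) (us n)) * L2_norm \<Omega> \<phi>) \<longlonglongrightarrow> norm y * sqrt e * L2_norm \<Omega> \<phi>"
    by (intro tendsto_intros assms(3))
  ultimately show "\<bar>L2_inner \<Omega> u (dderiv \<phi> y)\<bar> \<le> norm y * sqrt e * L2_norm \<Omega> \<phi>"
    by (rule LIMSEQ_le) (use weak_deriv_boundD[OF form_domain_weak_deriv_bound[OF d(1)] \<phi>] in blast)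
qed

lemma approximates_form_convergent:
  assumes "apx us u" "apx vs v" shows "convergent (\<lambda>n. E (us n) (vs n))"
  using approximatesD[OF assms(1)] approximatesD[OF assms(2)] by (intro F.cauchy_inner_convergent)

text \<open>Stated without closability, because it is applied to the limit form while closability of
  the approximating forms is still being proved.\<close>

lemma closure_domain_weak_deriv_bound:
  assumes "u \<in> D" obtains C where "0 \<le> C" "\<And>y. weak_deriv_bound \<Omega> u y (norm y * C)"
proof -
  obtain us where us: "u \<in> L2_space \<Omega>" "apx us u" using assms by (rule closure_domainE)
  obtain e where e: "(\<lambda>n. E (us n) (us n)) \<longlonglongrightarrow> e"
    using approximates_form_convergent[OF us(2,2)] by (auto simp: convergent_def)
  have "0 \<le> e" using e F.nonneg[OF approximatesD(1)[OF us(2)]] by (intro LIMSEQ_le_const) auto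
  then show thesis using that[of "sqrt e"] approximates_weak_deriv_bound[OF us(2,1) e] by simp
qed

text \<open>Closability in the usual sense, as \<open>apx ws (\<lambda>_. 0)\<close> bundles
  convergence to 0 in L^2 with the Cauchy property in the form.\<close>

definition closable :: bool where
  "closable \<longleftrightarrow> (\<forall>ws. apx ws (\<lambda>_. 0) \<longrightarrow> (\<lambda>n. E (ws n) (ws n)) \<longlonglongrightarrow> 0)"

text \<open>The difference of two approximations of one function approximates 0, so it is null in
  the form; the other factors stay bounded as Cauchy sequences.\<close>

lemma closable_limits_agree:
  assumes "closable" "apx us u" "apx us' u" "apx vs v" "apx vs' v" "u \<in> L2_space \<Omega>" "v \<in> L2_space \<Omega>"
  shows "(\<lambda>n. E (us n) (vs n) - E (us' n) (vs' n)) \<longlonglongrightarrow> 0"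
proof -
  note d = approximatesD[OF assms(2)] approximatesD[OF assms(3)] approximatesD[OF assms(4)] approximatesD[OF assms(5)]
  have nul: "(\<lambda>n. F.nrm (\<lambda>x. ws n x - ws' n x)) \<longlonglongrightarrow> 0"
    if "apx ws w" "apx ws' w" "w \<in> L2_space \<Omega>" for ws ws' w
    using tendsto_real_sqrt[OF assms(1)[unfolded closable_def, rule_format, OF approximates_diff[OF that]]]
    by (simp add: F.nrm_def)
  obtain K where K: "\<And>n. F.nrm (vs n) \<le> K" using F.cauchy_bounded[OF d(12,9)] by blast
  obtain L where L: "\<And>n. F.nrm (us' n) \<le> L" using F.cauchy_bounded[OF d(8,5)] by blast
  have "(\<lambda>n. E (\<lambda>x. us n x - us' n x) (vs n)) \<longlonglongrightarrow> 0"
    by (rule F.null_inner_tendsto[OF F.diff[OF d(1,5)] d(9) nul[OF assms(2,3,6)] K])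
  moreover have "(\<lambda>n. E (\<lambda>x. vs n x - vs' n x) (us' n)) \<longlonglongrightarrow> 0"
    by (rule F.null_inner_tendsto[OF F.diff[OF d(9,13)] d(5) nul[OF assms(4,5,7)] L])
  ultimately have "(\<lambda>n. E (\<lambda>x. us n x - us' n x) (vs n) + E (\<lambda>x. vs n x - vs' n x) (us' n)) \<longlonglongrightarrow> 0 + 0"
    by (rule tendsto_add)
  moreover have "E (\<lambda>x. us n x - us' n x) (vs n) + E (\<lambda>x. vs n x - vs' n x) (us' n)
      = E (us n) (vs n) - E (us' n) (vs' n)" for n
    using F.sym[OF d(9)[of n] d(5)[of n]] F.sym[OF d(13)[of n] d(5)[of n]]
    by (simp add: F.diff_left d(1,5,9,13))
  ultimately show ?thesis by simp
qed

lemma closure_form_tendsto: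
  assumes "closable" "apx us u" "apx vs v" "u \<in> L2_space \<Omega>" "v \<in> L2_space \<Omega>"
  shows "(\<lambda>n. E (us n) (vs n)) \<longlonglongrightarrow> cf u v"
proof -
  obtain r where r: "(\<lambda>n. E (us n) (vs n)) \<longlonglongrightarrow> r"
    using approximates_form_convergent[OF assms(2,3)] by (auto simp: convergent_def)
  have all: "(\<lambda>n. E (us' n) (vs' n)) \<longlonglongrightarrow> r" if "apx us' u" "apx vs' v" for us' vs'
    using tendsto_diff[OF r closable_limits_agree[OF assms(1,2) that(1) assms(3) that(2) assms(4,5)]] by simp
  have "cf u v = r"
    unfolding closure_form_def
  proof (rule the_equality)
    show "\<forall>us vs. apx us u \<and> apx vs v \<longrightarrow> (\<lambda>n. E (us n) (vs n)) \<longlonglongrightarrow> r" using all by blast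
    fix r' assume "\<forall>us vs. apx us u \<and> apx vs v \<longrightarrow> (\<lambda>n. E (us n) (vs n)) \<longlonglongrightarrow> r'"
    then have "(\<lambda>n. E (us n) (vs n)) \<longlonglongrightarrow> r'" using assms(2,3) by blast
    then show "r' = r" using r by (rule LIMSEQ_unique)
  qed
  then show ?thesis using r by simp
qed

lemma closure_form_semi_inner:
  assumes "closable" shows "semi_inner D cf"
proof
  show "(\<lambda>_. 0) \<in> D" using F.zero form_domain_subset_closure by blast
  fix u v :: "'a \<Rightarrow> real" assume u: "u \<in> D" and v: "v \<in> D"
  obtain us where us: "u \<in> L2_space \<Omega>" "apx us u" using u by (rule closure_domainE)
  obtain vs where vs: "v \<in> L2_space \<Omega>" "apx vs v" using v by (rule closure_domainE)
  note lim = closure_form_tendsto[OF assms]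
  show "(\<lambda>x. u x + c * v x) \<in> D" for c by (rule closure_domain_add_cmult[OF u v])
  show "0 \<le> cf u u"
    using lim[OF us(2,2,1,1)] F.nonneg[OF approximatesD(1)[OF us(2)]] by (intro LIMSEQ_le_const) auto
  show "cf u v = cf v u"
    using lim[OF us(2) vs(2) us(1) vs(1)] lim[OF vs(2) us(2) vs(1) us(1)]
      F.sym[OF approximatesD(1)[OF us(2)] approximatesD(1)[OF vs(2)]] by (simp add: LIMSEQ_unique)
  fix w :: "'a \<Rightarrow> real" and c :: real assume w: "w \<in> D"
  obtain ws where ws: "w \<in> L2_space \<Omega>" "apx ws w" using w by (rule closure_domainE)
  have "(\<lambda>n. E (\<lambda>x. us n x + c * vs n x) (ws n)) \<longlonglongrightarrow> cf (\<lambda>x. u x + c * v x) w"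
    by (rule lim[OF approximates_add_cmult[OF us(2) vs(2) us(1) vs(1)] ws(2) L2_add_cmult[OF us(1) vs(1)] ws(1)])
  moreover have "(\<lambda>n. E (us n) (ws n) + c * E (vs n) (ws n)) \<longlonglongrightarrow> cf u w + c * cf v w"
    by (intro tendsto_intros lim us vs ws)
  moreover have "E (\<lambda>x. us n x + c * vs n x) (ws n) = E (us n) (ws n) + c * E (vs n) (ws n)" for n
    by (rule F.lin[OF approximatesD(1)[OF us(2)] approximatesD(1)[OF vs(2)] approximatesD(1)[OF ws(2)]])
  ultimately show "cf (\<lambda>x. u x + c * v x) w = cf u w + c * cf v w"
    by (simp add: LIMSEQ_unique)
qed

text \<open>
  If the form is not closable, then no number has the property in the definition of the closed form at
  \<open>(u, u)\<close>, whose value is then an unspecified constant.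
\<close>

lemma closure_form_not_closable:
  assumes "\<not> closable" "u \<in> D"
  shows "cf u u = (THE r. False)"
proof -
  obtain us where us: "u \<in> L2_space \<Omega>" "apx us u" using assms(2) by (rule closure_domainE)
  obtain ws where ws: "apx ws (\<lambda>_. 0)" "\<not> (\<lambda>n. E (ws n) (ws n)) \<longlonglongrightarrow> 0"
    using assms(1) by (auto simp: closable_def)
  note d = approximatesD(1)[OF us(2)] approximatesD(1)[OF ws(1)]
  have nolim: False if r: "\<forall>us vs. apx us u \<and> apx vs u \<longrightarrow> (\<lambda>n. E (us n) (vs n)) \<longlonglongrightarrow> r" for r
  proof -
    \<comment> \<open>Adding c times the bad sequence leaves an approximation of u. If all energies
      had the limit r, the second difference over c = 1, -1, 0 would force the energies of
      \<open>ws\<close> to 0.\<close>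
    let ?v = "\<lambda>c n x. us n x + c * ws n x"
    have "apx (?v c) u" for c
      using approximates_add_cmult[OF us(2) ws(1) us(1) L2.zero, of c] by simp
    then have lim: "(\<lambda>n. E (?v c n) (?v c n)) \<longlonglongrightarrow> r" for c using r by blast
    have "(\<lambda>n. (E (?v 1 n) (?v 1 n) + E (?v (-1) n) (?v (-1) n) - 2 * E (?v 0 n) (?v 0 n)) / 2)
        \<longlonglongrightarrow> (r + r - 2 * r) / 2"
      by (intro tendsto_intros lim) simp
    moreover have "(E (?v 1 n) (?v 1 n) + E (?v (-1) n) (?v (-1) n) - 2 * E (?v 0 n) (?v 0 n)) / 2 = E (ws n) (ws n)" for n
      unfolding F.quad[OF d] by simp
    ultimately show False using ws(2) by simp
  qed
  \<comment> \<open>The describing predicate is constantly false, so the description is the same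
    term for every u.\<close>
  have "(\<lambda>r. \<forall>us vs. apx us u \<and> apx vs u \<longrightarrow> (\<lambda>n. E (us n) (vs n)) \<longlonglongrightarrow> r) = (\<lambda>r. False)"
    by (rule ext, rule iffI, erule nolim, erule FalseE)
  then show ?thesis unfolding closure_form_def by (simp only:)
qed

lemma closable_weak_deriv_bound:
  assumes "closable" "u \<in> D" shows "weak_deriv_bound \<Omega> u y (norm y * sqrt (cf u u))"
proof -
  obtain us where us: "u \<in> L2_space \<Omega>" "apx us u" using assms(2) by (rule closure_domainE)
  show ?thesis
    by (rule approximates_weak_deriv_bound[OF us(2,1) closure_form_tendsto[OF assms(1) us(2,2,1,1)]])
qed

text \<open>
  A minimizing sequence of \<open>E v v + \<mu> \<parallel>v\<parallel>\<^sup>2 - 2 (f, v)\<close> stays minimizing under any contraction \<open>T\<close> that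
  does not increase the distance to \<open>f / \<mu>\<close>; truncating at the bound of \<open>f / \<mu>\<close> yields bounded solutions.
\<close>

lemma resolvent_sequence:
  assumes \<mu>: "0 < \<mu>" and f: "f \<in> L2_space \<Omega>"
    and T: "\<And>a b. \<bar>T a - T b\<bar> \<le> \<bar>a - b\<bar>" "T 0 = 0" "\<And>a. T (T a) = T a"
    and Tf: "\<And>x a. \<bar>T a - f x / \<mu>\<bar> \<le> \<bar>a - f x / \<mu>\<bar>"
  obtains us u where "apx us u" "u \<in> L2_space \<Omega>" "\<And>x. T (u x) = u x"
    "\<And>vs v. apx vs v \<Longrightarrow> v \<in> L2_space \<Omega> \<Longrightarrow>
      (\<lambda>n. E (us n) (vs n) + \<mu> * L2_inner \<Omega> (us n) (vs n) - L2_inner \<Omega> f (vs n)) \<longlonglongrightarrow> 0"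
proof -
  let ?Q = "\<lambda>u v. E u v + \<mu> * L2_inner \<Omega> u v"
  have PL: "P \<subseteq> L2_space \<Omega>" using form_domainD(3) by blast
  have PI: "semi_inner P (L2_inner \<Omega>)"
    by (rule semi_inner_subspace[OF L2.semi_inner_axioms PL F.zero F.add_cmult])
  interpret Q: semi_inner P ?Q
    by (rule semi_inner_sum[OF F.semi_inner_axioms PI]) (use \<mu> in simp)
  have EQ: "E v v \<le> ?Q v v" and LQ: "\<mu> * (L2_norm \<Omega> v)\<^sup>2 \<le> ?Q v v" if "v \<in> P" for v
  proof -
    have "L2_inner \<Omega> v v = (L2_norm \<Omega> v)\<^sup>2"
      using L2.nrm_sq[OF form_domainD(3)[OF that]] by (simp add: L2_nrm_eq)
    then show "E v v \<le> ?Q v v" "\<mu> * (L2_norm \<Omega> v)\<^sup>2 \<le> ?Q v v" using F.nonneg[OF that] \<mu> by simp_all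
  qed
  let ?l = "L2_inner \<Omega> f"
  have l_lin: "?l (\<lambda>x. u x + c * v x) = ?l u + c * ?l v" if "u \<in> P" "v \<in> P" for u v c
    using that by (intro L2.lin_right form_domainD(3) f)
  have LQ': "L2_norm \<Omega> v \<le> Q.nrm v / sqrt \<mu>" if "v \<in> P" for v
  proof -
    have "sqrt (\<mu> * (L2_norm \<Omega> v)\<^sup>2) \<le> Q.nrm v"
      unfolding Q.nrm_def using LQ[OF that] by (rule real_sqrt_le_mono)
    then show ?thesis using \<mu> L2_norm_nonneg[of \<Omega> v] by (simp add: real_sqrt_mult field_simps)
  qed
  have l_bound: "\<bar>?l v\<bar> \<le> (L2_norm \<Omega> f / sqrt \<mu>) * Q.nrm v" if "v \<in> P" for v
    using L2_Cauchy_Schwarz[OF f form_domainD(3)[OF that]]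
      mult_left_mono[OF LQ'[OF that] L2_norm_nonneg[of \<Omega> f]] by simp
  note m = l_lin l_bound
  let ?m = "Q.minimum ?l"
  let ?\<Phi> = "\<lambda>v. ?Q v v - 2 * ?l v"
  obtain ws where ws: "\<And>n. ws n \<in> P" "(\<lambda>n. ?\<Phi> (ws n)) \<longlonglongrightarrow> ?m"
    using Q.minimizing_sequence_exists[OF m] by blast
  define us where "us n x = T (ws n x)" for n x
  have usP: "us n \<in> P" for n
    unfolding us_def by (rule form_domain_contraction(1)[OF ws(1) T(1,2)])
  have usL: "us n \<in> L2_space \<Omega>" for n using form_domainD(3)[OF usP] .
  have le: "?\<Phi> (us n) \<le> ?\<Phi> (ws n)" for n
  proof -
    have wL: "ws n \<in> L2_space \<Omega>" using form_domainD(3)[OF ws(1)] .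
    have eq: "\<mu> * L2_inner \<Omega> v v - 2 * ?l v = (LINT x|lebesgue_on \<Omega>. \<mu> * (v x * v x) - 2 * (f x * v x))"
      if "v \<in> L2_space \<Omega>" for v
      using L2_mult_integrable[OF that that] L2_mult_integrable[OF f that] by (simp add: L2_inner_def)
    have "\<mu> * L2_inner \<Omega> (us n) (us n) - 2 * ?l (us n) \<le> \<mu> * L2_inner \<Omega> (ws n) (ws n) - 2 * ?l (ws n)"
      unfolding eq[OF usL] eq[OF wL]
    proof (rule integral_mono)
      fix x
      \<comment> \<open>Completing the square: up to a term free of a, the integrand is \<mu> times
        the squared distance to f / \<mu>, which T does not increase.\<close>
      have *: "\<mu> * (a * a) - 2 * (f x * a) = \<mu> * (a - f x / \<mu>)\<^sup>2 - (f x)\<^sup>2 / \<mu>" for a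
        using \<mu> by (simp add: power2_eq_square field_simps)
      have "(us n x - f x / \<mu>)\<^sup>2 \<le> (ws n x - f x / \<mu>)\<^sup>2"
        unfolding us_def using Tf by (simp flip: abs_le_square_iff)
      then show "\<mu> * (us n x * us n x) - 2 * (f x * us n x) \<le> \<mu> * (ws n x * ws n x) - 2 * (f x * ws n x)"
        unfolding * using \<mu> by simp
    qed (use L2_mult_integrable[OF usL usL] L2_mult_integrable[OF f usL] L2_mult_integrable[OF wL wL]
        L2_mult_integrable[OF f wL] in auto)
    moreover have "E (us n) (us n) \<le> E (ws n) (ws n)"
      unfolding us_def by (rule form_domain_contraction(2)[OF ws(1) T(1,2)])
    ultimately show ?thesis by linarith
  qed
  have ge: "?m \<le> ?\<Phi> (us n)" for n by (rule Q.minimum_le[OF m usP])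
  have min: "(\<lambda>n. ?\<Phi> (us n)) \<longlonglongrightarrow> ?m"
    by (rule tendsto_sandwich[OF _ _ tendsto_const ws(2)]; rule always_eventually; rule allI; rule ge le)
  have Qc: "Q.cauchy us" by (rule Q.minimizing_cauchy[OF m usP min])
  have Fc: "F.cauchy us"
    unfolding F.cauchy_def
  proof (intro allI impI)
    fix e :: real assume "0 < e"
    then obtain M where "\<And>m n. m \<ge> M \<Longrightarrow> n \<ge> M \<Longrightarrow> ?Q (\<lambda>x. us m x - us n x) (\<lambda>x. us m x - us n x) < e"
      using Qc unfolding Q.cauchy_def by blast
    then show "\<exists>M. \<forall>m\<ge>M. \<forall>n\<ge>M. E (\<lambda>x. us m x - us n x) (\<lambda>x. us m x - us n x) < e"
      using EQ[OF F.diff[OF usP usP]] by (meson le_less_trans)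
  qed
  \<comment> \<open>The shift by \<mu> > 0 makes \<open>?Q\<close> dominate the L^2 norm.\<close>
  have "L2.cauchy \<Omega> us"
  proof (rule L2.cauchyI[OF usL])
    fix e :: real assume e: "0 < e"
    then have "0 < e * sqrt \<mu>" using \<mu> by simp
    then obtain M where M: "\<forall>m\<ge>M. \<forall>n\<ge>M. Q.nrm (\<lambda>x. us m x - us n x) < e * sqrt \<mu>"
      using Q.cauchyD[OF Qc usP] by blast
    have "L2.nrm \<Omega> (\<lambda>x. us m x - us n x) < e" if "m \<ge> M" "n \<ge> M" for m n
    proof -
      have "Q.nrm (\<lambda>x. us m x - us n x) / sqrt \<mu> < e"
        using M that \<mu> by (simp add: divide_less_eq)
      then show ?thesis using LQ'[OF F.diff[OF usP usP], of m n] by (simp add: L2_nrm_eq)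
    qed
    then show "\<exists>M. \<forall>m\<ge>M. \<forall>n\<ge>M. L2.nrm \<Omega> (\<lambda>x. us m x - us n x) < e" by blast
  qed
  then obtain h where h: "h \<in> L2_space \<Omega>" "(\<lambda>n. L2_dist \<Omega> (us n) h) \<longlonglongrightarrow> 0"
    using L2_complete[of us \<Omega>] usL by blast
  \<comment> \<open>T is applied again to the L^2 limit so that the fixed point property holds at
    every point; since T is nonexpansive and idempotent, u is still a limit of
    \<open>us\<close>.\<close>
  define u where "u x = T (h x)" for x
  have "continuous_on UNIV T"
    unfolding continuous_on_iff using T(1) by (auto simp: dist_real_def intro: le_less_trans)
  then have Tm: "T \<in> borel_measurable borel" by (rule borel_measurable_continuous_onI)
  have um: "u \<in> borel_measurable (lebesgue_on \<Omega>)"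
    unfolding u_def by (rule measurable_compose[OF L2_spaceD(1)[OF h(1)] Tm])
  have uL: "u \<in> L2_space \<Omega>"
    by (rule L2_norm_mono(1)[OF um h(1)]) (use T(1)[of _ 0] T(2) in \<open>simp add: u_def\<close>)
  have "L2_dist \<Omega> (us n) u \<le> L2_dist \<Omega> (us n) h" for n
  proof (rule L2_dist_mono[OF usL uL usL h(1)])
    have "\<bar>us n x - u x\<bar> \<le> \<bar>us n x - h x\<bar>" for x
      using T(1)[of "us n x" "h x"] T(3)[of "ws n x"] by (simp add: us_def u_def)
    then show "AE x in lebesgue_on \<Omega>. \<bar>us n x - u x\<bar> \<le> \<bar>us n x - h x\<bar>" by simp
  qed
  then have lim: "(\<lambda>n. L2_dist \<Omega> (us n) u) \<longlonglongrightarrow> 0"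
    by (intro Lim_null_comparison[OF always_eventually h(2)]) (simp add: L2_dist_nonneg)
  have apx: "apx us u" unfolding approximates_iff using usP lim Fc by blast
  show thesis
  proof (rule that[OF apx uL])
    show "T (u x) = u x" for x by (simp add: u_def T(3))
    fix vs v assume vs: "apx vs v" and v: "v \<in> L2_space \<Omega>"
    note vd = approximatesD[OF vs]
    let ?e = "\<lambda>n. sqrt (?\<Phi> (us n) - ?m)"
    have e0: "?e \<longlonglongrightarrow> 0"
      using tendsto_real_sqrt[OF tendsto_diff[OF min tendsto_const[of ?m]]]
      unfolding diff_self real_sqrt_zero .
    obtain c where "(\<lambda>n. E (vs n) (vs n)) \<longlonglongrightarrow> c"
      using approximates_form_convergent[OF vs vs] by (auto simp: convergent_def)
    moreover have "(\<lambda>n. L2_inner \<Omega> (vs n) (vs n)) \<longlonglongrightarrow> L2_inner \<Omega> v v"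
      by (rule L2_inner_tendsto2[OF vd(2) v vd(2) v vd(3) vd(3)])
    ultimately have "(\<lambda>n. ?Q (vs n) (vs n)) \<longlonglongrightarrow> c + \<mu> * L2_inner \<Omega> v v"
      by (intro tendsto_intros)
    then have "(\<lambda>n. Q.nrm (vs n)) \<longlonglongrightarrow> sqrt (c + \<mu> * L2_inner \<Omega> v v)"
      unfolding Q.nrm_def by (rule tendsto_real_sqrt)
    from tendsto_mult[OF e0 this] have z: "(\<lambda>n. ?e n * Q.nrm (vs n)) \<longlonglongrightarrow> 0" by simp
    show "(\<lambda>n. E (us n) (vs n) + \<mu> * L2_inner \<Omega> (us n) (vs n) - ?l (vs n)) \<longlonglongrightarrow> 0"
    proof (rule Lim_null_comparison[OF always_eventually z], rule allI)
      fix n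
      show "norm (E (us n) (vs n) + \<mu> * L2_inner \<Omega> (us n) (vs n) - ?l (vs n)) \<le> ?e n * Q.nrm (vs n)"
        using Q.minimizing_Euler_Lagrange[OF m usP vd(1)] unfolding real_norm_def .
    qed
  qed
qed

end

subsection \<open>Resolvents\<close>

context boundary_pair
begin

text \<open>The variational form of (\<mu> - \<Delta>) u = f; \<open>solves_resolvent_iff\<close>
  links it to the operator graph.\<close>

definition weak_solution :: "real \<Rightarrow> ('a \<Rightarrow> real) \<Rightarrow> ('a \<Rightarrow> real) \<Rightarrow> bool" where
  "weak_solution \<mu> f u \<longleftrightarrow>
     u \<in> D \<and> (\<forall>\<phi>\<in>D. cf u \<phi> + \<mu> * L2_inner \<Omega> u \<phi> = L2_inner \<Omega> f \<phi>)"

lemma weak_solution_L2: "weak_solution \<mu> f u \<Longrightarrow> u \<in> L2_space \<Omega>"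
  by (simp add: weak_solution_def closure_domain_L2)

text \<open>T is a parameter so that one proof serves twice: the identity gives existence for all f,
  and clipping gives bounded solutions for bounded f.\<close>

lemma weak_solution_exists_contraction:
  assumes "closable" "0 < \<mu>" "f \<in> L2_space \<Omega>"
    and "\<And>a b. \<bar>T a - T b\<bar> \<le> \<bar>a - b\<bar>" "T 0 = 0" "\<And>a. T (T a) = T a"
    and "\<And>x a. \<bar>T a - f x / \<mu>\<bar> \<le> \<bar>a - f x / \<mu>\<bar>"
  obtains u where "weak_solution \<mu> f u" "\<And>x. T (u x) = u x"
proof (rule resolvent_sequence[OF assms(2-7)])
  fix us u
  assume us: "apx us u" and u: "u \<in> L2_space \<Omega>" "\<And>x. T (u x) = u x"
    and EL: "\<And>vs v. apx vs v \<Longrightarrow> v \<in> L2_space \<Omega> \<Longrightarrow>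
      (\<lambda>n. E (us n) (vs n) + \<mu> * L2_inner \<Omega> (us n) (vs n) - L2_inner \<Omega> f (vs n)) \<longlonglongrightarrow> 0"
  note ud = approximatesD[OF us]
  have "cf u \<phi> + \<mu> * L2_inner \<Omega> u \<phi> = L2_inner \<Omega> f \<phi>" if \<phi>: "\<phi> \<in> D" for \<phi>
  proof -
    obtain vs where vs: "\<phi> \<in> L2_space \<Omega>" "apx vs \<phi>" using \<phi> by (rule closure_domainE)
    note vd = approximatesD[OF vs(2)]
    have "(\<lambda>n. L2_inner \<Omega> (vs n) f) \<longlonglongrightarrow> L2_inner \<Omega> \<phi> f"
      by (rule L2_inner_tendsto[OF vd(2) vs(1) assms(3) vd(3)])
    then have f: "(\<lambda>n. L2_inner \<Omega> f (vs n)) \<longlonglongrightarrow> L2_inner \<Omega> f \<phi>"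
      using L2.sym[OF vd(2) assms(3)] L2.sym[OF vs(1) assms(3)] by simp
    have "(\<lambda>n. E (us n) (vs n) + \<mu> * L2_inner \<Omega> (us n) (vs n) - L2_inner \<Omega> f (vs n))
       \<longlonglongrightarrow> cf u \<phi> + \<mu> * L2_inner \<Omega> u \<phi> - L2_inner \<Omega> f \<phi>"
      by (intro tendsto_intros closure_form_tendsto[OF assms(1) us vs(2) u(1) vs(1)] f
          L2_inner_tendsto2[OF ud(2) u(1) vd(2) vs(1) ud(3) vd(3)])
    from LIMSEQ_unique[OF this EL[OF vs(2,1)]] show ?thesis by simp
  qed
  then have "weak_solution \<mu> f u"
    using closure_domainI[OF u(1) us] by (simp add: weak_solution_def)
  then show thesis using that u(2) by blast
qed

lemma weak_solution_exists:
  assumes "closable" "0 < \<mu>" "f \<in> L2_space \<Omega>"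
  shows "\<exists>u. weak_solution \<mu> f u"
  using weak_solution_exists_contraction[OF assms, of "\<lambda>x. x"] by auto

text \<open>Clipping to [-M, M] never increases the distance to a point of that interval, such as
  f(x) / \<mu>. The bound M depends on f and \<mu> but not on the measures, so it is uniform along
  the sequence.\<close>

lemma weak_solution_exists_bounded:
  assumes "closable" "0 < \<mu>" "f \<in> L2_space \<Omega>" "\<And>x. \<bar>f x\<bar> \<le> \<mu> * M"
  shows "\<exists>u. weak_solution \<mu> f u \<and> (\<forall>x. \<bar>u x\<bar> \<le> M)"
proof -
  have "0 \<le> \<mu> * M" using assms(4)[of 0] by linarith
  then have M: "0 \<le> M" using assms(2) by (simp add: zero_le_mult_iff)
  have f: "\<bar>f x / \<mu>\<bar> \<le> M" for x using assms(4)[of x] assms(2) by (simp add: field_simps)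
  let ?T = "\<lambda>a. max (- M) (min M a)"
  obtain u where u: "weak_solution \<mu> f u" "\<And>x. ?T (u x) = u x"
  proof (rule weak_solution_exists_contraction[OF assms(1-3), of ?T])
    show "\<bar>?T a - f x / \<mu>\<bar> \<le> \<bar>a - f x / \<mu>\<bar>" for x a
    proof -
      have "\<bar>?T a - c\<bar> \<le> \<bar>a - c\<bar>" if "\<bar>c\<bar> \<le> M" for c :: real using that by linarith
      then show ?thesis using f by blast
    qed
  qed (use M in \<open>auto simp: max_def min_def\<close>)
  have "\<bar>u x\<bar> \<le> M" for x using u(2)[of x] M by (auto simp: max_def min_def abs_le_iff split: if_splits)
  then show ?thesis using u(1) by blast
qed

lemma solves_resolvent_iff:
  assumes "f \<in> L2_space \<Omega>"
  shows "solves_resolvent \<Omega> (laplacian \<Omega> \<kappa> \<theta>) \<mu> f u \<longleftrightarrow> weak_solution \<mu> f u"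
proof
  assume "solves_resolvent \<Omega> (laplacian \<Omega> \<kappa> \<theta>) \<mu> f u"
  then obtain v where v: "u \<in> D" "v \<in> L2_space \<Omega>" "\<forall>\<phi>\<in>D. cf u \<phi> = L2_inner \<Omega> v \<phi>"
    "AE x in lebesgue_on \<Omega>. \<mu> * u x - (- v x) = f x"
    by (auto simp: solves_resolvent_def laplacian_def)
  have u: "u \<in> L2_space \<Omega>" using v(1) by (rule closure_domain_L2)
  have "cf u \<phi> + \<mu> * L2_inner \<Omega> u \<phi> = L2_inner \<Omega> f \<phi>" if "\<phi> \<in> D" for \<phi>
  proof -
    have \<phi>: "\<phi> \<in> L2_space \<Omega>" using that by (rule closure_domain_L2)
    have "AE x in lebesgue_on \<Omega>. f x = v x + \<mu> * u x" using v(4) by eventually_elim simp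
    then have "L2_inner \<Omega> f \<phi> = L2_inner \<Omega> (\<lambda>x. v x + \<mu> * u x) \<phi>"
      by (rule L2_inner_cong_AE[OF _ _ assms L2_add_cmult[OF v(2) u] \<phi> \<phi>]) simp
    then show ?thesis using v(3) that by (simp add: L2.lin[OF v(2) u \<phi>])
  qed
  then show "weak_solution \<mu> f u" using v(1) by (simp add: weak_solution_def)
next
  assume u: "weak_solution \<mu> f u"
  \<comment> \<open>Read off from the equation: - \<Delta> u = f - \<mu> u.\<close>
  let ?v = "\<lambda>x. f x + (- \<mu>) * u x"
  note uL = weak_solution_L2[OF u]
  have v: "?v \<in> L2_space \<Omega>" by (rule L2_add_cmult[OF assms uL])
  have "cf u \<phi> = L2_inner \<Omega> ?v \<phi>" if "\<phi> \<in> D" for \<phi>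
  proof -
    have "cf u \<phi> + \<mu> * L2_inner \<Omega> u \<phi> = L2_inner \<Omega> f \<phi>" using u that by (simp add: weak_solution_def)
    then show ?thesis using L2.lin[OF assms uL closure_domain_L2[OF that], of "- \<mu>"] by linarith
  qed
  then have "(u, \<lambda>x. - ?v x) \<in> laplacian \<Omega> \<kappa> \<theta>"
    using u v unfolding laplacian_def weak_solution_def
    by (intro CollectI exI[of _ u] exI[of _ ?v] conjI refl) auto
  then show "solves_resolvent \<Omega> (laplacian \<Omega> \<kappa> \<theta>) \<mu> f u"
    unfolding solves_resolvent_def by (rule exI[of _ "\<lambda>x. - ?v x", OF conjI]) simp
qed

text \<open>Test the difference of the two equations with u - v and drop the nonnegative form. The
  estimate yields uniqueness, the bound 1 / \<mu> of the resolvent, and the density argument for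
  general f.\<close>

lemma weak_solution_dist:
  assumes "closable" "0 < \<mu>" "f \<in> L2_space \<Omega>" "g \<in> L2_space \<Omega>" "weak_solution \<mu> f u" "weak_solution \<mu> g v"
  shows "\<mu> * L2_dist \<Omega> u v \<le> L2_dist \<Omega> f g"
proof -
  interpret C: semi_inner D cf by (rule closure_form_semi_inner[OF assms(1)])
  have D: "u \<in> D" "v \<in> D" using assms(5,6) by (auto simp: weak_solution_def)
  let ?d = "\<lambda>x. u x - v x"
  have d: "?d \<in> D" by (rule C.diff[OF D])
  note L = closure_domain_L2[OF D(1)] closure_domain_L2[OF D(2)] closure_domain_L2[OF d]
  have "cf ?d ?d + \<mu> * L2_inner \<Omega> ?d ?d = L2_inner \<Omega> (\<lambda>x. f x - g x) ?d"
    using assms(5,6) d unfolding weak_solution_def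
    by (simp add: C.diff_left[OF D d] L2.diff_left[OF L] L2.diff_left[OF assms(3,4) L(3)] algebra_simps)
  then have "\<mu> * L2_inner \<Omega> ?d ?d \<le> L2_inner \<Omega> (\<lambda>x. f x - g x) ?d" using C.nonneg[OF d] by linarith
  also have "\<dots> \<le> L2_dist \<Omega> f g * L2_dist \<Omega> u v"
    using L2_Cauchy_Schwarz[OF L2.diff[OF assms(3,4)] L(3)] by (simp add: L2_dist_def)
  finally have le: "\<mu> * L2_dist \<Omega> u v * L2_dist \<Omega> u v \<le> L2_dist \<Omega> f g * L2_dist \<Omega> u v"
    using L2.nrm_sq[OF L(3)] by (simp add: L2_dist_def L2_nrm_eq power2_eq_square mult.assoc)
  show ?thesis
  proof (cases "L2_dist \<Omega> u v = 0")
    case False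
    then have "0 < L2_dist \<Omega> u v" using L2_dist_nonneg[of \<Omega> u v] by simp
    then show ?thesis using le by (rule mult_right_le_imp_le[rotated])
  qed (simp add: L2_dist_nonneg)
qed

lemma weak_solution_norm:
  assumes "closable" "0 < \<mu>" "f \<in> L2_space \<Omega>" "weak_solution \<mu> f u"
  shows "\<mu> * L2_norm \<Omega> u \<le> L2_norm \<Omega> f"
proof -
  interpret C: semi_inner D cf by (rule closure_form_semi_inner[OF assms(1)])
  have "weak_solution \<mu> (\<lambda>_. 0) (\<lambda>_. 0)"
    unfolding weak_solution_def using C.zero C.zero_left by (auto simp: L2_inner_def)
  from weak_solution_dist[OF assms(1-3) L2.zero assms(4) this] show ?thesis by (simp add: L2_dist_def)
qed

lemma weak_solution_form_le:
  assumes "closable" "0 < \<mu>" "f \<in> L2_space \<Omega>" "weak_solution \<mu> f u"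
  shows "cf u u \<le> (L2_norm \<Omega> f)\<^sup>2 / \<mu>"
proof -
  note uL = weak_solution_L2[OF assms(4)]
  have "cf u u \<le> L2_inner \<Omega> f u"
    using assms(2,4) L2.nonneg[OF uL] unfolding weak_solution_def by (smt (verit) mult_nonneg_nonneg)
  also have "\<dots> \<le> L2_norm \<Omega> f * L2_norm \<Omega> u" using L2_Cauchy_Schwarz[OF assms(3) uL] by simp
  also have "\<dots> \<le> L2_norm \<Omega> f * (L2_norm \<Omega> f / \<mu>)"
    using weak_solution_norm[OF assms] assms(2)
    by (intro mult_left_mono L2_norm_nonneg) (simp add: field_simps)
  finally show ?thesis by (simp add: power2_eq_square)
qed

text \<open>Expanding the quadratic functional around u leaves the form and \<mu> times the squared
  norm of v - u as excess. The second term is kept, so that a competitor of equal value is seen to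
  equal u in L^2.\<close>

lemma weak_solution_minimal:
  assumes "closable" "weak_solution \<mu> f u" "v \<in> D" "0 < \<mu>" "f \<in> L2_space \<Omega>"
  shows "cf u u + \<mu> * L2_inner \<Omega> u u - 2 * L2_inner \<Omega> f u + \<mu> * (L2_dist \<Omega> v u)\<^sup>2
    \<le> cf v v + \<mu> * L2_inner \<Omega> v v - 2 * L2_inner \<Omega> f v"
proof -
  interpret C: semi_inner D cf by (rule closure_form_semi_inner[OF assms(1)])
  have u: "u \<in> D" using assms(2) by (simp add: weak_solution_def)
  note L = closure_domain_L2[OF u] closure_domain_L2[OF assms(3)]
  let ?d = "\<lambda>x. v x - u x"
  have "0 \<le> cf ?d ?d" by (rule C.nonneg[OF C.diff[OF assms(3) u]])
  moreover have "cf ?d ?d = cf v v - 2 * cf u v + cf u u"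
    using C.quad_diff[OF assms(3) u] C.sym[OF assms(3) u] by simp
  moreover have "(L2_dist \<Omega> v u)\<^sup>2 = L2_inner \<Omega> v v - 2 * L2_inner \<Omega> u v + L2_inner \<Omega> u u"
    using L2.quad_diff[OF L(2,1)] L2.sym[OF L] L2.nrm_sq[OF L2.diff[OF L(2,1)]] by (simp add: L2_dist_nrm)
  then have "\<mu> * (L2_dist \<Omega> v u)\<^sup>2 = \<mu> * L2_inner \<Omega> v v - 2 * (\<mu> * L2_inner \<Omega> u v) + \<mu> * L2_inner \<Omega> u u"
    by (simp add: right_diff_distrib distrib_left)
  moreover have "cf u v + \<mu> * L2_inner \<Omega> u v = L2_inner \<Omega> f v" "cf u u + \<mu> * L2_inner \<Omega> u u = L2_inner \<Omega> f u"
    using assms(2,3) u by (auto simp: weak_solution_def)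
  ultimately show ?thesis by linarith
qed

lemma in_resolvent_set_laplacian:
  assumes "closable" "0 < \<mu>"
  shows "in_resolvent_set \<Omega> (laplacian \<Omega> \<kappa> \<theta>) \<mu>"
  unfolding in_resolvent_set_def
proof (intro conjI ballI allI impI)
  fix f assume f: "f \<in> L2_space \<Omega>"
  show "\<exists>u. solves_resolvent \<Omega> (laplacian \<Omega> \<kappa> \<theta>) \<mu> f u"
    using weak_solution_exists[OF assms f] solves_resolvent_iff[OF f] by blast
  fix u u' assume "solves_resolvent \<Omega> (laplacian \<Omega> \<kappa> \<theta>) \<mu> f u \<and> solves_resolvent \<Omega> (laplacian \<Omega> \<kappa> \<theta>) \<mu> f u'"
  then have w: "weak_solution \<mu> f u" "weak_solution \<mu> f u'" using solves_resolvent_iff[OF f] by auto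
  have "\<mu> * L2_dist \<Omega> u u' \<le> L2_dist \<Omega> f f" by (rule weak_solution_dist[OF assms f f w])
  also have "L2_dist \<Omega> f f = 0" by (simp add: L2_dist_eq_0_iff[OF f f])
  finally have "L2_dist \<Omega> u u' = 0"
    using assms(2) L2_dist_nonneg[of \<Omega> u u'] by (simp add: mult_le_0_iff)
  then show "AE x in lebesgue_on \<Omega>. u x = u' x"
    using L2_dist_eq_0_iff[OF w[THEN weak_solution_L2]] by blast
next
  have "L2_norm \<Omega> u \<le> (1 / \<mu>) * L2_norm \<Omega> f"
    if "f \<in> L2_space \<Omega>" "solves_resolvent \<Omega> (laplacian \<Omega> \<kappa> \<theta>) \<mu> f u" for f u
    using weak_solution_norm[OF assms that(1)] that solves_resolvent_iff[OF that(1)] assms(2)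
    by (simp add: field_simps)
  then show "\<exists>C. \<forall>f\<in>L2_space \<Omega>. \<forall>u. solves_resolvent \<Omega> (laplacian \<Omega> \<kappa> \<theta>) \<mu> f u \<longrightarrow>
      L2_norm \<Omega> u \<le> C * L2_norm \<Omega> f" by blast
qed

lemma resolvent_weak_solution:
  assumes "closable" "0 < \<mu>" "f \<in> L2_space \<Omega>"
  shows "weak_solution \<mu> f (resolvent \<Omega> (laplacian \<Omega> \<kappa> \<theta>) \<mu> f)"
  unfolding resolvent_def solves_resolvent_iff[OF assms(3)]
  using weak_solution_exists[OF assms] by (rule someI_ex)

end

subsection \<open>Closability of the limit\<close>

text \<open>The indicator jumps across a face: shifting by t b changes it on a slab of measure t A,
  so the squared norm of the difference is at least t A, whereas a weak derivative would allow only
  (t C)^2. Thus u lies in no closure domain, although functions common to all form domains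
  approximate it.\<close>

lemma box_indicator_no_weak_derivative:
  fixes \<Omega> :: "'a::euclidean_space set"
  assumes \<Omega>: "open \<Omega>" "bounded \<Omega>" "\<Omega> \<noteq> {}"
  obtains u :: "'a \<Rightarrow> real" and y :: 'a and \<phi>s where "u \<in> L2_space \<Omega>" "\<And>n. \<phi>s n \<in> test_functions \<Omega>"
    "(\<lambda>n. L2_dist \<Omega> (\<phi>s n) u) \<longlonglongrightarrow> 0" "\<And>C. 0 \<le> C \<Longrightarrow> \<not> weak_deriv_bound \<Omega> u y C"
proof -
  have \<Omega>s: "\<Omega> \<in> sets lebesgue" using \<Omega>(1) by auto
  obtain z where "z \<in> \<Omega>" using \<Omega>(3) by blast
  then obtain p q where pq: "z \<in> box p q" "cbox p q \<subseteq> \<Omega>"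
    using open_contains_cbox[of \<Omega> z] \<Omega>(1) by metis
  let ?u = "indicator (box p q) :: 'a \<Rightarrow> real"
  let ?\<phi> = "\<lambda>n. bump (real (Suc n)) p q"
  have m: "?u \<in> borel_measurable borel" by (simp add: borel_measurable_indicator)
  have \<phi>m: "?\<phi> n \<in> borel_measurable borel" for n
    by (intro borel_measurable_continuous_onI Ck_imp_continuous[OF Ck_bump])
  have "\<bar>?\<phi> n x\<bar> \<le> 1" for n x using bump_bounds[of "real (Suc n)" p q x] by simp
  note conv = bounded_pointwise_convergence_L2[OF \<Omega>(2) \<Omega>s \<phi>m this bump_tendsto m]
  obtain b :: 'a where b: "b \<in> Basis" using nonempty_Basis by blast
  have lt: "p \<bullet> i < q \<bullet> i" if "i \<in> Basis" for i
    using pq(1) that by (force simp: mem_box)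
  define A where "A = (\<Prod>i\<in>Basis - {b}. (q - p) \<bullet> i)"
  have A: "0 < A" unfolding A_def by (intro prod_pos) (auto simp: lt inner_diff_left)
  have False if C: "0 \<le> C" and wb: "weak_deriv_bound \<Omega> ?u b C" for C
  proof -
    obtain \<omega> e where \<omega>: "open \<omega>" "cbox p q \<subseteq> \<omega>" "\<omega> \<subseteq> \<Omega>" "0 < e" "\<And>z. norm z \<le> e \<Longrightarrow> (\<lambda>x. x + z) ` \<omega> \<subseteq> \<Omega>"
      using compact_open_thickening[OF compact_cbox pq(2) \<Omega>(1)] by blast
    \<comment> \<open>Small enough to stay in \<Omega>, to keep the slab inside the box, and to
      violate t A \<le> (t C)^2.\<close>
    define t where "t = min (min e (q \<bullet> b - p \<bullet> b)) (A / (2 * (C\<^sup>2 + 1)))"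
    have C1: "0 < C\<^sup>2 + 1" by (simp add: add_nonneg_pos)
    have t: "0 < t" "t \<le> e" "t \<le> q \<bullet> b - p \<bullet> b" "t * C\<^sup>2 < A"
    proof -
      show "0 < t" "t \<le> e" "t \<le> q \<bullet> b - p \<bullet> b" using \<omega>(4) lt[OF b] A C1 by (auto simp: t_def)
      have "t * C\<^sup>2 \<le> t * (C\<^sup>2 + 1)" using \<open>0 < t\<close> by simp
      also have "\<dots> \<le> A / (2 * (C\<^sup>2 + 1)) * (C\<^sup>2 + 1)" using C1 by (intro mult_right_mono) (auto simp: t_def)
      also have "\<dots> = A / 2"
      proof -
        have "A / (2 * r) * r = A / 2" if "0 < r" for r using that by simp
        from this[OF C1] show ?thesis .
      qed
      finally show "t * C\<^sup>2 < A" using A by linarith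
    qed
    have "0 \<le> \<bar>t\<bar> * C" using C by simp
    have sub: "(\<lambda>x. x + s *\<^sub>R (t *\<^sub>R b)) ` \<omega> \<subseteq> \<Omega>" if "0 \<le> s" "s \<le> 1" for s
    proof (rule \<omega>(5))
      have "s * t \<le> 1 * t" using that t(1) by (intro mult_right_mono) auto
      then have "s * t \<le> e" using t(2) by linarith
      then show "norm (s *\<^sub>R (t *\<^sub>R b)) \<le> e" using that t b by simp
    qed
    note tb = translation_bound[OF \<Omega>(1,2) conv(2) weak_deriv_bound_scaleR[OF wb, of t] \<open>0 \<le> \<bar>t\<bar> * C\<close> \<omega>(1) sub]
    \<comment> \<open>The lower corner of the slab of thickness t below the upper face in direction
      b.\<close>
    let ?p = "p + (q \<bullet> b - p \<bullet> b - t) *\<^sub>R b"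
    let ?w = "\<lambda>x. ?u (x + t *\<^sub>R b) - ?u x"
    let ?S = "box ?p q"
    have pb: "?p \<bullet> b = q \<bullet> b - t" and pi: "i \<in> Basis \<Longrightarrow> i \<noteq> b \<Longrightarrow> ?p \<bullet> i = p \<bullet> i" for i
      using b by (auto simp: inner_add_left inner_Basis)
    have w1: "(?w x)\<^sup>2 = 1" if "x \<in> ?S" for x
    proof -
      have x: "?p \<bullet> i < x \<bullet> i" "x \<bullet> i < q \<bullet> i" if "i \<in> Basis" for i
        using \<open>x \<in> ?S\<close> that by (auto simp: mem_box)
      have "x \<in> box p q"
        unfolding mem_box
      proof (intro ballI conjI)
        fix i :: 'a assume i: "i \<in> Basis"
        show "p \<bullet> i < x \<bullet> i" using x(1)[OF i] pb pi[OF i] t(3) by (cases "i = b") auto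
        show "x \<bullet> i < q \<bullet> i" by (rule x(2)[OF i])
      qed
      moreover have "x + t *\<^sub>R b \<notin> box p q"
      proof
        assume "x + t *\<^sub>R b \<in> box p q"
        then have "(x + t *\<^sub>R b) \<bullet> b < q \<bullet> b" using b by (auto simp: mem_box)
        then show False using x(1)[OF b] pb b by (simp add: inner_add_left)
      qed
      ultimately show ?thesis by simp
    qed
    have S\<omega>: "?S \<subseteq> \<omega>"
    proof -
      have "?S \<subseteq> cbox p q"
      proof
        fix x assume x: "x \<in> ?S"
        show "x \<in> cbox p q"
          unfolding mem_box
        proof (intro ballI conjI)
          fix i :: 'a assume i: "i \<in> Basis"
          have "?p \<bullet> i < x \<bullet> i" "x \<bullet> i < q \<bullet> i" using x i by (auto simp: mem_box)
          then show "p \<bullet> i \<le> x \<bullet> i" "x \<bullet> i \<le> q \<bullet> i" using pb pi[OF i] t(3) by (cases "i = b"; auto)+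
        qed
      qed
      then show ?thesis using \<omega>(2) by blast
    qed
    have \<omega>s: "\<omega> \<in> sets lebesgue" using \<omega>(1) by auto
    have Ss: "?S \<in> sets lebesgue" by (rule fmeasurableD[OF lmeasurable_box])
    have "t * A = measure lebesgue ?S"
    proof -
      have "measure lebesgue ?S = (\<Prod>i\<in>Basis. (q - ?p) \<bullet> i)"
      proof -
        have "?p \<bullet> i \<le> q \<bullet> i" if "i \<in> Basis" for i
          using pb pi[OF that] lt[OF that] t(1) by (cases "i = b") auto
        then show ?thesis by (simp add: measure_lborel_box_eq)
      qed
      also have "\<dots> = ((q - ?p) \<bullet> b) * (\<Prod>i\<in>Basis - {b}. (q - ?p) \<bullet> i)"
        by (rule prod.remove[OF finite_Basis b])
      also have "(\<Prod>i\<in>Basis - {b}. (q - ?p) \<bullet> i) = A"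
        unfolding A_def by (intro prod.cong refl) (auto simp: inner_diff_left pi)
      also have "(q - ?p) \<bullet> b = t" using pb by (simp add: inner_diff_left)
      finally show ?thesis by simp
    qed
    also have "measure lebesgue ?S = (LINT x|lebesgue_on ?S. (1::real))"
      by (simp add: measure_restrict_space Ss)
    also have "\<dots> = (LINT x|lebesgue_on ?S. (?w x)\<^sup>2)"
      by (rule Bochner_Integration.integral_cong[OF refl]) (use w1 in \<open>auto simp: space_restrict_space\<close>)
    also have "\<dots> = (L2_norm ?S ?w)\<^sup>2" by (rule L2_norm_sq[symmetric])
    also have "\<dots> \<le> (L2_norm \<omega> ?w)\<^sup>2"
      using L2_norm_split[OF tb(1) \<omega>s Ss S\<omega>] by simp
    also have "\<dots> \<le> (\<bar>t\<bar> * C)\<^sup>2" by (rule power_mono[OF tb(2) L2_norm_nonneg])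
    also have "\<dots> = t * (t * C\<^sup>2)" by (simp add: power_mult_distrib power2_eq_square)
    finally have "A \<le> t * C\<^sup>2" using t(1) by simp
    then show False using t(4) by simp
  qed
  moreover have "?\<phi> n \<in> test_functions \<Omega>" for n by (rule bump_test_function[OF _ pq(2)]) simp
  ultimately show thesis using that[of ?u ?\<phi> b] conv(2,3) by blast
qed

lemma liminf_le_of_frequently:
  fixes c :: ereal
  assumes "\<exists>\<^sub>F n in sequentially. a n \<le> c" shows "liminf a \<le> c"
proof (rule ccontr)
  assume "\<not> liminf a \<le> c"
  then have "\<forall>\<^sub>F n in sequentially. c < a n" by (intro less_LiminfD) simp
  then show False using assms by (simp add: frequently_def not_le)
qed

lemma L2_truncation_tendsto:
  assumes "f \<in> L2_space \<Omega>"
  shows "(\<lambda>x. max (- real n) (min (real n) (f x))) \<in> L2_space \<Omega>"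
    and "(\<lambda>n. L2_dist \<Omega> f (\<lambda>x. max (- real n) (min (real n) (f x)))) \<longlonglongrightarrow> 0"
proof -
  let ?f = "\<lambda>n x. max (- real n) (min (real n) (f x))"
  note [measurable] = L2_spaceD(1)[OF assms]
  have le: "\<bar>?f n x\<bar> \<le> \<bar>f x\<bar>" for n x by linarith
  show fL: "?f n \<in> L2_space \<Omega>" for n
    by (rule L2_norm_mono(1)[OF _ assms]) (use le in auto)
  have "(\<lambda>n. LINT x|lebesgue_on \<Omega>. (f x - ?f n x)\<^sup>2) \<longlonglongrightarrow> (LINT x|lebesgue_on \<Omega>. 0)"
  proof (rule integral_dominated_convergence[where w="\<lambda>x. (f x)\<^sup>2"])
    show "integrable (lebesgue_on \<Omega>) (\<lambda>x. (f x)\<^sup>2)" by (rule L2_spaceD(2)[OF assms])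
    show "AE x in lebesgue_on \<Omega>. (\<lambda>n. (f x - ?f n x)\<^sup>2) \<longlonglongrightarrow> 0"
    proof (intro always_eventually allI)
      fix x
      obtain N :: nat where N: "\<bar>f x\<bar> \<le> real N" using real_arch_simple by blast
      have "(f x - ?f n x)\<^sup>2 = 0" if "n \<ge> N" for n
      proof -
        have "real N \<le> real n" using that by simp
        then have "?f n x = f x" using N by linarith
        then show ?thesis by simp
      qed
      then have "\<forall>\<^sub>F n in sequentially. (f x - ?f n x)\<^sup>2 = 0"
        unfolding eventually_sequentially by blast
      then show "(\<lambda>n. (f x - ?f n x)\<^sup>2) \<longlonglongrightarrow> 0" by (rule tendsto_eventually)
    qed
    show "AE x in lebesgue_on \<Omega>. norm ((f x - ?f n x)\<^sup>2) \<le> (f x)\<^sup>2" for n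
    proof (intro always_eventually allI)
      fix x
      have "\<bar>f x - ?f n x\<bar> \<le> \<bar>f x\<bar>" by linarith
      then show "norm ((f x - ?f n x)\<^sup>2) \<le> (f x)\<^sup>2" by (simp add: abs_le_square_iff)
    qed
  qed measurable
  then have "(\<lambda>n. (L2_dist \<Omega> f (?f n))\<^sup>2) \<longlonglongrightarrow> 0" by (simp add: L2_dist_def L2_norm_sq)
  from tendsto_real_sqrt[OF this] show "(\<lambda>n. L2_dist \<Omega> f (?f n)) \<longlonglongrightarrow> 0"
    by (simp add: L2_dist_nonneg)
qed

text \<open>
  \<open>\<Gamma>\<close>-convergence is stated for \<open>closure_form\<close>, which is meaningful only for closable forms, and
  admissibility does not exclude forms that are not closable (a point mass of \<open>\<kappa>\<close> at a point where
  \<open>theta_hat\<close> is not locally finite is not controlled by it).  But the functional of a form that is not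
  closable is constant on its domain, and this is incompatible with a \<open>\<Gamma>\<close>-limit.
\<close>

locale gamma_convergent_pairs = lim: boundary_pair \<Omega> \<kappa> \<theta>
  for \<Omega> :: "'a::euclidean_space set" and \<kappa> \<theta> +
  fixes \<kappa>s :: "nat \<Rightarrow> 'a measure" and \<theta>s :: "nat \<Rightarrow> ('a \<times> 'a) measure"
  assumes pairs: "\<And>n. boundary_pair \<Omega> (\<kappa>s n) (\<theta>s n)"
    and gamma: "gamma_converges \<Omega> \<kappa>s \<theta>s \<kappa> \<theta>"
begin

sublocale S: boundary_pair \<Omega> "\<kappa>s n" "\<theta>s n" for n
  by (rule pairs)

abbreviation "F \<equiv> energy_functional \<Omega> \<kappa> \<theta>"
abbreviation "Fs n \<equiv> energy_functional \<Omega> (\<kappa>s n) (\<theta>s n)"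

lemma gamma_liminf:
  assumes "u \<in> L2_space \<Omega>" "\<And>n. us n \<in> L2_space \<Omega>" "(\<lambda>n. L2_dist \<Omega> (us n) u) \<longlonglongrightarrow> 0"
  shows "F u \<le> liminf (\<lambda>n. Fs n (us n))"
  using gamma assms unfolding gamma_converges_def Gamma_converges_def by blast

lemma gamma_recovery:
  assumes "u \<in> L2_space \<Omega>"
  obtains us where "\<And>n. us n \<in> L2_space \<Omega>" "(\<lambda>n. L2_dist \<Omega> (us n) u) \<longlonglongrightarrow> 0"
    "F u = limsup (\<lambda>n. Fs n (us n))"
  using gamma assms unfolding gamma_converges_def Gamma_converges_def by blast

text \<open>The functional is infinite outside its domain, so a finite bound on the upper limit also
  forces membership.\<close>

lemma recovery_energy_bound:
  assumes "F u = limsup (\<lambda>n. Fs n (us n))" "F u < ereal c"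
  shows "\<forall>\<^sub>F n in sequentially. us n \<in> S.D n \<and> S.cf n (us n) (us n) < c"
proof -
  have "\<forall>\<^sub>F n in sequentially. Fs n (us n) < ereal c"
    using assms by (intro Limsup_lessD) simp
  then show ?thesis
    by eventually_elim (auto simp: energy_functional_def split: if_splits)
qed

text \<open>No box fits into the empty set, so this case is split off; there all integrals
  vanish.\<close>

lemma empty_closable: "\<Omega> = {} \<Longrightarrow> lim.closable" "\<Omega> = {} \<Longrightarrow> S.closable n"
proof -
  have *: "boundary_pair.closable \<Omega> k t" if "boundary_pair \<Omega> k t" "\<Omega> = {}" for k t
  proof -
    interpret B: boundary_pair \<Omega> k t by fact
    have "space k = {}" "space t = {}"
      using sets_eq_imp_space_eq[OF B.sets_\<kappa>] sets_eq_imp_space_eq[OF B.sets_\<theta>] that(2)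
      by (auto simp: space_restrict_space off_diagonal_def)
    then have "B.E u u = 0" for u
      unfolding B.form_eq using that(2) by (simp add: Bochner_Integration.integral_empty space_restrict_space)
    then show ?thesis by (simp add: B.closable_def)
  qed
  show "\<Omega> = {} \<Longrightarrow> lim.closable" by (rule *[OF lim.boundary_pair_axioms])
  show "\<Omega> = {} \<Longrightarrow> S.closable n" by (rule *[OF pairs])
qed

text \<open>At nonclosable indices the functional has one fixed value on all test functions. If
  there were infinitely many, bumps converging to the box indicator would have a finite lower limit
  of energies, and the \<Gamma>-liminf inequality would put the indicator into the domain of the
  limit form, although it has no weak derivative.\<close>

lemma eventually_closable: "\<forall>\<^sub>F n in sequentially. S.closable n"
proof (rule ccontr)
  assume "\<not> (\<forall>\<^sub>F n in sequentially. S.closable n)"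
  then have freq: "\<exists>\<^sub>F n in sequentially. \<not> S.closable n" by (simp add: frequently_def)
  then have "\<Omega> \<noteq> {}" using empty_closable(2) by (auto simp: frequently_def)
  from box_indicator_no_weak_derivative[OF lim.open_\<Omega> lim.bounded_\<Omega> this]
  obtain u :: "'a \<Rightarrow> real" and y and \<phi>s where u: "u \<in> L2_space \<Omega>" "\<And>n. \<phi>s n \<in> test_functions \<Omega>"
    "(\<lambda>n. L2_dist \<Omega> (\<phi>s n) u) \<longlonglongrightarrow> 0" "\<And>C. 0 \<le> C \<Longrightarrow> \<not> weak_deriv_bound \<Omega> u y C" by metis
  have D: "\<phi>s n \<in> S.D n" for n
    using S.test_function_form_domain[OF u(2)] S.form_domain_subset_closure by blast
  have "Fs n (\<phi>s n) \<le> ereal (THE r. False)" if "\<not> S.closable n" for n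
    using S.closure_form_not_closable[OF that D] D by (simp add: energy_functional_def)
  then have "\<exists>\<^sub>F n in sequentially. Fs n (\<phi>s n) \<le> ereal (THE r. False)"
    using freq by (auto elim: frequently_elim1)
  then have "liminf (\<lambda>n. Fs n (\<phi>s n)) \<le> ereal (THE r. False)" by (rule liminf_le_of_frequently)
  moreover have "F u \<le> liminf (\<lambda>n. Fs n (\<phi>s n))"
    by (rule gamma_liminf[OF u(1) S.closure_domain_L2[OF D] u(3)])
  ultimately have "F u \<noteq> \<infinity>" by auto
  then have "u \<in> lim.D" by (auto simp: energy_functional_def split: if_splits)
  then obtain C where "0 \<le> C" "weak_deriv_bound \<Omega> u y (norm y * C)"
    using lim.closure_domain_weak_deriv_bound by blast
  then show False using u(4)[of "norm y * C"] by simp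
qed

text \<open>If the limit functional were constant on its domain, recovery sequences would give every
  test function the same bound on its weak derivatives, regardless of its size, and the bound would
  pass to the box indicator. Closability of the approximating forms comes first because their
  energies must control derivatives.\<close>

lemma limit_closable: "lim.closable"
proof (rule ccontr)
  assume nc: "\<not> lim.closable"
  then have "\<Omega> \<noteq> {}" using empty_closable(1) by blast
  from box_indicator_no_weak_derivative[OF lim.open_\<Omega> lim.bounded_\<Omega> this]
  obtain u :: "'a \<Rightarrow> real" and y and \<phi>s where u: "u \<in> L2_space \<Omega>" "\<And>n. \<phi>s n \<in> test_functions \<Omega>"
    "(\<lambda>n. L2_dist \<Omega> (\<phi>s n) u) \<longlonglongrightarrow> 0" "\<And>C. 0 \<le> C \<Longrightarrow> \<not> weak_deriv_bound \<Omega> u y C" by metis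
  \<comment> \<open>Nonnegative and strictly above the unspecified constant.\<close>
  define J where "J = \<bar>THE r::real. False\<bar> + 1"
  have J: "0 \<le> J" by (simp add: J_def)
  let ?c = "norm y * sqrt J"
  have test: "weak_deriv_bound \<Omega> \<phi> y ?c" if \<phi>: "\<phi> \<in> test_functions \<Omega>" for \<phi>
    unfolding weak_deriv_bound_def
  proof
    fix \<psi> assume \<psi>: "\<psi> \<in> test_functions \<Omega>"
    have \<phi>D: "\<phi> \<in> lim.D"
      using lim.test_function_form_domain[OF \<phi>] lim.form_domain_subset_closure by blast
    note \<phi>L = lim.closure_domain_L2[OF \<phi>D]
    obtain us where us: "\<And>n. us n \<in> L2_space \<Omega>" "(\<lambda>n. L2_dist \<Omega> (us n) \<phi>) \<longlonglongrightarrow> 0"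
      "F \<phi> = limsup (\<lambda>n. Fs n (us n))"
      using gamma_recovery[OF \<phi>L] by blast
    have "F \<phi> = ereal (THE r. False)"
      using \<phi>D lim.closure_form_not_closable[OF nc \<phi>D] by (simp add: energy_functional_def)
    then have "F \<phi> < ereal J" by (simp add: J_def)
    from recovery_energy_bound[OF us(3) this] eventually_closable
    have ev: "\<forall>\<^sub>F n in sequentially. \<bar>L2_inner \<Omega> (us n) (dderiv \<psi> y)\<bar> \<le> ?c * L2_norm \<Omega> \<psi>"
    proof eventually_elim
      case (elim n)
      have "\<bar>L2_inner \<Omega> (us n) (dderiv \<psi> y)\<bar> \<le> norm y * sqrt (S.cf n (us n) (us n)) * L2_norm \<Omega> \<psi>"
        using S.closable_weak_deriv_bound[of n "us n" y] elim \<psi> by (auto simp: weak_deriv_bound_def)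
      also have "\<dots> \<le> ?c * L2_norm \<Omega> \<psi>"
        using elim by (intro mult_right_mono mult_left_mono real_sqrt_le_mono L2_norm_nonneg) auto
      finally show ?case .
    qed
    have "(\<lambda>n. \<bar>L2_inner \<Omega> (us n) (dderiv \<psi> y)\<bar>) \<longlonglongrightarrow> \<bar>L2_inner \<Omega> \<phi> (dderiv \<psi> y)\<bar>"
      by (intro tendsto_rabs L2_inner_tendsto us \<phi>L test_function_L2(2)[OF lim.bounded_\<Omega> lim.sets_\<Omega> \<psi>])
    from tendsto_upperbound[OF this ev]
    show "\<bar>L2_inner \<Omega> \<phi> (dderiv \<psi> y)\<bar> \<le> ?c * L2_norm \<Omega> \<psi>" by simp
  qed
  have "weak_deriv_bound \<Omega> u y ?c"
    unfolding weak_deriv_bound_def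
  proof
    fix \<psi> assume \<psi>: "\<psi> \<in> test_functions \<Omega>"
    have "(\<lambda>n. \<bar>L2_inner \<Omega> (\<phi>s n) (dderiv \<psi> y)\<bar>) \<longlonglongrightarrow> \<bar>L2_inner \<Omega> u (dderiv \<psi> y)\<bar>"
      by (intro tendsto_rabs L2_inner_tendsto u(1,3) test_function_L2(1)[OF lim.bounded_\<Omega> lim.sets_\<Omega> u(2)]
          test_function_L2(2)[OF lim.bounded_\<Omega> lim.sets_\<Omega> \<psi>])
    then show "\<bar>L2_inner \<Omega> u (dderiv \<psi> y)\<bar> \<le> ?c * L2_norm \<Omega> \<psi>"
      by (rule tendsto_upperbound) (use weak_deriv_boundD[OF test[OF u(2)] \<psi>] in auto)
  qed
  then show False using u(4)[of ?c] J by simp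
qed

subsection \<open>Convergence of the resolvents\<close>

text \<open>The fundamental theorem of \<Gamma>-convergence along a subsequence: the limit w of
  minimizers is compared, through a recovery sequence, with the minimizer u, and the excess term in
  \<open>weak_solution_minimal\<close> forces w = u in L^2.\<close>

lemma limit_is_weak_solution:
  assumes "0 < \<mu>" "f \<in> L2_space \<Omega>" "strict_mono q" "w \<in> L2_space \<Omega>" "\<And>n. us n \<in> L2_space \<Omega>"
    and sol: "\<And>k. S.closable (q k)" "\<And>k. S.weak_solution (q k) \<mu> f (us (q k))"
    and conv: "(\<lambda>k. L2_dist \<Omega> (us (q k)) w) \<longlonglongrightarrow> 0" and u: "lim.weak_solution \<mu> f u"
  shows "L2_dist \<Omega> w u = 0"
proof -
  \<comment> \<open>\<Gamma>-convergence is stated for whole sequences, so the gaps of the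
    subsequence are filled with the limit itself.\<close>
  define zs where "zs n = (if n \<in> range q then us n else w)" for n
  have zL: "zs n \<in> L2_space \<Omega>" for n using assms(4,5) by (simp add: zs_def)
  have "(\<lambda>n. L2_dist \<Omega> (zs n) w) \<longlonglongrightarrow> 0"
  proof (rule LIMSEQ_I)
    fix e :: real assume e: "0 < e"
    obtain K where K: "\<And>k. k \<ge> K \<Longrightarrow> L2_dist \<Omega> (us (q k)) w < e"
      using order_tendstoD(2)[OF conv e] by (auto simp: eventually_sequentially)
    have "norm (L2_dist \<Omega> (zs n) w - 0) < e" if "n \<ge> q K" for n
    proof (cases "n \<in> range q")
      case True
      then obtain k where k: "n = q k" by blast
      then have "K \<le> k" using that assms(3) by (simp add: strict_mono_less_eq)
      then show ?thesis using K k by (simp add: zs_def L2_dist_nonneg)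
    next
      case False
      then show ?thesis using e L2_dist_eq_0_iff[OF assms(4,4)] by (simp add: zs_def)
    qed
    then show "\<exists>N. \<forall>n\<ge>N. norm (L2_dist \<Omega> (zs n) w - 0) < e" by blast
  qed
  then have "F w \<le> liminf (\<lambda>n. Fs n (zs n))" by (rule gamma_liminf[OF assms(4) zL])
  also have "\<dots> \<le> liminf ((\<lambda>n. Fs n (zs n)) \<circ> q)" by (rule liminf_subseq_mono[OF assms(3)])
  also have "(\<lambda>n. Fs n (zs n)) \<circ> q = (\<lambda>k. ereal (S.cf (q k) (us (q k)) (us (q k))))"
    using sol(2) by (auto simp: fun_eq_iff zs_def energy_functional_def S.weak_solution_def)
  finally have lower: "F w \<le> liminf (\<lambda>k. ereal (S.cf (q k) (us (q k)) (us (q k))))" .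
  \<comment> \<open>A uniform energy bound makes F w finite, so w belongs to the domain of the limit
    form.\<close>
  let ?B = "(L2_norm \<Omega> f)\<^sup>2 / \<mu>"
  have "liminf (\<lambda>k. ereal (S.cf (q k) (us (q k)) (us (q k)))) \<le> ereal ?B"
    using S.weak_solution_form_le[OF sol(1) assms(1,2) sol(2)]
    by (intro liminf_le_of_frequently eventually_frequently always_eventually) auto
  then have "F w \<noteq> \<infinity>" using lower by auto
  then have wD: "w \<in> lim.D" by (auto simp: energy_functional_def split: if_splits)
  then have Fw: "F w = ereal (lim.cf w w)" by (simp add: energy_functional_def)
  have uD: "u \<in> lim.D" using u by (simp add: lim.weak_solution_def)
  then have Fu: "F u = ereal (lim.cf u u)" by (simp add: energy_functional_def)
  note uL = lim.closure_domain_L2[OF uD]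
  obtain vs where vs: "\<And>n. vs n \<in> L2_space \<Omega>" "(\<lambda>n. L2_dist \<Omega> (vs n) u) \<longlonglongrightarrow> 0"
    "F u = limsup (\<lambda>n. Fs n (vs n))"
    using gamma_recovery[OF uL] by blast
  have q: "filterlim q sequentially sequentially" by (rule filterlim_subseq[OF assms(3)])
  have vq: "(\<lambda>k. L2_dist \<Omega> (vs (q k)) u) \<longlonglongrightarrow> 0" by (rule filterlim_compose[OF vs(2) q])
  let ?g = "\<lambda>v. \<mu> * L2_inner \<Omega> v v - 2 * L2_inner \<Omega> f v"
  have glim: "(\<lambda>k. ?g (xs k)) \<longlonglongrightarrow> ?g x"
    if "\<And>k. xs k \<in> L2_space \<Omega>" "x \<in> L2_space \<Omega>" "(\<lambda>k. L2_dist \<Omega> (xs k) x) \<longlonglongrightarrow> 0" for xs x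
  proof -
    have "(\<lambda>k. L2_inner \<Omega> (xs k) f) \<longlonglongrightarrow> L2_inner \<Omega> x f"
      by (rule L2_inner_tendsto[OF that(1,2) assms(2) that(3)])
    then have "(\<lambda>k. L2_inner \<Omega> f (xs k)) \<longlonglongrightarrow> L2_inner \<Omega> f x"
      using L2.sym[OF assms(2) that(1)] L2.sym[OF assms(2) that(2)] by simp
    then show ?thesis
      by (intro tendsto_intros L2_inner_tendsto2[OF that(1,2,1,2,3,3)])
  qed
  \<comment> \<open>Half of \<delta> is spent on the lower limit for w and half on the upper limit
    for u; \<open>?g\<close> is continuous in L^2.\<close>
  have "lim.cf w w + ?g w \<le> lim.cf u u + ?g u + \<delta>" if \<delta>: "0 < \<delta>" for \<delta>
  proof -
    have "ereal (lim.cf w w - \<delta> / 2) < F w" using Fw \<delta> by simp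
    then have "ereal (lim.cf w w - \<delta> / 2) < liminf (\<lambda>k. ereal (S.cf (q k) (us (q k)) (us (q k))))"
      using lower by (rule less_le_trans)
    then have 1: "\<forall>\<^sub>F k in sequentially. lim.cf w w - \<delta> / 2 < S.cf (q k) (us (q k)) (us (q k))"
      by (auto dest: less_LiminfD)
    have "F u < ereal (lim.cf u u + \<delta> / 2)" using Fu \<delta> by simp
    from eventually_compose_filterlim[OF recovery_energy_bound[OF vs(3) this] q] 1
    have "\<forall>\<^sub>F k in sequentially. lim.cf w w - \<delta> / 2 + ?g (us (q k)) \<le> lim.cf u u + \<delta> / 2 + ?g (vs (q k))"
    proof eventually_elim
      case (elim k)
      have "0 \<le> \<mu> * (L2_dist \<Omega> (vs (q k)) (us (q k)))\<^sup>2" using assms(1) by simp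
      then have "S.cf (q k) (us (q k)) (us (q k)) + ?g (us (q k)) \<le> S.cf (q k) (vs (q k)) (vs (q k)) + ?g (vs (q k))"
        using S.weak_solution_minimal[OF sol(1)[of k] sol(2)[of k] _ assms(1,2), of "vs (q k)"] elim by linarith
      then show ?case using elim by linarith
    qed
    moreover have "(\<lambda>k. lim.cf w w - \<delta> / 2 + ?g (us (q k))) \<longlonglongrightarrow> lim.cf w w - \<delta> / 2 + ?g w"
      by (intro tendsto_add tendsto_const glim assms(4,5) conv)
    moreover have "(\<lambda>k. lim.cf u u + \<delta> / 2 + ?g (vs (q k))) \<longlonglongrightarrow> lim.cf u u + \<delta> / 2 + ?g u"
      by (intro tendsto_add tendsto_const glim vs(1) uL vq)
    ultimately have "lim.cf w w - \<delta> / 2 + ?g w \<le> lim.cf u u + \<delta> / 2 + ?g u"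
      using tendsto_le[OF sequentially_bot] by blast
    then show ?thesis by linarith
  qed
  then have "lim.cf w w + ?g w \<le> lim.cf u u + ?g u" by (rule field_le_epsilon)
  then have "\<mu> * (L2_dist \<Omega> w u)\<^sup>2 \<le> 0"
    using lim.weak_solution_minimal[OF limit_closable u wD assms(1,2)] by linarith
  then show ?thesis using assms(1) by (simp add: mult_le_0_iff)
qed

text \<open>By contradiction: resolvents staying e away from the limit would, by compactness, have a
  subsequence converging to a weak solution of the limit problem, which is unique.\<close>

lemma bounded_resolvent_convergence:
  assumes "0 < \<mu>" "f \<in> L2_space \<Omega>" "\<And>x. \<bar>f x\<bar> \<le> \<mu> * M"
  shows "(\<lambda>n. L2_dist \<Omega> (resolvent \<Omega> (laplacian \<Omega> (\<kappa>s n) (\<theta>s n)) \<mu> f) (resolvent \<Omega> (laplacian \<Omega> \<kappa> \<theta>) \<mu> f))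
    \<longlonglongrightarrow> 0" (is "(\<lambda>n. L2_dist \<Omega> (?R n) ?u) \<longlonglongrightarrow> 0")
proof (rule ccontr)
  assume "\<not> (\<lambda>n. L2_dist \<Omega> (?R n) ?u) \<longlonglongrightarrow> 0"
  then obtain e where e: "0 < e" "\<And>N. \<exists>n\<ge>N. e \<le> L2_dist \<Omega> (?R n) ?u"
    unfolding LIMSEQ_def by (auto simp: not_less L2_dist_nonneg dist_real_def)
  obtain N0 where N0: "\<And>n. n \<ge> N0 \<Longrightarrow> S.closable n"
    using eventually_closable by (auto simp: eventually_sequentially)
  have "infinite {n. N0 \<le> n \<and> e \<le> L2_dist \<Omega> (?R n) ?u}"
    unfolding infinite_nat_iff_unbounded_le
  proof
    fix m
    obtain n where "max N0 m \<le> n" "e \<le> L2_dist \<Omega> (?R n) ?u" using e(2) by blast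
    then show "\<exists>n\<ge>m. n \<in> {n. N0 \<le> n \<and> e \<le> L2_dist \<Omega> (?R n) ?u}" by auto
  qed
  then obtain s :: "nat \<Rightarrow> nat" where s: "strict_mono s" "\<And>k. N0 \<le> s k" "\<And>k. e \<le> L2_dist \<Omega> (?R (s k)) ?u"
    using infinite_enumerate by blast
  have u: "lim.weak_solution \<mu> f ?u" by (rule lim.resolvent_weak_solution[OF limit_closable assms(1,2)])
  have "0 \<le> \<mu> * M" using assms(3)[of 0] by linarith
  then have M: "0 \<le> M" using assms(1) by (simp add: zero_le_mult_iff)
  \<comment> \<open>\<open>resolvent\<close> is an arbitrary representative and may be unbounded on
    a null set, so pointwise bounded solutions are chosen separately; 0 is a placeholder at the
    finitely many indices without closability.\<close>
  have "\<exists>v. v \<in> L2_space \<Omega> \<and> (\<forall>x. \<bar>v x\<bar> \<le> M) \<and> (S.closable n \<longrightarrow> S.weak_solution n \<mu> f v)" for n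
  proof (cases "S.closable n")
    case True
    then show ?thesis using S.weak_solution_exists_bounded[OF True assms] S.weak_solution_L2 by blast
  next
    case False
    then show ?thesis using M L2.zero by (intro exI[of _ "\<lambda>_. 0"]) auto
  qed
  then obtain us where us: "\<And>n. us n \<in> L2_space \<Omega>" "\<And>n x. \<bar>us n x\<bar> \<le> M"
    "\<And>n. S.closable n \<Longrightarrow> S.weak_solution n \<mu> f (us n)" by metis
  let ?C = "sqrt ((L2_norm \<Omega> f)\<^sup>2 / \<mu>)"
  have bound: "weak_deriv_bound \<Omega> (us (s k)) y (norm y * ?C)" for k y
    unfolding weak_deriv_bound_def
  proof
    fix \<phi> assume \<phi>: "\<phi> \<in> test_functions \<Omega>"
    note c = N0[OF s(2)[of k]]
    have "us (s k) \<in> S.D (s k)" using us(3)[OF c] by (simp add: S.weak_solution_def)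
    from weak_deriv_boundD[OF S.closable_weak_deriv_bound[OF c this] \<phi>]
    have "\<bar>L2_inner \<Omega> (us (s k)) (dderiv \<phi> y)\<bar>
        \<le> norm y * sqrt (S.cf (s k) (us (s k)) (us (s k))) * L2_norm \<Omega> \<phi>" .
    also have "\<dots> \<le> norm y * ?C * L2_norm \<Omega> \<phi>"
      by (intro mult_right_mono mult_left_mono real_sqrt_le_mono L2_norm_nonneg norm_ge_zero
          S.weak_solution_form_le[OF c assms(1,2) us(3)[OF c]])
    finally show "\<bar>L2_inner \<Omega> (us (s k)) (dderiv \<phi> y)\<bar> \<le> norm y * ?C * L2_norm \<Omega> \<phi>" .
  qed
  have C: "0 \<le> ?C" using assms(1) by simp
  obtain r where r: "strict_mono r" "L2.cauchy \<Omega> (\<lambda>k. us (s (r k)))"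
    using bounded_Rellich[of \<Omega> "\<lambda>k. us (s k)", OF lim.open_\<Omega> lim.bounded_\<Omega> us(1,2) bound C] by blast
  obtain w where w: "w \<in> L2_space \<Omega>" "(\<lambda>k. L2_dist \<Omega> (us (s (r k))) w) \<longlonglongrightarrow> 0"
    using L2_complete[of "\<lambda>k. us (s (r k))" \<Omega>, OF us(1) r(2)] by blast
  have cl: "S.closable (s (r k))" for k by (rule N0[OF s(2)])
  have "strict_mono (\<lambda>k. s (r k))" using strict_mono_o[OF s(1) r(1)] by (simp add: o_def)
  then have wu: "L2_dist \<Omega> w ?u = 0"
    by (rule limit_is_weak_solution[OF assms(1,2) _ w(1) us(1) cl us(3)[OF cl] w(2) u])
  note uL = lim.weak_solution_L2[OF u]
  have "e \<le> L2_dist \<Omega> (us (s (r k))) w" for k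
  proof -
    note Rk = S.resolvent_weak_solution[OF cl assms(1,2), of k]
    \<comment> \<open>Uniqueness identifies the chosen resolvent with the bounded solution in
      L^2.\<close>
    have "\<mu> * L2_dist \<Omega> (?R (s (r k))) (us (s (r k))) \<le> L2_dist \<Omega> f f"
      by (rule S.weak_solution_dist[OF cl assms(1,2,2) Rk us(3)[OF cl]])
    also have "L2_dist \<Omega> f f = 0" using L2_dist_eq_0_iff[OF assms(2,2)] by simp
    finally have "L2_dist \<Omega> (?R (s (r k))) (us (s (r k))) \<le> 0" using assms(1) by (simp add: mult_le_0_iff)
    moreover have "L2_dist \<Omega> (?R (s (r k))) ?u
        \<le> L2_dist \<Omega> (?R (s (r k))) (us (s (r k))) + L2_dist \<Omega> (us (s (r k))) ?u"
      by (rule L2_dist_triangle[OF S.weak_solution_L2[OF Rk] us(1) uL])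
    moreover have "L2_dist \<Omega> (us (s (r k))) ?u \<le> L2_dist \<Omega> (us (s (r k))) w + L2_dist \<Omega> w ?u"
      by (rule L2_dist_triangle[OF us(1) w(1) uL])
    ultimately show ?thesis using s(3)[of "r k"] wu by linarith
  qed
  then have "e \<le> 0" by (intro LIMSEQ_le_const[OF w(2)]) blast
  then show False using e(1) by simp
qed

lemma resolvent_convergence:
  assumes "0 < \<mu>" "f \<in> L2_space \<Omega>"
  shows "(\<lambda>n. L2_dist \<Omega> (resolvent \<Omega> (laplacian \<Omega> (\<kappa>s n) (\<theta>s n)) \<mu> f) (resolvent \<Omega> (laplacian \<Omega> \<kappa> \<theta>) \<mu> f))
    \<longlonglongrightarrow> 0"
proof (rule LIMSEQ_I)
  let ?Rn = "\<lambda>n. resolvent \<Omega> (laplacian \<Omega> (\<kappa>s n) (\<theta>s n)) \<mu>" and ?R = "resolvent \<Omega> (laplacian \<Omega> \<kappa> \<theta>) \<mu>"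
  fix e :: real assume e: "0 < e"
  let ?f = "\<lambda>n x. max (- real n) (min (real n) (f x))"
  \<comment> \<open>Resolvents have norm at most 1 / \<mu>, so this tolerance for the data becomes
    e/3 for the solutions, once for index n and once for the limit; the remaining third is the
    convergence for the bounded g.\<close>
  have "0 < \<mu> * (e / 3)" using e assms(1) by simp
  from order_tendstoD(2)[OF L2_truncation_tendsto(2)[OF assms(2)] this]
  obtain k where k: "L2_dist \<Omega> f (?f k) < \<mu> * (e / 3)" by (auto simp: eventually_sequentially)
  define g where "g = ?f k"
  have g: "g \<in> L2_space \<Omega>" unfolding g_def by (rule L2_truncation_tendsto(1)[OF assms(2)])
  have fg: "L2_dist \<Omega> f g < \<mu> * (e / 3)" using k by (simp add: g_def)
  have "\<bar>g x\<bar> \<le> \<mu> * (real k / \<mu>)" for x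
  proof -
    have "\<bar>g x\<bar> \<le> real k" unfolding g_def by linarith
    then show ?thesis using assms(1) by simp
  qed
  from bounded_resolvent_convergence[OF assms(1) g this]
  have "(\<lambda>n. L2_dist \<Omega> (?Rn n g) (?R g)) \<longlonglongrightarrow> 0" .
  then have ev: "\<forall>\<^sub>F n in sequentially. L2_dist \<Omega> (?Rn n g) (?R g) < e / 3"
    using e by (intro order_tendstoD(2)) auto
  have close: "d < e / 3" if "\<mu> * d \<le> L2_dist \<Omega> f g" for d
    using that fg assms(1) by (metis le_less_trans mult_less_cancel_left_pos)
  note Rf = lim.resolvent_weak_solution[OF limit_closable assms] and Rg = lim.resolvent_weak_solution[OF limit_closable assms(1) g]
  have R: "L2_dist \<Omega> (?R g) (?R f) < e / 3"
    using close[OF lim.weak_solution_dist[OF limit_closable assms(1,2) g Rf Rg]] by (simp add: L2_dist_sym)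
  have "\<forall>\<^sub>F n in sequentially. norm (L2_dist \<Omega> (?Rn n f) (?R f) - 0) < e"
    using ev eventually_closable
  proof eventually_elim
    case (elim n)
    note Rnf = S.resolvent_weak_solution[OF elim(2) assms] and Rng = S.resolvent_weak_solution[OF elim(2) assms(1) g]
    have "L2_dist \<Omega> (?Rn n f) (?Rn n g) < e / 3"
      by (rule close[OF S.weak_solution_dist[OF elim(2) assms(1,2) g Rnf Rng]])
    moreover have "L2_dist \<Omega> (?Rn n f) (?R f) \<le> L2_dist \<Omega> (?Rn n f) (?Rn n g) + L2_dist \<Omega> (?Rn n g) (?R f)"
      by (rule L2_dist_triangle[OF S.weak_solution_L2[OF Rnf] S.weak_solution_L2[OF Rng] lim.weak_solution_L2[OF Rf]])
    moreover have "L2_dist \<Omega> (?Rn n g) (?R f) \<le> L2_dist \<Omega> (?Rn n g) (?R g) + L2_dist \<Omega> (?R g) (?R f)"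
      by (rule L2_dist_triangle[OF S.weak_solution_L2[OF Rng] lim.weak_solution_L2[OF Rg] lim.weak_solution_L2[OF Rf]])
    ultimately show ?case using elim(1) R by (simp add: L2_dist_nonneg)
  qed
  then show "\<exists>N. \<forall>n\<ge>N. norm (L2_dist \<Omega> (?Rn n f) (?R f) - 0) < e"
    by (simp add: eventually_sequentially)
qed

theorem strong_resolvent_convergence:
  "strong_resolvent_converges \<Omega> (\<lambda>n. laplacian \<Omega> (\<kappa>s n) (\<theta>s n)) (laplacian \<Omega> \<kappa> \<theta>)"
  unfolding strong_resolvent_converges_def
proof (intro allI impI conjI ballI)
  fix \<mu> :: real assume \<mu>: "0 < \<mu>"
  show "in_resolvent_set \<Omega> (laplacian \<Omega> \<kappa> \<theta>) \<mu>"
    by (rule lim.in_resolvent_set_laplacian[OF limit_closable \<mu>])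
  show "\<forall>\<^sub>F n in sequentially. in_resolvent_set \<Omega> (laplacian \<Omega> (\<kappa>s n) (\<theta>s n)) \<mu>"
    using eventually_closable by eventually_elim (rule S.in_resolvent_set_laplacian[OF _ \<mu>])
qed (rule resolvent_convergence)

end

theorem proposition6p5:
  fixes \<Omega> :: "'a::euclidean_space set"
    and \<kappa>\<^sub>n :: "nat \<Rightarrow> 'a measure" and \<theta>\<^sub>n :: "nat \<Rightarrow> ('a \<times> 'a) measure"
    and \<kappa> :: "'a measure" and \<theta> :: "('a \<times> 'a) measure"
  assumes "open \<Omega>" and "bounded \<Omega>"
    and "\<And>n. admissible_pair \<Omega> (\<kappa>\<^sub>n n) (\<theta>\<^sub>n n)"
    and "admissible_pair \<Omega> \<kappa> \<theta>"
    and "gamma_converges \<Omega> \<kappa>\<^sub>n \<theta>\<^sub>n \<kappa> \<theta>"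
  shows "strong_resolvent_converges \<Omega>
           (\<lambda>n. laplacian \<Omega> (\<kappa>\<^sub>n n) (\<theta>\<^sub>n n)) (laplacian \<Omega> \<kappa> \<theta>)"
proof -
  have "boundary_pair \<Omega> k t" if "admissible_pair \<Omega> k t" for k t
    using that assms(1,2)
    by unfold_locales (auto simp: admissible_pair_def boundary_borel_measure_def symmetric_radon_measure_def)
  then interpret gamma_convergent_pairs \<Omega> \<kappa> \<theta> \<kappa>\<^sub>n \<theta>\<^sub>n
    using assms(3-5) by (intro gamma_convergent_pairs.intro gamma_convergent_pairs_axioms.intro) auto
  show ?thesis by (rule strong_resolvent_convergence)
qed

end
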